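(* Let $k\geq 2$, $\Gamma=J(2k,k)$, and suppose $G\leqslant\mathrm{Aut}(\Gamma)=S_{2k}\times\langle\tau\rangle$ is arc-transitive on $\Gamma$. Then either $G\cap S_{2k}$ is arc-transitive on $\Gamma$, or $k=2$, $G=\langle A_4,(1,2)\tau\rangle$ and $G\cap S_4=A_4$ has two orbits on arcs.
   Context: $J(2k,k)$ has vertices the $k$-subsets of $X=\{1,\dots,2k\}$, adjacent when they share $k-1$ points. $S_{2k}$ acts naturally and $\tau$ maps each $k$-subset to its complement in $X$. *)

theory Defs
  imports
    "HOL-Algebra.Sym_Groups"
    "HOL-Algebra.Group_Action"
    "Graph_Theory.Pair_Digraph"
begin

text \<open>
  A simple graph is represented by its symmetric loop-free digraph, so that \<^const>\<open>parcs\<close>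
  is exactly the set of arcs (ordered pairs of adjacent vertices).
\<close>

definition johnson_graph :: "nat \<Rightarrow> nat \<Rightarrow> nat set pair_pre_digraph" where
  "johnson_graph n k =
    (let V = {A. A \<subseteq> {1..n} \<and> card A = k}
     in \<lparr> pverts = V, parcs = {(A, B) \<in> V \<times> V. card (A \<inter> B) + 1 = k} \<rparr>)"

text \<open>
  As in \<^const>\<open>BijGroup\<close>, automorphisms are extensional functions on the vertex set, multiplied
  by composition (right factor first).
\<close>

definition aut_group :: "'a pair_pre_digraph \<Rightarrow> ('a \<Rightarrow> 'a) monoid" where
  "aut_group \<Gamma> = BijGroup (pverts \<Gamma>) \<lparr> carrier :=
     {f \<in> Bij (pverts \<Gamma>). \<forall>u \<in> pverts \<Gamma>. \<forall>v \<in> pverts \<Gamma>.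
        (f u, f v) \<in> parcs \<Gamma> \<longleftrightarrow> (u, v) \<in> parcs \<Gamma>} \<rparr>"

definition arc_action :: "'a pair_pre_digraph \<Rightarrow> ('a \<Rightarrow> 'a) \<Rightarrow> 'a \<times> 'a \<Rightarrow> 'a \<times> 'a" where
  "arc_action \<Gamma> f = (\<lambda>(u, v) \<in> parcs \<Gamma>. (f u, f v))"

definition arc_transitive :: "'a pair_pre_digraph \<Rightarrow> ('a \<Rightarrow> 'a) set \<Rightarrow> bool" where
  "arc_transitive \<Gamma> H \<longleftrightarrow>
     transitive_action (aut_group \<Gamma> \<lparr> carrier := H \<rparr>) (parcs \<Gamma>) (arc_action \<Gamma>)"

definition arc_orbits :: "'a pair_pre_digraph \<Rightarrow> ('a \<Rightarrow> 'a) set \<Rightarrow> ('a \<times> 'a) set set" where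
  "arc_orbits \<Gamma> H = orbits (aut_group \<Gamma> \<lparr> carrier := H \<rparr>) (parcs \<Gamma>) (arc_action \<Gamma>)"

definition induced_perm :: "nat \<Rightarrow> nat \<Rightarrow> (nat \<Rightarrow> nat) \<Rightarrow> nat set \<Rightarrow> nat set" where
  "induced_perm n k p = (\<lambda>A \<in> pverts (johnson_graph n k). p ` A)"

text \<open>The images of \<open>S\<^sub>n\<close> and \<open>A\<^sub>n\<close> in the automorphism group of \<open>J(n,k)\<close>.\<close>

definition induced_sym :: "nat \<Rightarrow> nat \<Rightarrow> (nat set \<Rightarrow> nat set) set" where
  "induced_sym n k = induced_perm n k ` carrier (sym_group n)"

definition induced_alt :: "nat \<Rightarrow> nat \<Rightarrow> (nat set \<Rightarrow> nat set) set" where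
  "induced_alt n k = induced_perm n k ` carrier (alt_group n)"

definition complement_map :: "nat \<Rightarrow> nat set \<Rightarrow> nat set" (\<open>\<tau>\<close>) where
  "\<tau> k = (\<lambda>A \<in> pverts (johnson_graph (2 * k) k). {1..2 * k} - A)"

end

theory Submission
  imports
    Defs
    Complex_Main
    "HOL-Computational_Algebra.Primes"
    "HOL-Algebra.Sylow"
    "HOL-Algebra.Multiplicative_Group"
begin

text \<open>
  An automorphism of \<open>J(2k,k)\<close> maps the \<open>k \<times> k\<close> grid of neighbours of a vertex to such a grid, so on a vertex and its
  neighbours it agrees with a permutation of the points, or with a permutation followed by complementation; and an
  automorphism that fixes a vertex and its neighbours is trivial. This gives the isomorphism.

  Let \<open>H\<close> be the group of permutations in \<open>G\<close>, of index at most 2. As the graph is connected and has triangles,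
  \<open>H\<close> is transitive on vertices. If \<open>k\<close> is odd, the stabiliser of a vertex in \<open>H\<close> is transitive on the
  \<open>k\<^sup>2\<close> neighbours, because two orbits would have equal size. If \<open>k \<ge> 4\<close> is even, Bertrand's postulate yields a
  prime \<open>k < p \<le> 2k - 3\<close>; it divides the number of vertices, so \<open>H\<close> contains a \<open>p\<close>-cycle. By the theorem of
  Livingstone and Wagner \<open>H\<close> is homogeneous on sets of size \<open>2k - p\<close>, and an argument of Jordan then gives a 3-cycle,
  hence all even permutations. If \<open>k = 2\<close>, the symmetric group acts regularly on arcs, and if \<open>H\<close> is not everything
  it has index 2 there.
\<close>

section \<open>Bertrand's postulate\<close>

text \<open>Because \<tau> commutes with every permutation, \<open>H\<close> is normal in
  \<open>G\<close>, so it has at most two orbits on arcs, of equal size. For odd \<open>k\<close>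
  parity rules out two orbits; for even \<open>k\<close> counting decides nothing and the structure
  of \<open>H\<close> has to be used: transitivity on vertices is homogeneity on
  \<open>k\<close>-subsets, and this forces the alternating group. The bounds on \<open>p\<close>
  have separate uses. From \<open>k < p\<close> it follows that \<open>p\<close> divides the number
  of \<open>k\<close>-subsets and that an element of order \<open>p\<close> is a single cycle;
  \<open>p \<le> 2 * k - 3\<close> leaves three fixed points, the least number whose permutations
  fail to commute. The alternating group is transitive on arcs as soon as some transposition fixes
  an arc. The ends of an arc share \<open>k - 1\<close> points, so such a transposition exists for
  \<open>k \<ge> 3\<close>, whereas for \<open>k = 2\<close> the stabiliser of an arc in the
  symmetric group is trivial; this is the origin of the exceptional group.\<close>

lemma prod_primes_dvd:
  fixes N :: nat
  assumes "finite A" "\<And>p. p \<in> A \<Longrightarrow> prime p" "\<And>p. p \<in> A \<Longrightarrow> p dvd N"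
  shows "\<Prod>A dvd N"
  using assms
proof (induction A rule: finite_induct)
  case (insert p A)
  have "coprime p (\<Prod>A)"
  proof (rule prod_coprime_right)
    fix q assume "q \<in> A"
    then have "p \<noteq> q" using insert.hyps by auto
    then show "coprime p q" using insert.prems(1) \<open>q \<in> A\<close> by (simp add: primes_coprime)
  qed
  moreover have "p dvd N" "\<Prod>A dvd N" using insert by auto
  ultimately show ?case using insert.hyps by (simp add: divides_mult)
qed auto

text \<open>\<open>p\<close> divides \<open>fact n\<close> but neither factorial in the denominator.
  It serves twice: for the primes above \<open>m + 1\<close> in the bound on products of primes, and
  for the number of vertices of the graph.\<close>

lemma prime_dvd_binomial:
  fixes p :: nat
  assumes "prime p" "k < p" "n - k < p" "p \<le> n"
  shows "p dvd (n choose k)"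
proof -
  have "k \<le> n" using assms by linarith
  then have "fact k * fact (n - k) * (n choose k) = fact n" by (rule binomial_fact_lemma)
  moreover have "p dvd fact n" using assms by (simp add: prime_dvd_fact_iff)
  ultimately have "p dvd fact k * fact (n - k) * (n choose k)" by simp
  moreover have "\<not> p dvd fact k" "\<not> p dvd fact (n - k)" using assms by (simp_all add: prime_dvd_fact_iff)
  ultimately show ?thesis using assms(1) by (metis prime_dvd_mult_iff)
qed

lemma binomial_middle_le: "(2 * m + 1) choose m \<le> (4::nat) ^ m"
proof -
  have "2 * ((2 * m + 1) choose m) = (\<Sum>k\<in>{m, m + 1}. (2 * m + 1) choose k)"
    using binomial_symmetric[of m "2 * m + 1"] by simp
  also have "\<dots> \<le> (\<Sum>k\<le>2 * m + 1. (2 * m + 1) choose k)"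
    by (rule sum_mono2) auto
  also have "\<dots> = 2 ^ (2 * m + 1)" by (rule choose_row_sum)
  also have "\<dots> = 2 * 4 ^ m" by (simp add: power_mult)
  finally show ?thesis by simp
qed

text \<open>The argument of Erdos: for \<open>n = 2 * m + 1\<close> the primes above
  \<open>m + 1\<close> all divide one binomial coefficient that is at most \<open>4 ^ m\<close>, and
  induction handles those up to \<open>m + 1\<close>. An even \<open>n > 2\<close> is no prime and
  adds no factor.\<close>

lemma primorial_le: "\<Prod>{p. prime p \<and> p \<le> n} \<le> (4::nat) ^ n"
proof (induction n rule: less_induct)
  case (less n)
  consider "n \<le> 1" | "n = 2" | "n > 2" "even n" | "n > 2" "odd n" by linarith
  then show ?case
  proof cases
    case 1
    then have "{p::nat. prime p \<and> p \<le> n} = {}" by (auto dest!: prime_ge_2_nat)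
    then show ?thesis by (simp only: prod.empty) simp
  next
    case 2
    then have "{p::nat. prime p \<and> p \<le> n} = {2}" using 2 by (auto dest!: prime_ge_2_nat)
    then show ?thesis using 2 by simp
  next
    case 3
    then have "\<not> prime n" using primes_dvd_imp_eq[of 2 n] by auto
    then have "p \<le> n \<longleftrightarrow> p \<le> n - 1" if "prime p" for p
      using that 3 by (cases "p = n") auto
    then have "{p::nat. prime p \<and> p \<le> n} = {p. prime p \<and> p \<le> n - 1}" by blast
    then have "\<Prod>{p::nat. prime p \<and> p \<le> n} \<le> 4 ^ (n - 1)" using less.IH[of "n - 1"] 3 by simp
    also have "\<dots> \<le> 4 ^ n" by (rule power_increasing) auto
    finally show ?thesis .
  next
    case 4
    then obtain m where m: "n = 2 * m + 1" by (elim oddE)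
    define B where "B = {p::nat. prime p \<and> m + 1 < p \<and> p \<le> n}"
    have fin: "finite {p::nat. prime p \<and> p \<le> m + 1}" "finite B" unfolding B_def by auto
    have "{p::nat. prime p \<and> p \<le> n} = {p. prime p \<and> p \<le> m + 1} \<union> B"
      using m by (auto simp: B_def)
    moreover have "{p::nat. prime p \<and> p \<le> m + 1} \<inter> B = {}" by (auto simp: B_def)
    ultimately have "\<Prod>{p::nat. prime p \<and> p \<le> n} = \<Prod>{p. prime p \<and> p \<le> m + 1} * \<Prod>B"
      using fin by (simp add: prod.union_disjoint)
    moreover have "\<Prod>B dvd (n choose m)"
      using fin(2) by (rule prod_primes_dvd) (auto simp: B_def m intro!: prime_dvd_binomial)
    then have "\<Prod>B \<le> (n choose m)" using m by (intro dvd_imp_le) auto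
    then have "\<Prod>B \<le> 4 ^ m" using binomial_middle_le[of m] m by simp
    moreover have "\<Prod>{p. prime p \<and> p \<le> m + 1} \<le> (4::nat) ^ (m + 1)" using less.IH[of "m + 1"] m 4 by simp
    ultimately have "\<Prod>{p::nat. prime p \<and> p \<le> n} \<le> 4 ^ (m + 1) * 4 ^ m"
      using mult_le_mono[of "\<Prod>{p. prime p \<and> p \<le> m + 1}" "4 ^ (m + 1)" "\<Prod>B" "4 ^ m"] by simp
    also have "\<dots> = 4 ^ n" by (simp add: m power_add[symmetric] mult_2)
    finally show ?thesis .
  qed
qed

text \<open>Legendre's formula. Passing from \<open>n\<close> to \<open>Suc n\<close> raises the
  quotient by \<open>p ^ i\<close> by one exactly when \<open>p ^ i\<close> divides
  \<open>Suc n\<close>, and there are as many such \<open>i\<close> as the multiplicity. The cutoff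
  \<open>M\<close> is free, so that the sums for \<open>n\<close> and \<open>2 * n\<close> can be
  taken over the same range and compared term by term.\<close>

lemma multiplicity_fact_eq_sum:
  fixes p :: nat
  assumes "prime p" "n \<le> M"
  shows "multiplicity p (fact n) = (\<Sum>i\<in>{1..M}. n div p ^ i)"
  using assms(2)
proof (induction n)
  case (Suc n)
  let ?m = "multiplicity p (Suc n)"
  have p1: "p > 1" using assms(1) prime_gt_1_nat by blast
  have dvd_iff: "p ^ i dvd Suc n \<longleftrightarrow> i \<le> ?m" for i
    using assms(1) by (intro power_dvd_iff_le_multiplicity) auto
  have "?m \<le> M"
  proof -
    have "?m < p ^ ?m" using p1 by (simp add: power_gt_expt)
    also have "\<dots> \<le> Suc n" by (intro dvd_imp_le multiplicity_dvd) auto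
    finally show ?thesis using Suc.prems by simp
  qed
  have "(\<Sum>i\<in>{1..M}. Suc n div p ^ i) = (\<Sum>i\<in>{1..M}. n div p ^ i + (if i \<le> ?m then 1 else 0))"
    using p1 by (intro sum.cong refl) (auto simp: div_Suc dvd_iff[symmetric] dvd_eq_mod_eq_0)
  also have "\<dots> = (\<Sum>i\<in>{1..M}. n div p ^ i) + card {i\<in>{1..M}. i \<le> ?m}"
    by (simp add: sum.distrib sum.inter_filter[symmetric])
  also have "{i\<in>{1..M}. i \<le> ?m} = {1..?m}" using \<open>?m \<le> M\<close> by auto
  also have "(\<Sum>i\<in>{1..M}. n div p ^ i) = multiplicity p (fact n)" using Suc by simp
  also have "\<dots> + card {1..?m} = multiplicity p (Suc n * fact n)"
    using assms(1) by (subst prime_elem_multiplicity_mult_distrib) auto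
  finally show ?case by simp
qed simp

lemma multiplicity_central_binomial:
  fixes p :: nat
  assumes "prime p"
  shows "multiplicity p ((2 * n) choose n) + 2 * (\<Sum>i\<in>{1..2 * n}. n div p ^ i)
           = (\<Sum>i\<in>{1..2 * n}. (2 * n) div p ^ i)"
proof -
  have "fact n * fact n * ((2 * n) choose n) = (fact (2 * n) :: nat)"
    using binomial_fact_lemma[of n "2 * n"] by simp
  then have "multiplicity p (fact (2 * n)) = multiplicity p (fact n * fact n * ((2 * n) choose n))"
    by simp
  also have "\<dots> = multiplicity p (fact n) + multiplicity p (fact n) + multiplicity p ((2 * n) choose n)"
    using assms by (simp add: prime_elem_multiplicity_mult_distrib)
  finally show ?thesis
    using multiplicity_fact_eq_sum[OF assms, of n "2 * n"]
      multiplicity_fact_eq_sum[OF assms, of "2 * n" "2 * n"] by simp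
qed

text \<open>Each exponent \<open>i\<close> contributes at most 1 to the multiplicity, and nothing
  when \<open>p ^ i\<close> exceeds \<open>2 * n\<close>.\<close>

lemma prime_power_central_binomial_le:
  fixes p :: nat
  assumes "prime p" "n > 0"
  shows "p ^ multiplicity p ((2 * n) choose n) \<le> 2 * n"
proof -
  let ?m = "multiplicity p ((2 * n) choose n)"
  define S where "S = {i\<in>{1..2 * n}. p ^ i \<le> 2 * n}"
  have p1: "p > 1" using assms(1) prime_gt_1_nat by blast
  have "(2 * n) div p ^ i \<le> 2 * (n div p ^ i) + (if p ^ i \<le> 2 * n then 1 else 0)" for i
  proof (cases "p ^ i \<le> 2 * n")
    case True
    have "n < (n div p ^ i + 1) * p ^ i" using p1 by (simp add: dividend_less_div_times)
    then have "2 * n < (2 * (n div p ^ i) + 2) * p ^ i" by (simp add: algebra_simps)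
    then have "(2 * n) div p ^ i < 2 * (n div p ^ i) + 2" using p1 by (simp add: less_mult_imp_div_less)
    then show ?thesis using True by simp
  qed simp
  then have "(\<Sum>i\<in>{1..2 * n}. (2 * n) div p ^ i)
      \<le> (\<Sum>i\<in>{1..2 * n}. 2 * (n div p ^ i) + (if p ^ i \<le> 2 * n then 1 else 0))"
    by (rule sum_mono)
  also have "\<dots> = 2 * (\<Sum>i\<in>{1..2 * n}. n div p ^ i) + card S"
    by (simp add: S_def sum.distrib sum_distrib_left sum.inter_filter[symmetric])
  finally have le: "?m \<le> card S" using multiplicity_central_binomial[OF assms(1), of n] by linarith
  show ?thesis
  proof (cases "?m = 0")
    case False
    have "\<not> S \<subseteq> {1..<?m}"
    proof
      assume "S \<subseteq> {1..<?m}"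
      then have "card S \<le> card {1..<?m}" by (rule card_mono[rotated]) simp
      then show False using le False by simp
    qed
    then obtain i where "i \<in> S" "?m \<le> i" unfolding S_def by force
    then have "p ^ ?m \<le> p ^ i" using p1 by (intro power_increasing) auto
    also have "\<dots> \<le> 2 * n" using \<open>i \<in> S\<close> by (simp add: S_def)
    finally show ?thesis .
  qed (use assms in simp)
qed

text \<open>For \<open>i = 1\<close> the quotients are 1 and 2, which cancel; for
  \<open>i \<ge> 2\<close> already \<open>p * p \<ge> 3 * p > 2 * n\<close>, so both quotients
  vanish.\<close>

lemma prime_not_dvd_central_binomial:
  fixes p :: nat
  assumes "prime p" "2 < p" "p \<le> n" "2 * n < 3 * p"
  shows "\<not> p dvd ((2 * n) choose n)"
proof -
  have "(2 * n) div p ^ i = 2 * (n div p ^ i)" if "i \<in> {1..2 * n}" for i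
  proof (cases "i = 1")
    case True
    have "n div p = 1" "(2 * n) div p = 2" using assms by (auto intro!: div_nat_eqI)
    then show ?thesis using True by simp
  next
    case False
    then have "i \<ge> 2" using that by auto
    have "2 * n < p * p" using assms(2,4) mult_le_mono1[of 3 p p] by linarith
    also have "p * p \<le> p ^ i" using \<open>i \<ge> 2\<close> assms(2) power_increasing[of 2 i p] by (simp add: power2_eq_square)
    finally show ?thesis by simp
  qed
  then have "(\<Sum>i\<in>{1..2 * n}. (2 * n) div p ^ i) = 2 * (\<Sum>i\<in>{1..2 * n}. n div p ^ i)"
    by (simp add: sum_distrib_left)
  then have "multiplicity p ((2 * n) choose n) = 0"
    using multiplicity_central_binomial[OF assms(1), of n] by linarith
  then show ?thesis using assms(1) by (simp add: prime_elem_multiplicity_eq_zero_iff)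
qed

text \<open>Without primes between \<open>n\<close> and \<open>2 * n\<close>, all prime factors are
  at most two thirds of \<open>n\<close>. Those with square at most \<open>2 * n\<close> number at
  most \<open>s\<close> and contribute at most \<open>2 * n\<close> each; the remaining ones occur
  once, so together they divide the product of the primes up to \<open>2 * n div 3\<close>.\<close>

lemma central_binomial_le_if_no_prime:
  fixes n s :: nat
  assumes "n \<ge> 3" "\<And>p. prime p \<Longrightarrow> n < p \<Longrightarrow> p < 2 * n \<Longrightarrow> False" "2 * n < (s + 1)\<^sup>2"
  shows "(2 * n) choose n \<le> (2 * n) ^ s * 4 ^ (2 * n div 3)"
proof -
  let ?C = "(2 * n) choose n"
  let ?P = "prime_factors ?C"
  define A B where "A = {p \<in> ?P. p ^ 2 \<le> 2 * n}" and "B = {p \<in> ?P. \<not> p ^ 2 \<le> 2 * n}"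
  have pow_le: "p ^ multiplicity p ?C \<le> 2 * n" if "p \<in> ?P" for p
    using that assms(1) by (intro prime_power_central_binomial_le) auto
  have small: "p \<le> 2 * n div 3" if "p \<in> ?P" for p
  proof -
    have p: "prime p" "p dvd ?C" using that by auto
    have "multiplicity p ?C \<ge> 1" using that by (simp add: prime_factors_multiplicity Suc_le_eq)
    then have "p ^ 1 \<le> p ^ multiplicity p ?C" using prime_ge_1_nat[OF p(1)] by (intro power_increasing) auto
    then have "p \<le> 2 * n" using pow_le[OF that] by simp
    moreover have "p \<noteq> 2 * n"
      using p(1) assms(1) primes_dvd_imp_eq[of 2 p] by auto
    ultimately have "p \<le> n" using assms(2)[OF p(1)] by (cases "n < p") auto
    moreover have "2 < p \<Longrightarrow> p \<le> n \<Longrightarrow> 2 * n < 3 * p \<Longrightarrow> False"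
      using prime_not_dvd_central_binomial[OF p(1)] p(2) by blast
    ultimately have "3 * p \<le> 2 * n" using assms(1) by (cases "p \<le> 2") (linarith, fastforce)
    then show ?thesis by linarith
  qed
  have "?C = (\<Prod>p\<in>?P. p ^ multiplicity p ?C)" by (rule prime_factorization_nat) simp
  also have "?P = A \<union> B" unfolding A_def B_def by auto
  also have "(\<Prod>p\<in>A \<union> B. p ^ multiplicity p ?C) = (\<Prod>p\<in>A. p ^ multiplicity p ?C) * (\<Prod>p\<in>B. p ^ multiplicity p ?C)"
    by (rule prod.union_disjoint) (auto simp: A_def B_def)
  also have "\<dots> \<le> (2 * n) ^ s * 4 ^ (2 * n div 3)"
  proof (rule mult_le_mono)
    have "(\<Prod>p\<in>A. p ^ multiplicity p ?C) \<le> (\<Prod>p\<in>A. 2 * n)"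
      using pow_le by (intro prod_mono) (auto simp: A_def)
    also have "\<dots> = (2 * n) ^ card A" by simp
    also have "A \<subseteq> {1..s}"
    proof
      fix p assume "p \<in> A"
      then have "p ^ 2 < (s + 1) ^ 2" "prime p" using assms(3) by (auto simp: A_def)
      then show "p \<in> {1..s}" using power_less_imp_less_base[of p 2 "s + 1"] prime_ge_1_nat by auto
    qed
    then have "card A \<le> s" using card_mono[of "{1..s}" A] by simp
    then have "(2 * n) ^ card A \<le> (2 * n) ^ s" using assms(1) by (intro power_increasing) auto
    finally show "(\<Prod>p\<in>A. p ^ multiplicity p ?C) \<le> (2 * n) ^ s" .
  next
    have "p ^ multiplicity p ?C \<le> p" if "p \<in> B" for p
    proof -
      have "p ^ multiplicity p ?C < p ^ 2" using that pow_le[of p] by (auto simp: B_def)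
      then have "multiplicity p ?C < 2"
        by (rule power_less_imp_less_exp[rotated]) (use that prime_gt_1_nat[of p] in \<open>simp add: B_def prime_factors_multiplicity\<close>)
      then have "p ^ multiplicity p ?C \<le> p ^ 1"
        using that prime_ge_1_nat[of p] by (intro power_increasing) (auto simp: B_def)
      then show ?thesis by simp
    qed
    then have "(\<Prod>p\<in>B. p ^ multiplicity p ?C) \<le> \<Prod>B" by (intro prod_mono) auto
    also have "\<dots> \<le> \<Prod>{p. prime p \<and> p \<le> 2 * n div 3}"
    proof (rule dvd_imp_le)
      show "\<Prod>B dvd \<Prod>{p. prime p \<and> p \<le> 2 * n div 3}"
        using small by (intro prod_dvd_prod_subset) (auto simp: B_def)
      show "\<Prod>{p. prime p \<and> p \<le> 2 * n div 3} > 0"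
        by (intro prod_pos) (auto simp: prime_gt_0_nat)
    qed
    also have "\<dots> \<le> 4 ^ (2 * n div 3)" by (rule primorial_le)
    finally show "(\<Prod>p\<in>B. p ^ multiplicity p ?C) \<le> 4 ^ (2 * n div 3)" .
  qed
  finally show ?thesis .
qed

text \<open>At each step the left side grows by a factor of at most
  \<open>(36 / 35) ^ 6 < 2\<close>. The exponent \<open>t - 3\<close> is made for
  \<open>t = s + 1\<close> in the final estimate, where \<open>(s - 2) * (s + 1)\<close> must stay
  below \<open>s\<^sup>2\<close>.\<close>

lemma power6_le_power2:
  fixes t :: nat
  assumes "t \<ge> 35"
  shows "t ^ 6 \<le> 2 ^ (t - 3)"
  using assms
proof (induction t rule: dec_induct)
  case (step t)
  have "real (t + 1) \<le> real t * (36 / 35)" using step by simp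
  then have "real (t + 1) ^ 6 \<le> (real t * (36 / 35)) ^ 6" by (intro power_mono) auto
  also have "\<dots> = real t ^ 6 * (36 / 35) ^ 6" by (rule power_mult_distrib)
  also have "\<dots> \<le> real t ^ 6 * 2" by (intro mult_left_mono) (auto simp: field_simps)
  finally have "real ((t + 1) ^ 6) \<le> real (2 * t ^ 6)" by simp
  then have "(t + 1) ^ 6 \<le> 2 * t ^ 6" by (simp only: of_nat_le_iff)
  also have "\<dots> \<le> 2 * 2 ^ (t - 3)" using step by simp
  also have "\<dots> = 2 ^ Suc (t - 3)" by simp
  also have "Suc (t - 3) = Suc t - 3" using step by simp
  finally show ?case by simp
qed simp

lemma nat_sqrt_exists: "\<exists>s::nat. s\<^sup>2 \<le> n \<and> n < (s + 1)\<^sup>2"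
proof (induction n)
  case (Suc n)
  then obtain s where s: "s\<^sup>2 \<le> n" "n < (s + 1)\<^sup>2" by blast
  show ?case
  proof (cases "Suc n < (s + 1)\<^sup>2")
    case False
    then have "Suc n = (s + 1)\<^sup>2" using s by simp
    then show ?thesis by (intro exI[of _ "s + 1"]) (simp add: power2_eq_square)
  qed (use s in \<open>auto intro!: exI[of _ s]\<close>)
qed (auto intro!: exI[of _ 0])

text \<open>Comparing the lower and the upper bound for the central binomial coefficient leaves 4 to
  the power n/3 against \<open>(2 * n) ^ (s + 1)\<close>; cubing removes the thirds. With the
  integer square root \<open>s\<close> of \<open>2 * n\<close> both sides are then compared with
  powers of 2, with exponents \<open>s\<^sup>2\<close> and \<open>(s - 2) * (s + 1)\<close>.\<close>

lemma bertrand_large: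
  fixes n :: nat
  assumes "n \<ge> 600"
  shows "\<exists>p. prime p \<and> n < p \<and> p < 2 * n"
proof (rule ccontr)
  assume no: "\<not> ?thesis"
  obtain s where s: "s\<^sup>2 \<le> 2 * n" "2 * n < (s + 1)\<^sup>2" using nat_sqrt_exists by blast
  \<comment> \<open>Here 600 enters: \<open>s \<le> 33\<close> would give
    \<open>2 * n < 34\<^sup>2\<close>, which is 1156, against
    \<open>2 * n \<ge> 1200\<close>.\<close>
  have s34: "s \<ge> 34"
  proof (rule ccontr)
    assume "\<not> ?thesis"
    then have "(s + 1)\<^sup>2 \<le> 34\<^sup>2" by (intro power_mono) auto
    then show False using s(2) assms by simp
  qed
  have "4 ^ n / (2 * real n) \<le> real ((2 * n) choose n)"
    using assms by (intro central_binomial_lower_bound) simp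
  then have "real (4 ^ n) \<le> real (2 * n * ((2 * n) choose n))" using assms by (simp add: field_simps)
  then have "4 ^ n \<le> 2 * n * ((2 * n) choose n)" by (simp only: of_nat_le_iff)
  also have "\<dots> \<le> 2 * n * ((2 * n) ^ s * 4 ^ (2 * n div 3))"
    using no assms s(2) by (intro mult_le_mono2 central_binomial_le_if_no_prime) auto
  finally have "4 ^ n \<le> (2 * n) ^ (s + 1) * 4 ^ (2 * n div 3)" by (simp add: mult.assoc)
  moreover have "(4::nat) ^ n = 4 ^ (n - 2 * n div 3) * 4 ^ (2 * n div 3)"
    by (simp add: power_add[symmetric])
  ultimately have "4 ^ (n - 2 * n div 3) \<le> (2 * n) ^ (s + 1)" by simp
  then have "(4 ^ (n - 2 * n div 3)) ^ 3 \<le> ((2 * n) ^ (s + 1)) ^ 3" by (rule power_mono) simp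
  moreover have "(2::nat) ^ s\<^sup>2 \<le> (4 ^ (n - 2 * n div 3)) ^ 3"
  proof -
    have "s\<^sup>2 \<le> 2 * ((n - 2 * n div 3) * 3)" using s(1) by linarith
    then have "(2::nat) ^ s\<^sup>2 \<le> 2 ^ (2 * ((n - 2 * n div 3) * 3))" by (rule power_increasing) simp
    also have "\<dots> = (4 ^ (n - 2 * n div 3)) ^ 3" by (simp only: power_mult) simp
    finally show ?thesis .
  qed
  ultimately have "2 ^ s\<^sup>2 \<le> ((2 * n) ^ (s + 1)) ^ 3" by linarith
  also have "\<dots> \<le> (((s + 1)\<^sup>2) ^ (s + 1)) ^ 3" using s(2) by (intro power_mono) auto
  also have "\<dots> = ((s + 1) ^ 6) ^ (s + 1)"
  proof -
    have "2 * (s + 1) * 3 = 6 * (s + 1)" by simp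
    then show ?thesis by (simp only: power_mult[symmetric])
  qed
  also have "\<dots> \<le> (2 ^ (s + 1 - 3)) ^ (s + 1)" using s34 by (intro power_mono power6_le_power2) auto
  also have "\<dots> = 2 ^ ((s - 2) * (s + 1))" by (simp only: power_mult) simp
  also have "\<dots> < 2 ^ s\<^sup>2"
  proof (rule power_strict_increasing)
    obtain r where "s = 2 + r" using s34 le_Suc_ex[of 2 s] by auto
    then show "(s - 2) * (s + 1) < s\<^sup>2" by (simp add: power2_eq_square algebra_simps)
  qed simp
  finally show False by simp
qed

lemma primeI_sqrt:
  fixes n s :: nat
  assumes "1 < n" "n < s * s" "\<forall>d\<in>set [2..<s]. \<not> d dvd n"
  shows "prime n"
proof (rule ccontr)
  assume "\<not> prime n"
  then obtain a where a: "a dvd n" "a \<noteq> 1" "a \<noteq> n" using assms(1) by (auto simp: prime_nat_iff)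
  then obtain b where n: "n = a * b" by blast
  have "a \<noteq> 0 \<and> b \<noteq> 0" using n assms(1) by (cases "a = 0"; cases "b = 0") simp_all
  moreover have "b \<noteq> 1" using n a(3) by auto
  ultimately have ab: "2 \<le> a" "2 \<le> b" using a(2) by simp_all
  have "a < s \<or> b < s" using assms(2) mult_le_mono[of s a s b] n by linarith
  then have "a \<in> set [2..<s] \<or> b \<in> set [2..<s]" using ab by simp
  then show False using assms(3) n by (metis dvd_triv_left dvd_triv_right)
qed
theorem bertrand:
  fixes n :: nat
  assumes "n \<ge> 2"
  shows "\<exists>p. prime p \<and> n < p \<and> p < 2 * n"
proof (cases "n \<ge> 600")
  case False
  have step: "b \<le> n \<or> ?thesis" if "a \<le> n \<or> ?thesis" "prime b" "b < 2 * a" for a b :: nat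
    using that(1)
  proof
    assume "a \<le> n"
    then have "n < b \<Longrightarrow> prime b \<and> n < b \<and> b < 2 * n" using that(2,3) by simp
    then show ?thesis using not_le by blast
  qed blast
  \<comment> \<open>Landau's chain of primes, each smaller than twice its predecessor. If
    \<open>n\<close> lies between two neighbours of the chain, the larger one is the required prime;
    the last member 631 exceeds 600.\<close>
  have "2 \<le> n \<or> ?thesis" using assms by blast
  then have "3 \<le> n \<or> ?thesis" by (rule step) simp_all
  then have "5 \<le> n \<or> ?thesis" by (rule step) simp_all
  then have "7 \<le> n \<or> ?thesis" by (rule step) simp_all
  then have "13 \<le> n \<or> ?thesis" by (rule step) simp_all
  then have "23 \<le> n \<or> ?thesis" by (rule step) simp_all
  then have "43 \<le> n \<or> ?thesis" by (rule step) (rule primeI_sqrt[of _ 7], simp_all)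
  then have "83 \<le> n \<or> ?thesis" by (rule step) (rule primeI_sqrt[of _ 10], simp_all)
  then have "163 \<le> n \<or> ?thesis" by (rule step) (rule primeI_sqrt[of _ 13], simp_all)
  then have "317 \<le> n \<or> ?thesis" by (rule step) (rule primeI_sqrt[of _ 18], simp_all)
  then have "631 \<le> n \<or> ?thesis" by (rule step) (rule primeI_sqrt[of _ 26], simp_all)
  with False show ?thesis by auto
qed (rule bertrand_large)

section \<open>Homogeneous permutation groups\<close>

lemma card_one_more_supersets:
  assumes "finite X" "A \<subseteq> X" "card A = j"
  shows "card {B. B \<subseteq> X \<and> card B = Suc j \<and> A \<subseteq> B \<and> P B} = card {x \<in> X - A. P (insert x A)}"
proof -
  have finA: "finite A" using assms finite_subset by blast
  have "{B. B \<subseteq> X \<and> card B = Suc j \<and> A \<subseteq> B \<and> P B} = (\<lambda>x. insert x A) ` {x \<in> X - A. P (insert x A)}"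
  proof (intro equalityI subsetI)
    fix B assume "B \<in> {B. B \<subseteq> X \<and> card B = Suc j \<and> A \<subseteq> B \<and> P B}"
    then have B: "B \<subseteq> X" "card B = Suc j" "A \<subseteq> B" "P B" by auto
    have "card (B - A) = 1" using B assms finA by (simp add: card_Diff_subset)
    then obtain x where "B - A = {x}" by (auto simp: card_1_singleton_iff)
    then have "B = insert x A" "x \<in> X - A" using B by auto
    then show "B \<in> (\<lambda>x. insert x A) ` {x \<in> X - A. P (insert x A)}" using B by blast
  qed (use assms finA in auto)
  moreover have "inj_on (\<lambda>x. insert x A) {x \<in> X - A. P (insert x A)}"
    by (auto simp: inj_on_def)
  ultimately show ?thesis by (simp add: card_image)
qed

text \<open>
  For a fixed \<^term>\<open>A\<^sub>0\<close>, summing the hypothesis over the sets \<^term>\<open>B\<close> that meet \<^term>\<open>A\<^sub>0\<close> in \<^term>\<open>i\<close>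
  points gives a recursion for the sum of \<^term>\<open>f A\<close> over the \<^term>\<open>A\<close> meeting \<^term>\<open>A\<^sub>0\<close> in \<^term>\<open>i\<close> points.
\<close>
lemma subset_sums_zero_imp_zero:
  fixes f :: "'a set \<Rightarrow> real"
  assumes X: "finite X" "2 * j < card X"
    and sums: "\<And>B. B \<subseteq> X \<Longrightarrow> card B = Suc j \<Longrightarrow> (\<Sum>A | A \<subseteq> B \<and> card A = j. f A) = 0"
    and A0: "A\<^sub>0 \<subseteq> X" "card A\<^sub>0 = j"
  shows "f A\<^sub>0 = 0"
proof -
  define J where "J = {A. A \<subseteq> X \<and> card A = j}"
  define t where "t i = (\<Sum>A\<in>J. if card (A \<inter> A\<^sub>0) = i then f A else 0)" for i
  have finJ: "finite J" using X(1) by (simp add: J_def)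
  have fin0: "finite A\<^sub>0" using A0 X(1) finite_subset by blast
  have rec: "real (card X - 2 * j + i) * t i + (if i = 0 then 0 else real (Suc j - i) * t (i - 1)) = 0"
    if "i \<le> j" for i
  proof -
    define \<B> where "\<B> = {B. B \<subseteq> X \<and> card B = Suc j \<and> card (B \<inter> A\<^sub>0) = i}"
    have fin\<B>: "finite \<B>" using X(1) by (simp add: \<B>_def)
    \<comment> \<open>A member of \<open>\<B>\<close> above \<open>A\<close> adds one point
      \<open>x\<close>. If \<open>A\<close> already meets \<open>A\<^sub>0\<close> in
      \<open>i\<close> points, then \<open>x\<close> avoids \<open>A \<union> A\<^sub>0\<close>,
      which has \<open>2 * j - i\<close> points; if it meets it in \<open>i - 1\<close>, then
      \<open>x\<close> is one of the \<open>j - (i - 1)\<close> points of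
      \<open>A\<^sub>0 - A\<close>.\<close>
    have coeff: "card {B \<in> \<B>. A \<subseteq> B} = (if card (A \<inter> A\<^sub>0) = i then card X - 2 * j + i
        else if Suc (card (A \<inter> A\<^sub>0)) = i then Suc j - i else 0)" if "A \<in> J" for A
    proof -
      have A: "A \<subseteq> X" "card A = j" "finite A" using that X(1) finite_subset by (auto simp: J_def)
      have ins: "card (insert x A \<inter> A\<^sub>0) = card (A \<inter> A\<^sub>0) + (if x \<in> A\<^sub>0 then 1 else 0)" if "x \<in> X - A" for x
        using that A fin0 by (simp add: Int_insert_left)
      have "{B \<in> \<B>. A \<subseteq> B} = {B. B \<subseteq> X \<and> card B = Suc j \<and> A \<subseteq> B \<and> card (B \<inter> A\<^sub>0) = i}"
        by (auto simp: \<B>_def)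
      then have "card {B \<in> \<B>. A \<subseteq> B} = card {x \<in> X - A. card (insert x A \<inter> A\<^sub>0) = i}"
        using card_one_more_supersets[OF X(1) A(1,2), of "\<lambda>B. card (B \<inter> A\<^sub>0) = i"] by simp
      also have "{x \<in> X - A. card (insert x A \<inter> A\<^sub>0) = i}
          = {x \<in> X - A. card (A \<inter> A\<^sub>0) + (if x \<in> A\<^sub>0 then 1 else 0) = i}"
        using ins by (intro Collect_cong conj_cong refl) (simp only:)
      also have "card \<dots> = (if card (A \<inter> A\<^sub>0) = i then card X - 2 * j + i
        else if Suc (card (A \<inter> A\<^sub>0)) = i then Suc j - i else 0)"
      proof (cases "card (A \<inter> A\<^sub>0) = i")
        case True
        have "{x \<in> X - A. card (A \<inter> A\<^sub>0) + (if x \<in> A\<^sub>0 then 1 else 0) = i} = X - (A \<union> A\<^sub>0)"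
          using True by auto
        moreover have "card (A \<union> A\<^sub>0) + i = 2 * j"
          using card_Un_Int[OF A(3) fin0] A(2) A0(2) True by simp
        moreover have "card (X - (A \<union> A\<^sub>0)) = card X - card (A \<union> A\<^sub>0)"
          using A A0 fin0 by (intro card_Diff_subset) auto
        ultimately show ?thesis using True X(2) by simp
      next
        case False
        have "card (A\<^sub>0 - A) = j - card (A \<inter> A\<^sub>0)"
          using card_Diff_subset_Int[of A\<^sub>0 A] fin0 A0(2) by (simp add: Int_commute)
        moreover have "{x \<in> X - A. card (A \<inter> A\<^sub>0) + (if x \<in> A\<^sub>0 then 1 else 0) = i}
            = (if Suc (card (A \<inter> A\<^sub>0)) = i then A\<^sub>0 - A else {})"
          using False A0(1) by auto
        ultimately show ?thesis using False by auto
      qed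
      finally show ?thesis .
    qed
    have "0 = (\<Sum>B\<in>\<B>. \<Sum>A | A \<subseteq> B \<and> card A = j. f A)"
      by (rule sum.neutral[symmetric]) (simp add: \<B>_def sums)
    also have "\<dots> = (\<Sum>B\<in>\<B>. \<Sum>A\<in>J. if A \<subseteq> B then f A else 0)"
    proof (rule sum.cong[OF refl])
      fix B assume "B \<in> \<B>"
      then have "{A \<in> J. A \<subseteq> B} = {A. A \<subseteq> B \<and> card A = j}" by (auto simp: J_def \<B>_def)
      then show "(\<Sum>A | A \<subseteq> B \<and> card A = j. f A) = (\<Sum>A\<in>J. if A \<subseteq> B then f A else 0)"
        using sum.inter_filter[OF finJ, of f "\<lambda>A. A \<subseteq> B"] by simp
    qed
    also have "\<dots> = (\<Sum>A\<in>J. \<Sum>B\<in>\<B>. if A \<subseteq> B then f A else 0)" by (rule sum.swap)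
    also have "\<dots> = (\<Sum>A\<in>J. real (card {B \<in> \<B>. A \<subseteq> B}) * f A)"
      using fin\<B> by (simp add: sum.inter_filter[symmetric])
    also have "\<dots> = (\<Sum>A\<in>J. real (card X - 2 * j + i) * (if card (A \<inter> A\<^sub>0) = i then f A else 0)
        + (if i = 0 then 0 else real (Suc j - i) * (if card (A \<inter> A\<^sub>0) = i - 1 then f A else 0)))"
      by (intro sum.cong refl) (auto simp: coeff)
    also have "\<dots> = real (card X - 2 * j + i) * t i + (if i = 0 then 0 else real (Suc j - i) * t (i - 1))"
      by (simp add: sum.distrib t_def sum_distrib_left)
    finally show ?thesis by simp
  qed
  \<comment> \<open>The leading coefficient \<open>card X - 2 * j + i\<close> is positive because
    \<open>2 * j < card X\<close>; so the recursion starts with \<open>t 0 = 0\<close> and carries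
    zero up to \<open>t j\<close>, where only \<open>A\<^sub>0\<close> itself is left in the
    sum.\<close>
  have "t i = 0" if "i \<le> j" for i
    using that
  proof (induction i)
    case 0
    then show ?case using rec[of 0] X(2) by simp
  next
    case (Suc i)
    then show ?case using rec[of "Suc i"] X(2) by simp
  qed
  moreover have "t j = f A\<^sub>0"
  proof -
    have "card (A \<inter> A\<^sub>0) = j \<longleftrightarrow> A = A\<^sub>0" if "A \<in> J" for A
    proof
      assume "card (A \<inter> A\<^sub>0) = j"
      moreover have "finite A" using that X(1) finite_subset by (auto simp: J_def)
      ultimately have "A \<inter> A\<^sub>0 = A" using that card_subset_eq[of A "A \<inter> A\<^sub>0"] by (simp add: J_def)
      then show "A = A\<^sub>0" using that A0 fin0 card_subset_eq[of "A\<^sub>0" A] by (auto simp: J_def)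
    qed (use A0 in simp)
    then have "t j = (\<Sum>A\<in>J. if A = A\<^sub>0 then f A else 0)" unfolding t_def by (intro sum.cong) auto
    then show ?thesis using finJ A0 by (simp add: J_def)
  qed
  ultimately show ?thesis by simp
qed

lemma
  assumes "subgroup H (sym_group n)"
  shows perm_subgroup_permutes: "h \<in> H \<Longrightarrow> h permutes {1..n}"
    and perm_subgroup_comp: "g \<in> H \<Longrightarrow> h \<in> H \<Longrightarrow> g \<circ> h \<in> H"
    and perm_subgroup_id: "id \<in> H"
    and perm_subgroup_inv: "h \<in> H \<Longrightarrow> inv' h \<in> H"
    and perm_subgroup_bij: "h \<in> H \<Longrightarrow> bij h"
proof -
  interpret subgroup H "sym_group n" by fact
  show perm: "h \<in> H \<Longrightarrow> h permutes {1..n}" for h using sym_group_carrier mem_carrier by blast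
  show "g \<in> H \<Longrightarrow> h \<in> H \<Longrightarrow> g \<circ> h \<in> H" using m_closed by (simp add: sym_group_mult)
  show "id \<in> H" using one_closed by (simp add: sym_group_one)
  show "h \<in> H \<Longrightarrow> inv' h \<in> H" using m_inv_closed mem_carrier sym_group_inv_equality by metis
  show "h \<in> H \<Longrightarrow> bij h" using perm permutes_bij by blast
qed

lemma permutes_image_subset: "h permutes X \<Longrightarrow> A \<subseteq> X \<Longrightarrow> h ` A \<subseteq> X"
  using permutes_image by blast

lemma permutes_card_image: "h permutes X \<Longrightarrow> card (h ` A) = card A"
  by (meson card_image inj_on_subset permutes_inj subset_UNIV)

definition homogeneous :: "nat \<Rightarrow> nat \<Rightarrow> (nat \<Rightarrow> nat) set \<Rightarrow> bool" where
  "homogeneous n j H \<longleftrightarrow>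
     (\<forall>A B. A \<subseteq> {1..n} \<longrightarrow> card A = j \<longrightarrow> B \<subseteq> {1..n} \<longrightarrow> card B = j \<longrightarrow> (\<exists>h\<in>H. h ` A = B))"

lemma homogeneousD:
  assumes "homogeneous n j H" "A \<subseteq> {1..n}" "card A = j" "B \<subseteq> {1..n}" "card B = j"
  obtains h where "h \<in> H" "h ` A = B"
  using assms unfolding homogeneous_def by metis

text \<open>One step of the Livingstone-Wagner theorem. By homogeneity, all sets of size
  \<open>Suc j\<close> contain the same number of members of the orbit \<open>\<O>\<close>. The
  indicator of \<open>\<O>\<close> minus its mean thus has sum zero over the subsets of size
  \<open>j\<close> of every such set, hence vanishes; so the indicator is constant and there is only
  one orbit.\<close>

lemma homogeneous_Suc_imp:
  assumes H: "subgroup H (sym_group n)" and hom: "homogeneous n (Suc j) H" and j: "2 * j < n"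
  shows "homogeneous n j H"
  unfolding homogeneous_def
proof (intro allI impI)
  fix A\<^sub>0 A\<^sub>1 assume A0: "A\<^sub>0 \<subseteq> {1..n}" "card A\<^sub>0 = j" and A1: "A\<^sub>1 \<subseteq> {1..n}" "card A\<^sub>1 = j"
  define \<O> where "\<O> = {A. \<exists>h\<in>H. h ` A\<^sub>0 = A}"
  define N where "N B = card {A. A \<subseteq> B \<and> card A = j \<and> A \<in> \<O>}" for B
  have O_closed: "h ` A \<in> \<O>" if "h \<in> H" "A \<in> \<O>" for h A
  proof -
    obtain g where g: "g \<in> H" "g ` A\<^sub>0 = A" using \<open>A \<in> \<O>\<close> by (auto simp: \<O>_def)
    then have "h \<circ> g \<in> H" using perm_subgroup_comp[OF H \<open>h \<in> H\<close>] by blast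
    moreover have "(h \<circ> g) ` A\<^sub>0 = h ` A" using g(2) by (simp only: image_comp[symmetric])
    ultimately show ?thesis unfolding \<O>_def by blast
  qed
  have le: "N B \<le> N (h ` B)" if "h \<in> H" "finite B" for h B
    unfolding N_def
  proof (rule card_inj_on_le[of "image h"])
    have h: "h permutes {1..n}" using that(1) perm_subgroup_permutes[OF H] by blast
    then show "inj_on ((`) h) {A. A \<subseteq> B \<and> card A = j \<and> A \<in> \<O>}"
      by (meson inj_image_eq_iff inj_onI permutes_inj)
    show "(`) h ` {A. A \<subseteq> B \<and> card A = j \<and> A \<in> \<O>} \<subseteq> {A. A \<subseteq> h ` B \<and> card A = j \<and> A \<in> \<O>}"
      using O_closed[OF that(1)] h by (auto simp: permutes_card_image)
  qed (use that in auto)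
  obtain B\<^sub>0 :: "nat set" where B0: "B\<^sub>0 \<subseteq> {1..n}" "card B\<^sub>0 = Suc j"
  proof
    show "{1..Suc j} \<subseteq> {1..n}" using j by auto
  qed simp
  have const: "N B = N B\<^sub>0" if B: "B \<subseteq> {1..n}" "card B = Suc j" for B
  proof -
    have fin: "finite B" "finite B\<^sub>0" using B B0 finite_subset by blast+
    obtain h where "h \<in> H" "h ` B = B\<^sub>0" using homogeneousD[OF hom B B0] .
    moreover obtain h' where "h' \<in> H" "h' ` B\<^sub>0 = B" using homogeneousD[OF hom B0 B] .
    ultimately show ?thesis using le[of h B] le[of h' B\<^sub>0] fin by simp
  qed
  define f where "f A = (if A \<in> \<O> then 1 else 0) - real (N B\<^sub>0) / real (Suc j)" for A
  have zero: "f A = 0" if "A \<subseteq> {1..n}" "card A = j" for A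
  proof (rule subset_sums_zero_imp_zero[of "{1..n}" j f, OF _ _ _ that])
    fix B :: "nat set" assume B: "B \<subseteq> {1..n}" "card B = Suc j"
    then have fin: "finite B" using finite_subset by blast
    then have "card {A. A \<subseteq> B \<and> card A = j} = Suc j"
      using n_subsets[of B j] B(2) by simp
    moreover have "(\<Sum>A | A \<subseteq> B \<and> card A = j. if A \<in> \<O> then 1 else 0 :: real) = real (N B)"
      using fin by (simp add: N_def sum.inter_filter[symmetric])
    ultimately show "(\<Sum>A | A \<subseteq> B \<and> card A = j. f A) = 0"
      using const[OF B] by (simp add: f_def sum_subtractf)
  qed (use j in auto)
  have "A\<^sub>0 \<in> \<O>" using perm_subgroup_id[OF H] unfolding \<O>_def by (intro CollectI bexI[of _ id]) auto
  then have "A\<^sub>1 \<in> \<O>" using zero[OF A0] zero[OF A1] by (auto simp: f_def split: if_splits)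
  then show "\<exists>h\<in>H. h ` A\<^sub>0 = A\<^sub>1" by (simp add: \<O>_def)
qed

lemma homogeneous_mono:
  assumes H: "subgroup H (sym_group n)" and hom: "homogeneous n k H" and "j \<le> k" "2 * k \<le> n"
  shows "homogeneous n j H"
  using assms(3)
proof (induction j rule: inc_induct)
  case (step j)
  then show ?case using homogeneous_Suc_imp[OF H] assms(4) by simp
qed (rule hom)

section \<open>Elements of prime order\<close>

lemma funpow_eq_mod:
  assumes "(f ^^ p) x = x"
  shows "(f ^^ (m * p)) x = x"
  using assms by (induction m) (simp_all add: funpow_add)

text \<open>A coincidence gives a period \<open>d\<close> with \<open>0 < d < p\<close>; by Bezout
  some multiple of \<open>d\<close> exceeds a multiple of \<open>p\<close> by one, so
  \<open>x\<close> would be fixed by \<open>f\<close>.\<close>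

lemma funpow_prime_period_inj:
  fixes p :: nat
  assumes p: "prime p" and per: "(f ^^ p) x = x" and "f x \<noteq> x"
  shows "inj_on (\<lambda>i. (f ^^ i) x) {..<p}"
proof (rule linorder_inj_onI')
  fix i j assume ij: "i < j" "i \<in> {..<p}" "j \<in> {..<p}"
  show "(f ^^ i) x \<noteq> (f ^^ j) x"
  proof
    assume eq: "(f ^^ i) x = (f ^^ j) x"
    define d where "d = j - i"
    have "x = (f ^^ (p - i + i)) x" using per ij by simp
    also have "\<dots> = (f ^^ (p - i)) ((f ^^ j) x)" by (simp only: funpow_add o_apply eq)
    also have "\<dots> = (f ^^ (d + p)) x"
    proof -
      have "p - i + j = d + p" using ij by (simp add: d_def)
      then show ?thesis by (metis funpow_add o_apply)
    qed
    also have "\<dots> = (f ^^ d) x" by (simp add: funpow_add per)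
    finally have d: "(f ^^ d) x = x" by simp
    have "0 < d" "d < p" using ij by (auto simp: d_def)
    then have "\<not> p dvd d" using dvd_imp_le by force
    then have "coprime d p" using p prime_imp_coprime coprime_commute by metis
    then obtain a b where "a * d = b * p + 1"
      using bezout_nat[of d p] \<open>0 < d\<close> by (metis coprime_imp_gcd_eq_1 less_not_refl mult.commute)
    then have "(f ^^ (a * d)) x = f ((f ^^ (b * p)) x)" by simp
    then show False using funpow_eq_mod[OF d, of a] funpow_eq_mod[OF per, of b] \<open>f x \<noteq> x\<close> by simp
  qed
qed

definition funpow_orbit :: "('a \<Rightarrow> 'a) \<Rightarrow> 'a \<Rightarrow> 'a set" where
  "funpow_orbit f x = range (\<lambda>i. (f ^^ i) x)"

lemma funpow_orbit_self: "x \<in> funpow_orbit f x"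
  unfolding funpow_orbit_def by (metis funpow_0 rangeI)

lemma funpow_orbit_eq:
  assumes "(f ^^ p) x = x" "p > 0" "y \<in> funpow_orbit f x"
  shows "funpow_orbit f y = funpow_orbit f x"
proof -
  obtain i where i: "y = (f ^^ i) x" using assms(3) by (auto simp: funpow_orbit_def)
  \<comment> \<open>Continuing from \<open>y\<close> up to the multiple \<open>i * p\<close> of the
    period leads back to \<open>x\<close>; the subtraction is exact because
    \<open>p > 0\<close>.\<close>
  have "(f ^^ (i * p - i)) y = (f ^^ (i * p)) x"
    using assms(2) by (simp add: i funpow_add[unfolded o_def fun_eq_iff, rule_format, symmetric])
  then have "x = (f ^^ (i * p - i)) y" using funpow_eq_mod[OF assms(1)] by simp
  then have "(f ^^ j) x \<in> funpow_orbit f y" for j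
    unfolding funpow_orbit_def by (metis funpow_add o_apply rangeI)
  moreover have "(f ^^ j) y \<in> funpow_orbit f x" for j
    unfolding funpow_orbit_def i by (metis funpow_add o_apply rangeI)
  ultimately show ?thesis unfolding funpow_orbit_def by auto
qed

lemma card_funpow_orbit:
  fixes p :: nat
  assumes p: "prime p" and per: "(f ^^ p) x = x" and "f x \<noteq> x"
  shows "card (funpow_orbit f x) = p"
proof -
  have "funpow_orbit f x = (\<lambda>i. (f ^^ i) x) ` {..<p}"
  proof -
    have "(f ^^ i) x = (f ^^ (i mod p)) x" for i
      by (metis funpow_mod_eq per)
    moreover have "i mod p < p" for i using p prime_gt_0_nat by simp
    ultimately show ?thesis unfolding funpow_orbit_def by (blast intro: lessThan_iff[THEN iffD2])
  qed
  then show ?thesis using funpow_prime_period_inj[OF assms] by (simp add: card_image)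
qed

lemma prime_dvd_card_if_no_fixpoint:
  fixes p :: nat
  assumes "prime p" "finite S" "\<And>x. x \<in> S \<Longrightarrow> f x \<in> S" "\<And>x. x \<in> S \<Longrightarrow> (f ^^ p) x = x"
    and "\<And>x. x \<in> S \<Longrightarrow> f x \<noteq> x"
  shows "p dvd card S"
proof -
  have p0: "p > 0" using assms(1) prime_gt_0_nat by blast
  have "(f ^^ i) x \<in> S" if "x \<in> S" for i x using that assms(3) by (induction i) auto
  then have sub: "funpow_orbit f x \<subseteq> S" if "x \<in> S" for x using that by (auto simp: funpow_orbit_def)
  then have "S = \<Union> (funpow_orbit f ` S)" using funpow_orbit_self by fast
  moreover have "p dvd card (\<Union> (funpow_orbit f ` S))"
  proof (rule dvd_partition)
    show "finite (\<Union> (funpow_orbit f ` S))" using calculation assms(2) by simp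
    show "\<forall>c\<in>funpow_orbit f ` S. p dvd card c"
      using card_funpow_orbit[OF assms(1) assms(4,5)] by auto
    show "\<forall>c1\<in>funpow_orbit f ` S. \<forall>c2\<in>funpow_orbit f ` S. c1 \<noteq> c2 \<longrightarrow> c1 \<inter> c2 = {}"
    proof (intro ballI impI)
      fix c1 c2 assume c: "c1 \<in> funpow_orbit f ` S" "c2 \<in> funpow_orbit f ` S" "c1 \<noteq> c2"
      then obtain x y where xy: "c1 = funpow_orbit f x" "c2 = funpow_orbit f y" "x \<in> S" "y \<in> S" by blast
      show "c1 \<inter> c2 = {}"
        using funpow_orbit_eq[OF assms(4) p0] xy c(3) by blast
    qed
  qed
  ultimately show ?thesis by simp
qed

text \<open>
  A subgroup of order \<^term>\<open>p\<close> whose index is prime to \<^term>\<open>p\<close> is a Sylow subgroup; an element of order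
  \<^term>\<open>p\<close> acting on its cosets must fix one of them.
\<close>
lemma (in group) conjugate_into_prime_subgroup:
  fixes p :: nat
  assumes p: "prime p" and fin: "finite (carrier G)" and P: "subgroup P G" "card P = p"
    and ord: "\<not> p * p dvd order G" and g: "g \<in> carrier G" "g [^] p = \<one>"
  obtains t where "t \<in> carrier G" "t \<otimes> g \<otimes> inv t \<in> P"
proof -
  define \<phi> where "\<phi> c = c #> g" for c
  have PG: "P \<subseteq> carrier G" using P(1) subgroup.subset by blast
  have pow: "(\<phi> ^^ i) (P #> t) = P #> (t \<otimes> g [^] i)" if "t \<in> carrier G" for t i
  proof (induction i)
    case (Suc i)
    then show ?case using that g(1) PG by (simp add: \<phi>_def coset_mult_assoc m_assoc)
  qed (use that in simp)
  have "\<exists>c\<in>rcosets P. \<phi> c = c"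
  proof (rule ccontr)
    assume no: "\<not> ?thesis"
    have "p dvd card (rcosets P)"
    proof (rule prime_dvd_card_if_no_fixpoint[OF p])
      show "finite (rcosets P)" using fin by (simp add: RCOSETS_def)
      show "\<phi> c \<in> rcosets P" "(\<phi> ^^ p) c = c" if c: "c \<in> rcosets P" for c
      proof -
        obtain t where t: "t \<in> carrier G" "c = P #> t" using c by (auto simp: RCOSETS_def)
        then show "(\<phi> ^^ p) c = c" using pow[OF t(1), of p] g by simp
        have "\<phi> c = P #> (t \<otimes> g)" using t g PG by (simp add: \<phi>_def coset_mult_assoc)
        then show "\<phi> c \<in> rcosets P" using t g PG by (simp add: rcosetsI)
      qed
    qed (use no in blast)
    then have "p * p dvd card (rcosets P) * card P" using P(2) by simp
    then show False using lagrange[OF P(1)] ord by simp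
  qed
  then obtain t where t: "t \<in> carrier G" "P #> t #> g = P #> t" by (auto simp: RCOSETS_def \<phi>_def)
  then have "P #> (t \<otimes> g) = P #> t" using g PG by (simp add: coset_mult_assoc)
  then have "t \<otimes> g \<in> P #> t" using rcos_self[of "t \<otimes> g" P] P(1) t g by simp
  then obtain q where "q \<in> P" "t \<otimes> g = q \<otimes> t" by (auto simp: r_coset_def)
  then have "t \<otimes> g \<otimes> inv t = q" using t(1) PG by (metis inv_solve_right m_closed subsetD g(1))
  then show thesis using that t(1) \<open>q \<in> P\<close> by blast
qed

text \<open>Cauchy's theorem, from Sylow's with exponent 1: this gives a subgroup of order exactly
  \<open>p\<close>, in which the \<open>p\<close>-th power of every element is trivial.\<close>

lemma (in group) obtain_prime_order_element:
  fixes p :: nat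
  assumes p: "prime p" and "finite (carrier G)" "p dvd order G"
  obtains g where "g \<in> carrier G" "g \<noteq> \<one>" "g [^] p = \<one>"
proof -
  obtain m where m: "order G = p ^ 1 * m" using assms(3) by auto
  then obtain P where P: "subgroup P G" "card P = p"
    using sylow_thm[OF p is_group m assms(2)] by auto
  interpret P: group "G\<lparr>carrier := P\<rparr>" using subgroup_imp_group[OF P(1)] .
  have "\<not> P \<subseteq> {\<one>}" using P(2) card_mono[of "{\<one>}" P] prime_gt_1_nat[OF p] by auto
  then obtain g where g: "g \<in> P" "g \<noteq> \<one>" by blast
  then have "g [^]\<^bsub>G\<lparr>carrier := P\<rparr>\<^esub> p = \<one>"
    using P.pow_order_eq_1[of g] P(2) by (simp add: order_def)
  then have "g [^] p = \<one>" by (simp add: nat_pow_def)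
  then show thesis using that[of g] g subgroup.mem_carrier[OF P(1)] by blast
qed

section \<open>Homogeneous groups containing a cycle of prime length\<close>

lemma sym_group_pow: "g [^]\<^bsub>sym_group n\<^esub> (i::nat) = g ^^ i"
proof (induction i)
  case (Suc i)
  then show ?case by (simp add: nat_pow_def sym_group_def funpow_Suc_right del: funpow.simps)
qed (simp add: nat_pow_def sym_group_def)

lemma perm_subgroup_funpow: "subgroup H (sym_group n) \<Longrightarrow> h \<in> H \<Longrightarrow> h ^^ i \<in> H"
  by (induction i) (auto simp: perm_subgroup_id perm_subgroup_comp)

lemma funpow_conj:
  assumes "bij h"
  shows "(h \<circ> g \<circ> inv' h) ^^ i = h \<circ> g ^^ i \<circ> inv' h"
proof (induction i)
  case 0
  then show ?case using assms by (simp add: fun_eq_iff bij_is_surj surj_f_inv_f)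
next
  case (Suc i)
  then show ?case using assms by (simp add: fun_eq_iff bij_is_inj)
qed

lemma cycle_transitive:
  assumes f: "(g ^^ p) z = z" "p > 0" "x \<in> funpow_orbit g z" "y \<in> funpow_orbit g z"
  obtains i where "(g ^^ i) x = y"
proof -
  have "y \<in> range (\<lambda>i. (g ^^ i) x)"
    using funpow_orbit_eq[OF assms(1-3)] assms(4) unfolding funpow_orbit_def by simp
  then show thesis using that by blast
qed

text \<open>Every nontrivial cycle of \<open>g\<close> has length \<open>p\<close>, and two disjoint
  ones would occupy \<open>2 * p > n\<close> points.\<close>

lemma prime_order_perm_is_cycle:
  fixes p n :: nat
  assumes "prime p" "n < 2 * p" and g: "g permutes {1..n}" "g ^^ p = id" "g \<noteq> id"
  obtains z where "z \<in> {1..n}" "funpow_orbit g z \<subseteq> {1..n}" "card (funpow_orbit g z) = p"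
    "\<And>y. y \<notin> funpow_orbit g z \<Longrightarrow> g y = y"
proof -
  obtain z where z: "g z \<noteq> z" using g(3) by (auto simp: fun_eq_iff)
  have p0: "p > 0" using assms(1) prime_gt_0_nat by blast
  have per: "(g ^^ p) y = y" for y using g(2) by simp
  have mem: "y \<in> {1..n}" if "g y \<noteq> y" for y using that g(1) permutes_not_in by metis
  have "(g ^^ i) y \<in> {1..n}" if "y \<in> {1..n}" for y i
  proof (induction i)
    case (Suc i)
    then show ?case using permutes_in_image[OF g(1)] by simp
  qed (use that in simp)
  then have sub: "funpow_orbit g y \<subseteq> {1..n}" if "g y \<noteq> y" for y
    using mem[OF that] by (auto simp only: funpow_orbit_def)
  have card: "card (funpow_orbit g y) = p" if "g y \<noteq> y" for y
    using card_funpow_orbit[OF assms(1) per that] .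
  have "g y = y" if y: "y \<notin> funpow_orbit g z" for y
  proof (rule ccontr)
    assume gy: "g y \<noteq> y"
    have "funpow_orbit g y \<inter> funpow_orbit g z = {}"
    proof (rule ccontr)
      assume "funpow_orbit g y \<inter> funpow_orbit g z \<noteq> {}"
      then obtain w where "w \<in> funpow_orbit g y" "w \<in> funpow_orbit g z" by blast
      then have "funpow_orbit g y = funpow_orbit g z" using funpow_orbit_eq[OF per p0] by metis
      then show False using y funpow_orbit_self by metis
    qed
    then have "card (funpow_orbit g y \<union> funpow_orbit g z) = 2 * p"
      using card[OF gy] card[OF z] finite_subset[OF sub[OF gy]] finite_subset[OF sub[OF z]]
      by (subst card_Un_disjoint) auto
    moreover have "card (funpow_orbit g y \<union> funpow_orbit g z) \<le> card {1..n}"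
      using sub[OF gy] sub[OF z] by (intro card_mono) auto
    ultimately show False using assms(2) by simp
  qed
  then show thesis using that[OF mem[OF z] sub[OF z] card[OF z]] by blast
qed

text \<open>Tuples are matched one entry at a time: once \<open>h\<close> carries \<open>xs\<close>
  to \<open>ys\<close>, an element fixing all entries of \<open>ys\<close> corrects the image of the
  next point. The fixed set never has more than \<open>f\<close> points, whence the bound
  \<open>Suc f\<close> on the length.\<close>

lemma map_transitive_if_point_stabilisers_transitive:
  assumes H: "subgroup H (sym_group n)"
    and trans: "\<And>U x y. U \<subseteq> {1..n} \<Longrightarrow> card U \<le> f \<Longrightarrow> x \<in> {1..n} - U \<Longrightarrow> y \<in> {1..n} - U \<Longrightarrow>
      \<exists>k\<in>H. (\<forall>u\<in>U. k u = u) \<and> k x = y"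
    and xs: "length xs = length ys" "length xs \<le> Suc f" "distinct xs" "distinct ys"
      "set xs \<subseteq> {1..n}" "set ys \<subseteq> {1..n}"
  shows "\<exists>h\<in>H. map h xs = ys"
  using xs
proof (induction xs ys rule: rev_induct2)
  case 1
  then show ?case using perm_subgroup_id[OF H] by auto
next
  case (4 x xs y ys)
  then obtain h where h: "h \<in> H" "map h xs = ys" by auto
  have "h x \<notin> set ys" using h 4 perm_subgroup_bij[OF H h(1)] by (auto simp: bij_def inj_eq)
  moreover have "h x \<in> {1..n}" using 4 perm_subgroup_permutes[OF H h(1)] permutes_in_image by fastforce
  moreover have "card (set ys) \<le> f" using 4 by (simp add: distinct_card)
  ultimately obtain k where k: "k \<in> H" "\<forall>u\<in>set ys. k u = u" "k (h x) = y"
    using trans[of "set ys" "h x" y] 4 by auto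
  have "map k ys = ys" using k(2) by (simp add: map_idI)
  then have "map (k \<circ> h) xs = ys" using h(2) by (metis map_map)
  then have "map (k \<circ> h) (xs @ [x]) = ys @ [y]" using k(3) by simp
  then show ?case using perm_subgroup_comp[OF H k(1) h(1)] by blast
qed auto

lemma three_cycles_generate:
  assumes H: "subgroup H (sym_group n)" and "three_cycles n \<subseteq> H"
  shows "carrier (alt_group n) \<subseteq> H"
proof
  fix h assume "h \<in> carrier (alt_group n)"
  then have "h \<in> generate (alt_group n) (three_cycles n)"
    using alt_group_carrier_as_three_cycles by blast
  then show "h \<in> H"
  proof (induction rule: generate.induct)
    case one
    then show ?case using perm_subgroup_id[OF H] by (simp only: alt_group_one)
  next
    case (inv h)
    then show ?case
      using alt_group_inv_equality[OF subsetD[OF three_cycles_incl inv]]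
        perm_subgroup_inv[OF H subsetD[OF assms(2) inv]] by simp
  next
    case (eng h1 h2)
    then show ?case using perm_subgroup_comp[OF H] by (simp only: alt_group_mult)
  qed (use assms(2) in blast)
qed


text \<open>
  A version of Jordan's theorem on primitive groups containing a cycle of prime length. Let \<^term>\<open>F\<close> be the set of
  fixed points of the cycle \<^term>\<open>g\<close>. By the Frattini argument the normaliser of \<^term>\<open>g\<close> induces all permutations
  of \<^term>\<open>F\<close>. A commutator of two elements of the normaliser centralises \<^term>\<open>g\<close>, so it agrees with a power of
  \<^term>\<open>g\<close> on the support of \<^term>\<open>g\<close>; removing this power leaves a 3-cycle.
\<close>
theorem homogeneous_with_prime_cycle_contains_alt:
  fixes p n :: nat
  assumes H: "subgroup H (sym_group n)" and p: "prime p" "n < 2 * p" "p + 3 \<le> n"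
    and hom: "homogeneous n (n - p) H"
    and g: "g \<in> H" "g ^^ p = id" "g \<noteq> id"
  shows "carrier (alt_group n) \<subseteq> H"
proof -
  let ?X = "{1..n}" and ?f = "n - p"
  interpret S: group "sym_group n" by (rule sym_group_is_group)
  have p0: "p > 0" using p(1) prime_gt_0_nat by blast
  have per: "(g ^^ p) y = y" for y using g(2) by simp
  have perm: "h permutes ?X" if "h \<in> H" for h using perm_subgroup_permutes[OF H that] .
  obtain z where z: "z \<in> ?X" "funpow_orbit g z \<subseteq> ?X" "card (funpow_orbit g z) = p"
    "\<And>y. y \<notin> funpow_orbit g z \<Longrightarrow> g y = y"
    using prime_order_perm_is_cycle[OF p(1,2) perm[OF g(1)] g(2,3)] by blast
  define \<Gamma> where "\<Gamma> = funpow_orbit g z"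
  define F where "F = ?X - \<Gamma>"
  have fin: "finite \<Gamma>" "finite F" using z(2) finite_subset by (auto simp: F_def \<Gamma>_def)
  have F: "F \<subseteq> ?X" "card F = ?f"
    using z(2,3) fin by (auto simp: F_def \<Gamma>_def card_Diff_subset)
  have gF: "g y = y" if "y \<notin> \<Gamma>" for y using z(4) that by (simp add: \<Gamma>_def)
  have giF: "(g ^^ i) y = y" if "y \<notin> \<Gamma>" for y i using gF[OF that] by (induction i) auto
  have gcyc: "\<exists>i. (g ^^ i) x = y" if "x \<in> \<Gamma>" "y \<in> \<Gamma>" for x y
    using cycle_transitive[OF per p0] that unfolding \<Gamma>_def by metis
  have gpow: "g ^^ i \<in> H" for i using perm_subgroup_funpow[OF H g(1)] .

  \<comment> \<open>\<open>h\<close> carries the fixed set \<open>F\<close> of \<open>g\<close> to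
    \<open>U\<close>; the powers of \<open>g\<close> conjugated by \<open>h\<close> fix
    \<open>U\<close> pointwise and are transitive on the rest.\<close>
  have stab_exact: "\<exists>k\<in>H. (\<forall>u\<in>U. k u = u) \<and> k x = y"
    if U: "U \<subseteq> ?X" "card U = ?f" "x \<in> ?X - U" "y \<in> ?X - U" for U x y
  proof -
    obtain h where h: "h \<in> H" "h ` F = U" using homogeneousD[OF hom F U(1,2)] .
    have bh: "bij h" using perm_subgroup_bij[OF H h(1)] .
    have "inv' h w \<in> \<Gamma>" if "w \<in> ?X - U" for w
    proof -
      have "inv' h w \<in> ?X" using that permutes_in_image[OF permutes_inv[OF perm[OF h(1)]]] by blast
      moreover have "inv' h w \<notin> F" using that h(2) bh by (metis DiffD2 bij_is_surj imageI surj_f_inv_f)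
      ultimately show ?thesis by (simp add: F_def)
    qed
    then obtain i where i: "(g ^^ i) (inv' h x) = inv' h y" using gcyc U(3,4) by blast
    define k where "k = h \<circ> (g ^^ i) \<circ> inv' h"
    have "k \<in> H" unfolding k_def
      using perm_subgroup_comp[OF H] perm_subgroup_inv[OF H h(1)] h(1) gpow by blast
    moreover have "k x = y" using i bh by (simp add: k_def bij_is_surj surj_f_inv_f)
    moreover have "k u = u" if "u \<in> U" for u
    proof -
      obtain v where v: "v \<in> F" "u = h v" using \<open>u \<in> U\<close> h(2) by blast
      then have "inv' h u = v" using bh by (simp add: bij_is_inj)
      then show ?thesis using v giF[of v i] by (simp add: k_def F_def)
    qed
    ultimately show ?thesis by blast
  qed
  \<comment> \<open>A smaller \<open>U\<close> is enlarged to exactly \<open>n - p\<close> points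
    that still avoid \<open>x\<close> and \<open>y\<close>; there is room because
    \<open>p \<ge> 2\<close>.\<close>
  have stab: "\<exists>k\<in>H. (\<forall>u\<in>U. k u = u) \<and> k x = y"
    if U: "U \<subseteq> ?X" "card U \<le> ?f" "x \<in> ?X - U" "y \<in> ?X - U" for U x y
  proof -
    have "card (?X - {x, y}) \<ge> n - 2" using diff_card_le_card_Diff[of "{x, y}" ?X] card_insert_le_m1[of 2 "{y}" x] by simp
    moreover have "n - p \<le> n - 2" using prime_ge_2_nat[OF p(1)] by simp
    moreover have "U \<subseteq> ?X - {x, y}" using U by auto
    ultimately obtain U' where U': "U \<subseteq> U'" "U' \<subseteq> ?X - {x, y}" "card U' = ?f"
      using exists_subset_between[of U ?f "?X - {x, y}"] U(2) by auto
    then show ?thesis using stab_exact[of U' x y] U by blast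
  qed
  have trans: "\<exists>h\<in>H. map h xs = ys"
    if "length xs = length ys" "length xs \<le> Suc ?f" "distinct xs" "distinct ys"
      "set xs \<subseteq> ?X" "set ys \<subseteq> ?X" for xs ys
    by (rule map_transitive_if_point_stabilisers_transitive[OF H stab that])

  define L where "L = {h \<in> H. \<forall>x\<in>F. h x = x}"
  have L: "subgroup L (sym_group n)"
  proof (rule S.subgroupI)
    show "L \<subseteq> carrier (sym_group n)" using perm by (auto simp: L_def sym_group_carrier)
    show "L \<noteq> {}" using perm_subgroup_id[OF H] by (auto simp: L_def)
    show "inv\<^bsub>sym_group n\<^esub> h \<in> L" if "h \<in> L" for h
    proof -
      have h: "h \<in> H" "\<forall>x\<in>F. h x = x" using that by (auto simp: L_def)
      then have "inv' h x = x" if "x \<in> F" for x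
        using that perm_subgroup_bij[OF H h(1)] by (metis bij_is_inj inv_f_f)
      then show ?thesis using h(1) perm_subgroup_inv[OF H h(1)] perm[OF h(1)]
        by (simp add: L_def sym_group_carrier)
    qed
    show "h \<otimes>\<^bsub>sym_group n\<^esub> h' \<in> L" if "h \<in> L" "h' \<in> L" for h h'
      using that perm_subgroup_comp[OF H] by (simp add: L_def sym_group_mult del: o_apply) (simp add: o_def)
  qed
  have gL: "g ^^ i \<in> L" for i using gpow giF by (auto simp: L_def F_def)
  define P where "P = range (\<lambda>i. g ^^ i)"
  have Pcard: "card P = p"
  proof -
    have "P = (\<lambda>i. g ^^ i) ` {..<p}"
    proof -
      have "g ^^ i = g ^^ (i mod p)" for i using funpow_mod_eq[OF per] by (simp add: fun_eq_iff)
      moreover have "i mod p < p" for i using p0 by simp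
      ultimately show ?thesis unfolding P_def by (blast intro: lessThan_iff[THEN iffD2])
    qed
    moreover have "inj_on (\<lambda>i. g ^^ i) {..<p}"
    proof (rule inj_onI)
      obtain x where x: "g x \<noteq> x" using g(3) by (auto simp: fun_eq_iff)
      fix i j assume "i \<in> {..<p}" "j \<in> {..<p}" "g ^^ i = g ^^ j"
      then show "i = j" using funpow_prime_period_inj[OF p(1) per x] by (auto simp: inj_on_def)
    qed
    ultimately show ?thesis by (simp add: card_image)
  qed
  interpret L: group "sym_group n\<lparr>carrier := L\<rparr>" using S.subgroup_imp_group[OF L] .
  have P: "subgroup P (sym_group n\<lparr>carrier := L\<rparr>)"
  proof (rule L.subgroupI)
    show "P \<subseteq> carrier (sym_group n\<lparr>carrier := L\<rparr>)" using gL by (auto simp: P_def)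
    show "P \<noteq> {}" by (auto simp: P_def)
    have mult: "a \<otimes>\<^bsub>sym_group n\<lparr>carrier := L\<rparr>\<^esub> b = a \<circ> b" for a b by (simp add: sym_group_mult)
    show "a \<otimes>\<^bsub>sym_group n\<lparr>carrier := L\<rparr>\<^esub> b \<in> P" if "a \<in> P" "b \<in> P" for a b
    proof -
      obtain i j where "a = g ^^ i" "b = g ^^ j" using \<open>a \<in> P\<close> \<open>b \<in> P\<close> unfolding P_def by blast
      then have "a \<circ> b = g ^^ (i + j)" by (simp add: funpow_add)
      then show ?thesis unfolding mult P_def by blast
    qed
    show "inv\<^bsub>sym_group n\<lparr>carrier := L\<rparr>\<^esub> a \<in> P" if "a \<in> P" for a
    proof -
      obtain i where a: "a = g ^^ i" using \<open>a \<in> P\<close> unfolding P_def by blast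
      have "g ^^ (i * p - i) \<circ> a = g ^^ (i * p - i + i)" by (simp add: a funpow_add)
      also have "\<dots> = g ^^ (i * p)" using p0 by simp
      also have "\<dots> = id" using funpow_eq_mod[OF per] by (simp add: fun_eq_iff)
      finally have "inv\<^bsub>sym_group n\<lparr>carrier := L\<rparr>\<^esub> a = g ^^ (i * p - i)"
        using gL by (intro L.inv_equality) (simp_all add: sym_group_mult sym_group_one a)
      then show ?thesis by (simp add: P_def)
    qed
  qed
  \<comment> \<open>\<open>L\<close> embeds into the symmetric group on the \<open>p\<close> points
    of \<open>\<Gamma>\<close>, and \<open>fact p\<close> has only one factor \<open>p\<close>. So
    the powers of \<open>g\<close> form a Sylow subgroup of \<open>L\<close>.\<close>
  have ordL: "\<not> p * p dvd order (sym_group n\<lparr>carrier := L\<rparr>)"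
  proof
    define Q where "Q = {q. q permutes \<Gamma>}"
    have \<Gamma>X: "\<Gamma> \<subseteq> ?X" using z(2) by (simp add: \<Gamma>_def)
    have Q: "subgroup Q (sym_group n)"
    proof (rule S.subgroupI)
      show "Q \<subseteq> carrier (sym_group n)"
        using permutes_subset[OF _ \<Gamma>X] by (auto simp: Q_def sym_group_carrier)
      then show "inv\<^bsub>sym_group n\<^esub> q \<in> Q" if "q \<in> Q" for q
        using that permutes_inv[of q \<Gamma>] sym_group_inv_equality[OF subsetD[of Q _ q]] by (simp add: Q_def)
    qed (auto simp: Q_def sym_group_mult intro: permutes_id permutes_compose)
    then interpret Q: group "sym_group n\<lparr>carrier := Q\<rparr>" using S.subgroup_imp_group by blast
    have "L \<subseteq> Q"
    proof
      fix h assume "h \<in> L"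
      then have "h permutes ?X" "\<forall>x\<in>F. h x = x" using perm by (auto simp: L_def)
      then show "h \<in> Q" unfolding Q_def
        by (auto intro!: permutes_superset[of h ?X \<Gamma>] simp: F_def)
    qed
    then have "subgroup L (sym_group n\<lparr>carrier := Q\<rparr>)" using S.subgroup_incl[OF L Q] by blast
    from Q.lagrange[OF this] have "card Q = card (rcosets\<^bsub>sym_group n\<lparr>carrier := Q\<rparr>\<^esub> L) * card L"
      by (simp add: order_def)
    then have "card L dvd card Q" by simp
    also have "card Q = fact p" using card_permutations[OF _ fin(1)] z(3) by (simp add: Q_def \<Gamma>_def)
    also have "fact p = p * fact (p - 1)" using p0 by (simp add: fact_reduce)
    finally have cd: "card L dvd p * fact (p - 1)" .
    assume "p * p dvd order (sym_group n\<lparr>carrier := L\<rparr>)"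
    then have "p * p dvd card L" by (simp add: order_def)
    then have "p * p dvd p * fact (p - 1)" using cd by (rule dvd_trans)
    then have "p dvd fact (p - 1)" using p0 by simp
    then show False using p(1) p0 by (simp add: prime_dvd_fact_iff)
  qed

  \<comment> \<open>Some \<open>h\<close> in \<open>H\<close> acts as \<open>\<sigma>\<close> on
    \<open>F\<close>, and the conjugate of \<open>g\<close> by \<open>h\<close> still fixes
    \<open>F\<close> pointwise, so it lies in \<open>L\<close>. An element \<open>t\<close> of
    \<open>L\<close> conjugates it into the powers of \<open>g\<close>; since \<open>t\<close> is
    trivial on \<open>F\<close>, the product \<open>t \<circ> h\<close> still acts as
    \<open>\<sigma>\<close> there.\<close>
  have normaliser: "\<exists>t\<in>H. \<exists>e. (\<forall>x\<in>F. t x = \<sigma> x) \<and> t \<circ> g = g ^^ e \<circ> t" if \<sigma>: "\<sigma> permutes F" for \<sigma>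
  proof -
    obtain xs where xs: "set xs = F" "distinct xs" using finite_distinct_list[OF fin(2)] by blast
    have "length xs = ?f" using xs F(2) distinct_card by metis
    moreover have "set (map \<sigma> xs) \<subseteq> ?X" using xs(1) F(1) permutes_image[OF \<sigma>] by simp
    moreover have "distinct (map \<sigma> xs)" using xs \<sigma> by (simp add: distinct_map permutes_inj_on)
    ultimately obtain h where h: "h \<in> H" "map h xs = map \<sigma> xs"
      using trans[of xs "map \<sigma> xs"] xs F(1) by auto
    have hF: "h x = \<sigma> x" if "x \<in> F" for x using h(2) xs(1) that by simp
    have bh: "bij h" using perm_subgroup_bij[OF H h(1)] .
    define g' where "g' = h \<circ> g \<circ> inv' h"
    have "g' \<in> H" unfolding g'_def using perm_subgroup_comp[OF H] perm_subgroup_inv[OF H h(1)] h(1) g(1) by blast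
    moreover have "g' x = x" if "x \<in> F" for x
    proof -
      have "x \<in> \<sigma> ` F" using that permutes_image[OF \<sigma>] by simp
      then obtain y where y: "y \<in> F" "x = h y" using hF by auto
      then have "inv' h x = y" using bh by (simp add: bij_is_inj)
      then show ?thesis using y gF[of y] by (simp add: g'_def F_def)
    qed
    ultimately have g'L: "g' \<in> L" by (simp add: L_def)
    have "g' ^^ p = id"
      unfolding g'_def funpow_conj[OF bh] g(2) using bh by (simp add: fun_eq_iff bij_is_surj surj_f_inv_f)
    then have "g' [^]\<^bsub>sym_group n\<lparr>carrier := L\<rparr>\<^esub> p = \<one>\<^bsub>sym_group n\<lparr>carrier := L\<rparr>\<^esub>"
      using sym_group_pow[where g = g' and n = n and i = p] by (simp add: nat_pow_def sym_group_one)
    moreover have "finite (carrier (sym_group n\<lparr>carrier := L\<rparr>))"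
      using L finite_permutations[of ?X] by (auto simp: sym_group_def dest!: subgroup.subset intro: finite_subset)
    ultimately obtain t where t: "t \<in> L"
      "t \<otimes>\<^bsub>sym_group n\<lparr>carrier := L\<rparr>\<^esub> g' \<otimes>\<^bsub>sym_group n\<lparr>carrier := L\<rparr>\<^esub> inv\<^bsub>sym_group n\<lparr>carrier := L\<rparr>\<^esub> t \<in> P"
      using L.conjugate_into_prime_subgroup[OF p(1) _ P Pcard ordL, of g'] g'L by auto
    have tH: "t \<in> H" "\<forall>x\<in>F. t x = x" using t(1) by (auto simp: L_def)
    have bt: "bij t" using perm_subgroup_bij[OF H tH(1)] .
    have "inv\<^bsub>sym_group n\<lparr>carrier := L\<rparr>\<^esub> t = inv' t"
      using S.m_inv_consistent[OF L t(1)] sym_group_inv_equality perm[OF tH(1)] by (simp add: sym_group_carrier)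
    then obtain e where e: "t \<circ> g' \<circ> inv' t = g ^^ e" using t(2) by (auto simp: P_def sym_group_mult)
    have "t \<circ> h \<circ> g = t \<circ> g' \<circ> inv' t \<circ> (t \<circ> h)"
      unfolding g'_def using bh bt by (simp add: fun_eq_iff bij_is_inj)
    then have "(t \<circ> h) \<circ> g = g ^^ e \<circ> (t \<circ> h)" by (simp only: e)
    moreover have "(t \<circ> h) x = \<sigma> x" if "x \<in> F" for x
      using hF[OF that] tH(2) that permutes_in_image[OF \<sigma>] by simp
    ultimately show ?thesis using perm_subgroup_comp[OF H tH(1) h(1)] by blast
  qed

  have "card F \<ge> 3" using F(2) p(3) by simp
  then obtain T where "T \<subseteq> F" "card T = 3" using obtain_subset_with_card_n by metis
  then obtain u v w where uvw: "u \<in> F" "v \<in> F" "w \<in> F" "u \<noteq> v" "v \<noteq> w" "u \<noteq> w"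
    by (auto simp: card_3_iff)
  \<comment> \<open>Two overlapping transpositions of fixed points do not commute; this is where the
    three fixed points are spent.\<close>
  obtain a ea where a: "a \<in> H" "\<forall>x\<in>F. a x = transpose u v x" "a \<circ> g = g ^^ ea \<circ> a"
    using normaliser[OF permutes_swap_id[OF uvw(1,2)]] by blast
  obtain b eb where b: "b \<in> H" "\<forall>x\<in>F. b x = transpose v w x" "b \<circ> g = g ^^ eb \<circ> b"
    using normaliser[OF permutes_swap_id[OF uvw(2,3)]] by blast
  have comm_pow: "t \<circ> g ^^ i = g ^^ (e * i) \<circ> t" if "t \<circ> g = g ^^ e \<circ> t" for t e i
  proof (induction i)
    case (Suc i)
    have "t \<circ> g ^^ Suc i = (t \<circ> g) \<circ> g ^^ i" by (simp add: fun_eq_iff)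
    also have "\<dots> = g ^^ e \<circ> (t \<circ> g ^^ i)" by (simp only: that comp_assoc)
    also have "\<dots> = g ^^ (e * Suc i) \<circ> t" by (simp add: Suc funpow_add fun_eq_iff add.commute)
    finally show ?case .
  qed simp
  have ab: "a \<circ> b \<circ> g = g ^^ (ea * eb) \<circ> (a \<circ> b)"
  proof -
    have "a \<circ> b \<circ> g = a \<circ> g ^^ eb \<circ> b" by (simp only: comp_assoc b(3))
    then show ?thesis by (simp only: comm_pow[OF a(3)] comp_assoc)
  qed
  have ba: "b \<circ> a \<circ> g = g ^^ (ea * eb) \<circ> (b \<circ> a)"
  proof -
    have "b \<circ> a \<circ> g = b \<circ> g ^^ ea \<circ> a" by (simp only: comp_assoc a(3))
    then show ?thesis by (simp only: comm_pow[OF b(3)] comp_assoc mult.commute)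
  qed
  \<comment> \<open>Both \<open>a \<circ> b\<close> and \<open>b \<circ> a\<close> turn
    \<open>g\<close> into the power with exponent \<open>ea * eb\<close>, so this quotient commutes
    with \<open>g\<close>; on \<open>F\<close> it acts as a commutator of the two
    transpositions.\<close>
  define c where "c = inv' (b \<circ> a) \<circ> (a \<circ> b)"
  have cH: "c \<in> H" unfolding c_def using a(1) b(1) perm_subgroup_comp[OF H] perm_subgroup_inv[OF H] by blast
  have bba: "bij (b \<circ> a)" using a(1) b(1) perm_subgroup_bij[OF H] perm_subgroup_comp[OF H] by blast
  have cg: "c (g x) = g (c x)" for x
  proof -
    have "(b \<circ> a) (g (c x)) = (g ^^ (ea * eb)) ((b \<circ> a) (c x))" using ba by (metis comp_apply)
    also have "(b \<circ> a) (c x) = (a \<circ> b) x"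
      unfolding c_def using bba by (metis bij_is_surj comp_apply surj_f_inv_f)
    also have "(g ^^ (ea * eb)) ((a \<circ> b) x) = (a \<circ> b) (g x)" using ab by (metis comp_apply)
    finally show ?thesis unfolding c_def using bba by (metis bij_is_inj comp_apply inv_f_f)
  qed
  have cgi: "c ((g ^^ i) x) = (g ^^ i) (c x)" for i x by (induction i) (auto simp: cg)
  have cF: "c x = y" if "x \<in> F" "y \<in> F" "transpose u v (transpose v w x) = transpose v w (transpose u v y)" for x y
  proof -
    have "transpose v w x \<in> F" "transpose u v y \<in> F"
      using that(1,2) uvw by (auto simp: transpose_def)
    then have "(a \<circ> b) x = (b \<circ> a) y" using a(2) b(2) that by simp
    then show ?thesis unfolding c_def using bba by (metis bij_is_inj comp_apply inv_f_f)
  qed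
  have cFF: "c x \<in> F" if "x \<in> F" for x
  proof -
    let ?y = "transpose u v (transpose v w (transpose u v (transpose v w x)))"
    have "?y \<in> F" using that uvw by (simp add: transpose_def)
    then show ?thesis using cF[OF that, of ?y] by simp
  qed
  have c\<Gamma>: "c z \<in> \<Gamma>"
  proof (rule ccontr)
    assume "c z \<notin> \<Gamma>"
    then have "c z \<in> F" using z(1) permutes_in_image[OF perm[OF cH]] by (simp add: F_def)
    moreover have "c ` F = F"
      using cFF fin(2) permutes_inj_on[OF perm[OF cH]] by (intro endo_inj_surj) auto
    ultimately obtain x where "x \<in> F" "c x = c z" by (metis imageE)
    then have "z \<in> F" using permutes_inj[OF perm[OF cH]] by (simp add: inj_eq)
    then show False using funpow_orbit_self[of z g] by (simp add: F_def \<Gamma>_def)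
  qed
  then obtain i where i: "(g ^^ i) z = c z"
    using gcyc[of z "c z"] funpow_orbit_self[of z g] by (auto simp: \<Gamma>_def)
  \<comment> \<open>\<open>c\<close> agrees with \<open>g ^^ i\<close> at \<open>z\<close> and
    commutes with \<open>g\<close>, hence agrees with it on the whole cycle \<open>\<Gamma>\<close>;
    dividing by this power leaves the action on \<open>F\<close> as it is.\<close>
  define d where "d = inv' (g ^^ i) \<circ> c"
  have dH: "d \<in> H" unfolding d_def using perm_subgroup_comp[OF H] perm_subgroup_inv[OF H gpow] cH by blast
  have bi: "bij (g ^^ i)" using perm_subgroup_bij[OF H gpow] .
  have d\<Gamma>: "d x = x" if "x \<in> \<Gamma>" for x
  proof -
    obtain j where j: "x = (g ^^ j) z" using \<open>x \<in> \<Gamma>\<close> by (auto simp: \<Gamma>_def funpow_orbit_def)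
    have "c x = (g ^^ j) ((g ^^ i) z)" by (simp add: j cgi i)
    also have "\<dots> = (g ^^ i) x" by (simp add: j) (metis add.commute comp_apply funpow_add)
    finally show ?thesis using bi by (simp add: d_def bij_is_inj)
  qed
  have dF: "d x = c x" if "x \<in> F" for x
  proof -
    have "(g ^^ i) (c x) = c x" using cFF[OF that] giF by (simp add: F_def)
    then show ?thesis unfolding d_def using bi by (metis bij_is_inj comp_apply inv_f_f)
  qed
  have "d = cycle_of_list [u, w, v]"
  proof
    fix x
    consider "x \<notin> ?X" | "x \<in> \<Gamma>" | "x \<in> F" by (auto simp: F_def)
    then show "d x = cycle_of_list [u, w, v] x"
    proof cases
      case 1
      then show ?thesis using permutes_not_in[OF perm[OF dH]] uvw F(1) by (auto simp: transpose_def)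
    next
      case 2
      then show ?thesis using d\<Gamma> uvw by (auto simp: transpose_def F_def)
    next
      case 3
      have "d x = cycle_of_list [u, w, v] x"
        unfolding dF[OF 3] using uvw 3 by (intro cF) (auto simp: transpose_def)
      then show ?thesis .
    qed
  qed
  then have dcyc: "cycle_of_list [u, w, v] \<in> H" using dH by simp
  \<comment> \<open>\<open>H\<close> is transitive on triples of distinct points because
    \<open>3 \<le> Suc (n - p)\<close>, so every 3-cycle is conjugate in \<open>H\<close> to the one
    just found.\<close>
  have "three_cycles n \<subseteq> H"
  proof
    fix q assume "q \<in> three_cycles n"
    then obtain cs where cs: "q = cycle_of_list cs" "cycle cs" "length cs = 3" "set cs \<subseteq> ?X" by auto
    have "set [u, w, v] \<subseteq> ?X" "length [u, w, v] \<le> Suc ?f" "distinct [u, w, v]"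
      using uvw F(1) p(3) by auto
    then obtain h where h: "h \<in> H" "map h [u, w, v] = cs"
      using trans[of "[u, w, v]" cs] cs(2-4) by auto
    have "h \<circ> cycle_of_list [u, w, v] \<circ> inv' h = q"
      using conjugation_of_cycle[of "[u, w, v]" h] perm_subgroup_bij[OF H h(1)] uvw h(2) cs(1) by auto
    then show "q \<in> H" using perm_subgroup_comp[OF H] perm_subgroup_inv[OF H h(1)] h(1) dcyc by blast
  qed
  then show ?thesis by (rule three_cycles_generate[OF H])
qed

section \<open>From homogeneity on k-subsets to the alternating group, for even k\<close>

lemma perm_subgroup_finite:
  assumes "subgroup H (sym_group n)"
  shows "finite H"
proof (rule finite_subset)
  show "H \<subseteq> {h. h permutes {1..n}}" using perm_subgroup_permutes[OF assms] by blast
qed (simp add: finite_permutations)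

text \<open>An orbit-stabiliser count: composing with an element that takes \<open>A\<close> to
  \<open>B\<close> maps the stabiliser of \<open>A\<close> bijectively onto the set of elements
  taking \<open>A\<close> to \<open>B\<close>, so all these fibres have the same size.\<close>

lemma binomial_dvd_card_homogeneous:
  assumes H: "subgroup H (sym_group n)" and hom: "homogeneous n k H" and k: "k \<le> n"
  shows "(n choose k) dvd card H"
proof -
  define V where "V = {B. B \<subseteq> {1..n} \<and> card B = k}"
  have finV: "finite V" by (simp add: V_def)
  have finH: "finite H" by (rule perm_subgroup_finite[OF H])
  obtain A where A: "A \<subseteq> {1..n}" "card A = k"
  proof
    show "{1..k} \<subseteq> {1..n}" using k by auto
  qed simp
  define fib where "fib B = {h \<in> H. h ` A = B}" for B
  have "card (fib B) = card (fib A)" if "B \<in> V" for B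
  proof -
    have "B \<subseteq> {1..n}" "card B = k" using that by (auto simp: V_def)
    then obtain h where h: "h \<in> H" "h ` A = B" using homogeneousD[OF hom A] by metis
    have bh: "bij h" using perm_subgroup_bij[OF H h(1)] .
    have "bij_betw (\<lambda>s. h \<circ> s) (fib A) (fib B)"
    proof (rule bij_betw_byWitness[where f' = "\<lambda>s. inv' h \<circ> s"])
      show "\<forall>s\<in>fib A. inv' h \<circ> (h \<circ> s) = s" using bh by (simp add: fun_eq_iff bij_is_inj)
      show "\<forall>s\<in>fib B. h \<circ> (inv' h \<circ> s) = s" using bh by (simp add: fun_eq_iff bij_is_surj surj_f_inv_f)
      show "(\<lambda>s. h \<circ> s) ` fib A \<subseteq> fib B"
      proof
        fix q assume "q \<in> (\<lambda>s. h \<circ> s) ` fib A"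
        then obtain s where s: "s \<in> H" "s ` A = A" "q = h \<circ> s" by (auto simp: fib_def)
        then have "q ` A = B" using h(2) by (simp only: image_comp[symmetric])
        then show "q \<in> fib B" using s perm_subgroup_comp[OF H h(1)] by (simp add: fib_def)
      qed
      show "(\<lambda>s. inv' h \<circ> s) ` fib B \<subseteq> fib A"
      proof
        fix q assume "q \<in> (\<lambda>s. inv' h \<circ> s) ` fib B"
        then obtain s where s: "s \<in> H" "s ` A = B" "q = inv' h \<circ> s" by (auto simp: fib_def)
        have "q ` A = inv' h ` h ` A" using s h(2) by (simp only: image_comp[symmetric])
        also have "\<dots> = A" using bh by (simp add: bij_is_inj)
        finally show "q \<in> fib A"
          using s perm_subgroup_comp[OF H perm_subgroup_inv[OF H h(1)]] by (simp add: fib_def)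
      qed
    qed
    then show ?thesis by (simp add: bij_betw_same_card)
  qed
  moreover have "card H = (\<Sum>B\<in>V. card (fib B))"
  proof -
    have "(\<lambda>h. h ` A) ` H \<subseteq> V"
    proof (intro image_subsetI)
      fix h assume "h \<in> H"
      from perm_subgroup_permutes[OF H this] show "h ` A \<in> V"
        using permutes_image_subset[of h _ A] permutes_card_image[of h _ A] A unfolding V_def by blast
    qed
    from sum.group[OF finH finV this, of "\<lambda>_. 1 :: nat"] show ?thesis by (simp add: fib_def)
  qed
  ultimately have "card H = card V * card (fib A)" by simp
  also have "card V = n choose k" using n_subsets[of "{1..n}" k] by (simp add: V_def)
  finally show ?thesis by simp
qed

theorem homogeneous_even_contains_alt:
  assumes k: "k \<ge> 4" "even k" and H: "subgroup H (sym_group (2 * k))" and hom: "homogeneous (2 * k) k H"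
  shows "carrier (alt_group (2 * k)) \<subseteq> H"
proof -
  interpret S: group "sym_group (2 * k)" by (rule sym_group_is_group)
  interpret HG: group "sym_group (2 * k)\<lparr>carrier := H\<rparr>" using S.subgroup_imp_group[OF H] .
  \<comment> \<open>Bertrand's postulate is applied to \<open>k - 1\<close> and not to
    \<open>k\<close>, which would allow \<open>p = 2 * k - 1\<close> and a single fixed point. The
    price is the possible value \<open>p = k\<close>, excluded because \<open>k\<close> is even and
    greater than 2.\<close>
  obtain p where p: "prime p" "k - 1 < p" "p < 2 * (k - 1)" using bertrand[of "k - 1"] k(1) by fastforce
  have "p \<noteq> k" using primes_dvd_imp_eq[of 2 p] p(1) k by auto
  then have kp: "k < p" "p + 3 \<le> 2 * k" using p k(1) by auto
  have "p dvd (2 * k choose k)" using p(1) kp by (intro prime_dvd_binomial) auto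
  also have "\<dots> dvd card H" using binomial_dvd_card_homogeneous[OF H hom] by simp
  finally have "p dvd order (sym_group (2 * k)\<lparr>carrier := H\<rparr>)" by (simp add: order_def)
  moreover have "finite (carrier (sym_group (2 * k)\<lparr>carrier := H\<rparr>))"
    using perm_subgroup_finite[OF H] by simp
  ultimately obtain g where g: "g \<in> H" "g \<noteq> id"
      "g [^]\<^bsub>sym_group (2 * k)\<lparr>carrier := H\<rparr>\<^esub> p = id"
    using HG.obtain_prime_order_element[OF p(1)] by (auto simp: sym_group_one)
  then have "g ^^ p = id" using sym_group_pow[where g = g and n = "2 * k" and i = p] by (simp add: nat_pow_def sym_group_one)
  moreover have "homogeneous (2 * k) (2 * k - p) H"
    using homogeneous_mono[OF H hom, of "2 * k - p"] kp by simp
  ultimately show ?thesis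
    using homogeneous_with_prime_cycle_contains_alt[OF H p(1)] kp g by simp
qed

section \<open>Automorphisms and arcs\<close>

lemma aut_group_carrier:
  "f \<in> carrier (aut_group \<Gamma>) \<longleftrightarrow> f \<in> Bij (pverts \<Gamma>) \<and>
     (\<forall>u\<in>pverts \<Gamma>. \<forall>v\<in>pverts \<Gamma>. (f u, f v) \<in> parcs \<Gamma> \<longleftrightarrow> (u, v) \<in> parcs \<Gamma>)"
  by (simp add: aut_group_def)

lemma aut_group_closed: "f \<in> carrier (aut_group \<Gamma>) \<Longrightarrow> v \<in> pverts \<Gamma> \<Longrightarrow> f v \<in> pverts \<Gamma>"
  using Bij_imp_funcset unfolding aut_group_carrier by fast

lemma aut_group_arc:
  "f \<in> carrier (aut_group \<Gamma>) \<Longrightarrow> u \<in> pverts \<Gamma> \<Longrightarrow> v \<in> pverts \<Gamma> \<Longrightarrow>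
    (f u, f v) \<in> parcs \<Gamma> \<longleftrightarrow> (u, v) \<in> parcs \<Gamma>"
  unfolding aut_group_carrier by blast

lemma aut_group_inj: "f \<in> carrier (aut_group \<Gamma>) \<Longrightarrow> inj_on f (pverts \<Gamma>)"
  unfolding aut_group_carrier by (simp add: Bij_def bij_betw_def)

lemma aut_group_eqI:
  assumes "f \<in> carrier (aut_group \<Gamma>)" "g \<in> carrier (aut_group \<Gamma>)" "\<And>v. v \<in> pverts \<Gamma> \<Longrightarrow> f v = g v"
  shows "f = g"
  using assms Bij_imp_extensional unfolding aut_group_carrier by (metis extensionalityI)

lemma aut_group_one_apply: "v \<in> pverts \<Gamma> \<Longrightarrow> \<one>\<^bsub>aut_group \<Gamma>\<^esub> v = v"
  by (simp add: aut_group_def BijGroup_def)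

lemma aut_group_mult_apply:
  assumes "f \<in> carrier (aut_group \<Gamma>)" "g \<in> carrier (aut_group \<Gamma>)" "v \<in> pverts \<Gamma>"
  shows "(f \<otimes>\<^bsub>aut_group \<Gamma>\<^esub> g) v = f (g v)"
  using assms by (simp add: aut_group_def BijGroup_def compose_def)

lemma aut_group_is_group: "group (aut_group \<Gamma>)"
proof -
  interpret B: group "BijGroup (pverts \<Gamma>)" by (rule group_BijGroup)
  let ?C = "carrier (aut_group \<Gamma>)" and ?V = "pverts \<Gamma>"
  have C: "?C \<subseteq> carrier (BijGroup ?V)" by (auto simp: aut_group_carrier BijGroup_def)
  have "subgroup ?C (BijGroup ?V)"
  proof (rule B.subgroupI[OF C])
    have "(\<lambda>x\<in>?V. x) \<in> ?C" by (simp add: aut_group_carrier id_Bij)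
    then show "?C \<noteq> {}" by blast
    show "f \<otimes>\<^bsub>BijGroup ?V\<^esub> g \<in> ?C" if "f \<in> ?C" "g \<in> ?C" for f g
    proof -
      have B: "f \<in> Bij ?V" "g \<in> Bij ?V" using that by (auto simp: aut_group_carrier)
      have "compose ?V f g \<in> ?C"
        using compose_Bij[OF B] aut_group_closed[OF that(2)] aut_group_arc[OF that(1)] aut_group_arc[OF that(2)]
        by (simp add: aut_group_carrier compose_eq)
      then show ?thesis using B by (simp add: BijGroup_def)
    qed
    show "inv\<^bsub>BijGroup ?V\<^esub> f \<in> ?C" if f: "f \<in> ?C" for f
    proof -
      have fB: "f \<in> Bij ?V" using f by (simp add: aut_group_carrier)
      then have inv: "inv\<^bsub>BijGroup ?V\<^esub> f = (\<lambda>x\<in>?V. inv_into ?V f x)" by (rule inv_BijGroup)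
      have im: "f ` ?V = ?V" using fB by (simp add: Bij_def bij_betw_def)
      have "(inv_into ?V f u, inv_into ?V f v) \<in> parcs \<Gamma> \<longleftrightarrow> (u, v) \<in> parcs \<Gamma>"
        if "u \<in> ?V" "v \<in> ?V" for u v
        using aut_group_arc[OF f, of "inv_into ?V f u" "inv_into ?V f v"] that im
        by (metis f_inv_into_f inv_into_into)
      then show ?thesis using restrict_inv_into_Bij[OF fB] by (simp add: inv aut_group_carrier)
    qed
  qed
  then show ?thesis using B.subgroup_imp_group by (simp add: aut_group_def)
qed

lemma aut_group_inv_apply:
  assumes "f \<in> carrier (aut_group \<Gamma>)" "v \<in> pverts \<Gamma>"
  shows "(inv\<^bsub>aut_group \<Gamma>\<^esub> f) (f v) = v" "f ((inv\<^bsub>aut_group \<Gamma>\<^esub> f) v) = v"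
proof -
  interpret group "aut_group \<Gamma>" by (rule aut_group_is_group)
  show "(inv\<^bsub>aut_group \<Gamma>\<^esub> f) (f v) = v"
    using aut_group_mult_apply[of "inv\<^bsub>aut_group \<Gamma>\<^esub> f" \<Gamma> f v] assms by (simp add: aut_group_one_apply)
  show "f ((inv\<^bsub>aut_group \<Gamma>\<^esub> f) v) = v"
    using aut_group_mult_apply[of f \<Gamma> "inv\<^bsub>aut_group \<Gamma>\<^esub> f" v] assms by (simp add: aut_group_one_apply)
qed

lemma arc_action_Bij:
  assumes wf: "parcs \<Gamma> \<subseteq> pverts \<Gamma> \<times> pverts \<Gamma>" and f: "f \<in> carrier (aut_group \<Gamma>)"
  shows "arc_action \<Gamma> f \<in> Bij (parcs \<Gamma>)"
proof -
  interpret group "aut_group \<Gamma>" by (rule aut_group_is_group)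
  have closed: "arc_action \<Gamma> g e \<in> parcs \<Gamma>" if "g \<in> carrier (aut_group \<Gamma>)" "e \<in> parcs \<Gamma>" for g e
    using that wf aut_group_arc[OF that(1)] by (cases e) (auto simp: arc_action_def)
  let ?g = "inv\<^bsub>aut_group \<Gamma>\<^esub> f"
  have inv: "arc_action \<Gamma> ?g (arc_action \<Gamma> f e) = e" "arc_action \<Gamma> f (arc_action \<Gamma> ?g e) = e"
    if "e \<in> parcs \<Gamma>" for e
    using closed[OF f that] closed[OF inv_closed[OF f] that] that wf aut_group_inv_apply[OF f]
    by (auto simp: arc_action_def split: prod.splits)
  have "bij_betw (arc_action \<Gamma> f) (parcs \<Gamma>) (parcs \<Gamma>)"
    using closed[OF f] closed[OF inv_closed[OF f]] inv
    by (intro bij_betw_byWitness[where f' = "arc_action \<Gamma> ?g"]) auto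
  then show ?thesis by (simp add: Bij_def arc_action_def)
qed

lemma arc_group_action:
  assumes wf: "parcs \<Gamma> \<subseteq> pverts \<Gamma> \<times> pverts \<Gamma>" and H: "subgroup H (aut_group \<Gamma>)"
  shows "group_action (aut_group \<Gamma>\<lparr>carrier := H\<rparr>) (parcs \<Gamma>) (arc_action \<Gamma>)"
proof -
  interpret group "aut_group \<Gamma>" by (rule aut_group_is_group)
  have HC: "f \<in> carrier (aut_group \<Gamma>)" if "f \<in> H" for f using subgroup.mem_carrier[OF H that] .
  have bij: "arc_action \<Gamma> f \<in> Bij (parcs \<Gamma>)" if "f \<in> H" for f by (rule arc_action_Bij[OF wf HC[OF that]])
  have "arc_action \<Gamma> (f \<otimes>\<^bsub>aut_group \<Gamma>\<^esub> g) = compose (parcs \<Gamma>) (arc_action \<Gamma> f) (arc_action \<Gamma> g)"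
    if "f \<in> H" "g \<in> H" for f g
  proof
    fix e
    show "arc_action \<Gamma> (f \<otimes>\<^bsub>aut_group \<Gamma>\<^esub> g) e = compose (parcs \<Gamma>) (arc_action \<Gamma> f) (arc_action \<Gamma> g) e"
    proof (cases "e \<in> parcs \<Gamma>")
      case True
      obtain u v where e: "e = (u, v)" by fastforce
      then have uv: "u \<in> pverts \<Gamma>" "v \<in> pverts \<Gamma>" using True wf by auto
      then have "(g u, g v) \<in> parcs \<Gamma>" using aut_group_arc[OF HC[OF that(2)]] True e by blast
      then show ?thesis
        using True e uv aut_group_mult_apply[OF HC[OF that(1)] HC[OF that(2)]]
        by (simp add: arc_action_def compose_def)
    qed (simp add: arc_action_def compose_def)
  qed
  then have "arc_action \<Gamma> \<in> hom (aut_group \<Gamma>\<lparr>carrier := H\<rparr>) (BijGroup (parcs \<Gamma>))"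
    using bij by (intro homI) (simp_all add: BijGroup_def)
  then show ?thesis
    using subgroup_imp_group[OF H] group_BijGroup by (simp add: group_action_def group_hom_def group_hom_axioms_def)
qed

lemma arc_transitive_iff:
  assumes wf: "parcs \<Gamma> \<subseteq> pverts \<Gamma> \<times> pverts \<Gamma>" and H: "subgroup H (aut_group \<Gamma>)"
  shows "arc_transitive \<Gamma> H \<longleftrightarrow>
    (\<forall>u v u' v'. (u, v) \<in> parcs \<Gamma> \<longrightarrow> (u', v') \<in> parcs \<Gamma> \<longrightarrow> (\<exists>h\<in>H. h u = u' \<and> h v = v'))"
proof -
  have "arc_transitive \<Gamma> H \<longleftrightarrow> (\<forall>x\<in>parcs \<Gamma>. \<forall>y\<in>parcs \<Gamma>. \<exists>h\<in>H. arc_action \<Gamma> h x = y)"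
    using arc_group_action[OF wf H]
    by (auto simp: arc_transitive_def transitive_action_def transitive_action_axioms_def)
  also have "\<dots> \<longleftrightarrow> (\<forall>u v u' v'. (u, v) \<in> parcs \<Gamma> \<longrightarrow> (u', v') \<in> parcs \<Gamma> \<longrightarrow> (\<exists>h\<in>H. h u = u' \<and> h v = v'))"
    by (fastforce simp: arc_action_def)
  finally show ?thesis .
qed

text \<open>
  Two distinct points of a grid are collinear if they agree in exactly one coordinate. The images of the corners of
  a rectangle are again the corners of a rectangle, so all horizontal pairs are mapped to pairs of the same direction.
\<close>
lemma grid_isomorphism:
  fixes \<phi> :: "'a \<times> 'b \<Rightarrow> 'c \<times> 'd"
  assumes two: "\<exists>a\<in>A. \<exists>a'\<in>A. a \<noteq> a'" "\<exists>b\<in>B. \<exists>b'\<in>B. b \<noteq> b'"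
    and inj: "inj_on \<phi> (A \<times> B)"
    and coll: "\<And>a b a' b'. a \<in> A \<Longrightarrow> b \<in> B \<Longrightarrow> a' \<in> A \<Longrightarrow> b' \<in> B \<Longrightarrow>
      (fst (\<phi> (a, b)) = fst (\<phi> (a', b'))) \<noteq> (snd (\<phi> (a, b)) = snd (\<phi> (a', b'))) \<longleftrightarrow> (a = a') \<noteq> (b = b')"
  shows "(\<exists>\<sigma> \<rho>. \<forall>a\<in>A. \<forall>b\<in>B. \<phi> (a, b) = (\<sigma> a, \<rho> b)) \<or> (\<exists>\<sigma> \<rho>. \<forall>a\<in>A. \<forall>b\<in>B. \<phi> (a, b) = (\<rho> b, \<sigma> a))"
proof -
  define x where "x a b = fst (\<phi> (a, b))" for a b
  define y where "y a b = snd (\<phi> (a, b))" for a b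
  have phi: "\<phi> (a, b) = (x a b, y a b)" for a b by (simp add: x_def y_def)
  have injxy: "x a b = x a' b' \<Longrightarrow> y a b = y a' b' \<Longrightarrow> a = a' \<and> b = b'"
    if "a \<in> A" "b \<in> B" "a' \<in> A" "b' \<in> B" for a b a' b'
    using inj that phi by (auto dest!: inj_onD[of \<phi> _ "(a, b)" "(a', b')"])
  have coll': "(x a b = x a' b') \<noteq> (y a b = y a' b') \<longleftrightarrow> (a = a') \<noteq> (b = b')"
    if "a \<in> A" "b \<in> B" "a' \<in> A" "b' \<in> B" for a b a' b'
    using coll[OF that] by (simp add: x_def y_def)
  \<comment> \<open>Injectivity and collinearity force the ends of a diagonal to differ in both
    coordinates, while the ends of a side share exactly one. Two patterns remain: sides with common
    \<open>a\<close> share \<open>x\<close> and those with common \<open>b\<close> share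
    \<open>y\<close>, or the reverse.\<close>
  have square: "(x a b = x a b' \<longleftrightarrow> x a' b = x a' b') \<and> (x a b = x a b' \<longleftrightarrow> y a b = y a' b)
      \<and> (x a b = x a b' \<longleftrightarrow> y a b \<noteq> y a b') \<and> (x a b = x a' b \<longleftrightarrow> y a b \<noteq> y a' b)"
    if m: "a \<in> A" "b \<in> B" "a' \<in> A" "b' \<in> B" and d: "a \<noteq> a'" "b \<noteq> b'" for a b a' b'
    using coll'[OF m(1,2,1,4)] coll'[OF m(1,2,3,2)] coll'[OF m(1,4,3,4)] coll'[OF m(3,2,3,4)]
      coll'[OF m(1,2,3,4)] coll'[OF m(1,4,3,2)] injxy[OF m] injxy[OF m(1,4,3,2)] d by metis
  show ?thesis
  \<comment> \<open>By \<open>square\<close>, one pair with common \<open>a\<close> and equal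
    \<open>x\<close> forces equal \<open>x\<close> for every such pair; hence the coordinates are
    either kept throughout or swapped throughout.\<close>
  proof (cases "\<exists>a\<in>A. \<exists>b\<in>B. \<exists>b'\<in>B. b \<noteq> b' \<and> x a b = x a b'")
    case True
    then obtain a b b' where h: "a \<in> A" "b \<in> B" "b' \<in> B" "b \<noteq> b'" "x a b = x a b'" by blast
    have row: "x a b = x a b1" if "b1 \<in> B" for b1
    proof (cases "b1 = b")
      case False
      obtain a1 where a1: "a1 \<in> A" "a1 \<noteq> a" using two(1) by metis
      then show ?thesis using square[OF h(1,2) a1(1) h(3)] square[OF h(1,2) a1(1) that] h False by metis
    qed simp
    have row': "x a1 b = x a1 b1" if "a1 \<in> A" "b1 \<in> B" for a1 b1
    proof (cases "a1 = a \<or> b1 = b")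
      case False
      then show ?thesis using square[OF h(1,2) that] row[OF that(2)] by metis
    qed (use row[OF that(2)] in auto)
    have X: "x a1 b1 = x a1 b2" if "a1 \<in> A" "b1 \<in> B" "b2 \<in> B" for a1 b1 b2
      using row'[OF that(1,2)] row'[OF that(1,3)] by simp
    have Y: "y a1 b1 = y a2 b1" if "a1 \<in> A" "a2 \<in> A" "b1 \<in> B" for a1 a2 b1
    proof (cases "a1 = a2")
      case False
      obtain b2 where b2: "b2 \<in> B" "b2 \<noteq> b1" using two(2) by metis
      then show ?thesis using square[OF that(1,3,2) b2(1)] X[OF that(1,3) b2(1)] False by metis
    qed simp
    have "\<forall>a1\<in>A. \<forall>b1\<in>B. \<phi> (a1, b1) = (x a1 b, y a b1)"
      using X Y h(1,2) phi by (metis prod.inject)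
    then show ?thesis by (intro disjI1 exI[of _ "\<lambda>a. x a b"] exI[of _ "\<lambda>b. y a b"])
  next
    case False
    have Y: "y a1 b1 = y a1 b2" if "a1 \<in> A" "b1 \<in> B" "b2 \<in> B" for a1 b1 b2
      using False coll'[OF that(1,2,1,3)] that by metis
    have X: "x a1 b1 = x a2 b1" if "a1 \<in> A" "a2 \<in> A" "b1 \<in> B" for a1 a2 b1
    proof (cases "a1 = a2")
      case neq: False
      obtain b2 where b2: "b2 \<in> B" "b2 \<noteq> b1" using two(2) by metis
      then show ?thesis using square[OF that(1,3,2) b2(1)] False that neq by metis
    qed simp
    obtain a b where ab: "a \<in> A" "b \<in> B" using two by blast
    have "\<forall>a1\<in>A. \<forall>b1\<in>B. \<phi> (a1, b1) = (x a b1, y a1 b)"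
      using X Y ab phi by (metis prod.inject)
    then show ?thesis by (intro disjI2 exI[of _ "\<lambda>a. y a b"] exI[of _ "\<lambda>b. x a b"])
  qed
qed

section \<open>The automorphism group of the middle Johnson graph\<close>

lemma two_distinct_elements:
  assumes "2 \<le> card S"
  shows "\<exists>x\<in>S. \<exists>y\<in>S. x \<noteq> y"
proof -
  obtain D where "D \<subseteq> S" "card D = 2" using obtain_subset_with_card_n[OF assms] by blast
  moreover from this obtain x y where "D = {x, y}" "x \<noteq> y" by (meson card_2_iff)
  ultimately show ?thesis by blast
qed

text \<open>The neighbours of a vertex \<open>A\<close> are the sets \<open>exchange A a b\<close>
  with \<open>a\<close> in \<open>A\<close> and \<open>b\<close> outside; the pair
  \<open>(a, b)\<close> is the position in the grid of neighbours.\<close>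

definition exchange :: "'a set \<Rightarrow> 'a \<Rightarrow> 'a \<Rightarrow> 'a set" where
  "exchange A a b = insert b (A - {a})"

lemma exchange_eq_iff:
  assumes "a \<in> A" "a' \<in> A" "b \<notin> A" "b' \<notin> A"
  shows "exchange A a b = exchange A a' b' \<longleftrightarrow> a = a' \<and> b = b'"
  using assms by (auto simp: exchange_def)

lemma card_exchange:
  assumes "finite A" "a \<in> A" "b \<notin> A"
  shows "card (exchange A a b) = card A"
proof -
  have "card (exchange A a b) = Suc (card (A - {a}))"
    unfolding exchange_def using assms by (intro card_insert_disjoint) auto
  also have "\<dots> = card A" using assms(1,2) by (rule card.remove[symmetric])
  finally show ?thesis .
qed

lemma image_exchange: "inj h \<Longrightarrow> h ` exchange A a b = exchange (h ` A) (h a) (h b)"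
  by (simp add: exchange_def image_set_diff)

text \<open>Additive on both sides, so that no subtraction of natural numbers occurs; later
  computations of adjacency between exchanged sets reduce to it.\<close>

lemma card_Int_exchange:
  assumes "finite A" "a \<in> A" "b \<notin> A"
  shows "card (exchange A a b \<inter> W) + (if a \<in> W then 1 else 0) = card (A \<inter> W) + (if b \<in> W then 1 else 0)"
proof -
  have "(A - {a}) \<inter> W = A \<inter> W - {a}" by blast
  moreover have "card (A \<inter> W - {a}) + (if a \<in> W then 1 else 0) = card (A \<inter> W)"
    using assms card_gt_0_iff[of "A \<inter> W"] by (auto simp: card_Diff_singleton_if)
  ultimately show ?thesis using assms by (auto simp: exchange_def Int_insert_left)
qed

locale middle_johnson =
  fixes k :: nat
  assumes k2: "2 \<le> k"
begin

abbreviation X :: "nat set" where "X \<equiv> {1..2 * k}"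
abbreviation J :: "nat set pair_pre_digraph" where "J \<equiv> johnson_graph (2 * k) k"
abbreviation V :: "nat set set" where "V \<equiv> pverts J"
abbreviation \<A> :: "(nat set \<Rightarrow> nat set) monoid" where "\<A> \<equiv> aut_group J"
abbreviation ind :: "(nat \<Rightarrow> nat) \<Rightarrow> nat set \<Rightarrow> nat set" where "ind \<equiv> induced_perm (2 * k) k"

lemma V_iff: "A \<in> V \<longleftrightarrow> A \<subseteq> X \<and> card A = k"
  by (simp add: johnson_graph_def Let_def)

lemma arc_iff: "(A, B) \<in> parcs J \<longleftrightarrow> A \<in> V \<and> B \<in> V \<and> card (A \<inter> B) + 1 = k"
  by (simp add: johnson_graph_def Let_def)

lemma wf: "parcs J \<subseteq> V \<times> V"
  using arc_iff by auto

lemma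
  assumes "A \<in> V"
  shows V_subset: "A \<subseteq> X" and V_card: "card A = k" and finite_V: "finite A"
  using assms V_iff finite_subset[of A X] by simp_all

lemma compl_V:
  assumes "A \<in> V"
  shows "X - A \<in> V"
proof -
  have "card (X - A) = card X - card A"
    using finite_V[OF assms] V_subset[OF assms] by (rule card_Diff_subset)
  then show ?thesis using V_card[OF assms] by (simp add: V_iff)
qed

lemma compl_compl: "A \<in> V \<Longrightarrow> X - (X - A) = A"
  using V_subset by blast

lemma image_V: "p permutes X \<Longrightarrow> A \<in> V \<Longrightarrow> p ` A \<in> V"
  using permutes_image_subset permutes_card_image unfolding V_iff by metis

lemma exchange_V:
  assumes "A \<in> V" "a \<in> A" "b \<in> X - A"
  shows "exchange A a b \<in> V"
proof -
  have "card (exchange A a b) = card A" using card_exchange[OF finite_V[OF assms(1)] assms(2)] assms(3) by simp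
  moreover have "A \<subseteq> X" using assms(1) V_iff by simp
  then have "exchange A a b \<subseteq> X" using assms(3) unfolding exchange_def by blast
  ultimately show ?thesis using assms(1) by (simp add: V_iff)
qed

lemma arc_exchange:
  assumes "A \<in> V" "a \<in> A" "b \<in> X - A"
  shows "(A, exchange A a b) \<in> parcs J"
proof -
  have "card (exchange A a b \<inter> A) + 1 = card A"
    using card_Int_exchange[OF finite_V[OF assms(1)] assms(2), of b A] assms(2,3) by simp
  moreover have "card A = k" using assms(1) by (simp add: V_iff)
  ultimately show ?thesis
    unfolding arc_iff Int_commute[of A] using assms(1) exchange_V[OF assms] by blast
qed

lemma arc_obtain_exchange:
  assumes "(A, B) \<in> parcs J"
  obtains a b where "a \<in> A" "b \<in> X - A" "B = exchange A a b"
proof -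
  have AB: "A \<in> V" "B \<in> V" "card (A \<inter> B) + 1 = k" using assms arc_iff by auto
  have "card (A - B) = 1" "card (B - A) = 1"
    using AB finite_V V_card card_Diff_subset_Int[of A B] card_Diff_subset_Int[of B A]
    by (simp_all add: Int_commute)
  then obtain a b where ab: "A - B = {a}" "B - A = {b}" by (auto simp: card_1_singleton_iff)
  then have "a \<in> A" "b \<in> B" "b \<notin> A" "B = exchange A a b" by (auto simp: exchange_def)
  moreover have "B \<subseteq> X" using AB(2) by (rule V_subset)
  ultimately show thesis using that[of a b] by blast
qed

text \<open>This is the rook's graph on the grid of neighbours, and the reason why an automorphism
  preserves collinearity in these grids.\<close>

lemma arc_exchange_exchange_iff:
  assumes A: "A \<in> V" and a: "a \<in> A" "a' \<in> A" and b: "b \<in> X - A" "b' \<in> X - A"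
  shows "(exchange A a b, exchange A a' b') \<in> parcs J \<longleftrightarrow> (a = a') \<noteq> (b = b')"
proof -
  have "card (exchange A a b \<inter> A) + 1 = k"
    using arc_exchange[OF A a(1) b(1)] by (simp add: arc_iff Int_commute)
  moreover have "card (exchange A a b \<inter> exchange A a' b') + (if a' \<in> exchange A a b then 1 else 0)
      = card (exchange A a b \<inter> A) + (if b' \<in> exchange A a b then 1 else 0)"
    using card_Int_exchange[of A a' b' "exchange A a b"] finite_V[OF A] a b by (simp add: Int_commute)
  moreover have "a' \<in> exchange A a b \<longleftrightarrow> a \<noteq> a'" "b' \<in> exchange A a b \<longleftrightarrow> b = b'"
    using a b by (auto simp: exchange_def)
  ultimately have "card (exchange A a b \<inter> exchange A a' b') + 1 = k \<longleftrightarrow> (a = a') \<noteq> (b = b')"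
    by (simp split: if_splits)
  then show ?thesis
    using exchange_V[OF A a(1) b(1)] exchange_V[OF A a(2) b(2)] by (simp add: arc_iff)
qed

section \<open>Permutations and complementation as automorphisms\<close>

lemma ind_apply: "A \<in> V \<Longrightarrow> ind p A = p ` A"
  by (simp add: induced_perm_def)

lemma \<tau>_apply: "A \<in> V \<Longrightarrow> \<tau> k A = X - A"
  by (simp add: complement_map_def)

sublocale aut: group \<A>
  by (rule aut_group_is_group)

lemma ind_carrier:
  assumes p: "p permutes X"
  shows "ind p \<in> carrier \<A>"
proof -
  have p': "inv' p permutes X" using permutes_inv[OF p] .
  have inj: "inj p" using permutes_inj[OF p] .
  have "bij_betw (ind p) V V"
  proof (rule bij_betw_byWitness[where f' = "\<lambda>A. inv' p ` A"])
    show "\<forall>A\<in>V. inv' p ` ind p A = A" using inj by (simp add: ind_apply image_image)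
    show "\<forall>A\<in>V. ind p (inv' p ` A) = A"
      using image_V[OF p'] permutes_surj[OF p] by (simp add: ind_apply image_image surj_f_inv_f)
  qed (use image_V[OF p] image_V[OF p'] in \<open>auto simp: ind_apply\<close>)
  then have "ind p \<in> Bij V" by (simp add: Bij_def induced_perm_def)
  moreover have "(ind p A, ind p B) \<in> parcs J \<longleftrightarrow> (A, B) \<in> parcs J" if "A \<in> V" "B \<in> V" for A B
  proof -
    have "card (p ` A \<inter> p ` B) = card (A \<inter> B)"
      unfolding image_Int[OF inj, symmetric] by (rule permutes_card_image[OF p])
    then show ?thesis using that image_V[OF p] by (simp add: arc_iff ind_apply)
  qed
  ultimately show ?thesis by (simp add: aut_group_carrier)
qed

lemma \<tau>_carrier: "\<tau> k \<in> carrier \<A>"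
proof -
  have "bij_betw (\<tau> k) V V"
  proof (rule bij_betw_byWitness[where f' = "\<lambda>A. X - A"])
    show "\<forall>A\<in>V. X - \<tau> k A = A" "\<forall>A\<in>V. \<tau> k (X - A) = A"
      using compl_V compl_compl by (simp_all add: \<tau>_apply)
  qed (use compl_V in \<open>auto simp: \<tau>_apply\<close>)
  then have "\<tau> k \<in> Bij V" by (simp add: Bij_def complement_map_def)
  moreover have "(\<tau> k A, \<tau> k B) \<in> parcs J \<longleftrightarrow> (A, B) \<in> parcs J" if "A \<in> V" "B \<in> V" for A B
  proof -
    have "card (A \<union> B) + card (A \<inter> B) = 2 * k"
      using card_Un_Int[of A B] that finite_V V_card by simp
    moreover have "(X - A) \<inter> (X - B) = X - (A \<union> B)" by blast
    moreover have "card (X - (A \<union> B)) = 2 * k - card (A \<union> B)"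
      using card_Diff_subset[of "A \<union> B" X] that finite_V V_subset by simp
    ultimately have "card ((X - A) \<inter> (X - B)) = card (A \<inter> B)" by simp
    then show ?thesis using that compl_V by (simp add: arc_iff \<tau>_apply)
  qed
  ultimately show ?thesis by (simp add: aut_group_carrier)
qed

lemma ind_comp:
  assumes "p permutes X" "q permutes X"
  shows "ind (p \<circ> q) = ind p \<otimes>\<^bsub>\<A>\<^esub> ind q"
  using assms image_V[OF assms(2)] ind_carrier permutes_compose[OF assms(2,1)]
  by (intro aut_group_eqI) (auto simp: aut_group_mult_apply ind_apply)

lemma \<tau>_ind_commute:
  assumes "p permutes X"
  shows "\<tau> k \<otimes>\<^bsub>\<A>\<^esub> ind p = ind p \<otimes>\<^bsub>\<A>\<^esub> \<tau> k"
proof (rule aut_group_eqI)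
  fix A assume A: "A \<in> V"
  have "X - p ` A = p ` (X - A)" using permutes_image[OF assms] permutes_inj[OF assms] by (simp add: image_set_diff)
  then show "(\<tau> k \<otimes>\<^bsub>\<A>\<^esub> ind p) A = (ind p \<otimes>\<^bsub>\<A>\<^esub> \<tau> k) A"
    using A assms image_V compl_V by (simp add: aut_group_mult_apply ind_carrier \<tau>_carrier ind_apply \<tau>_apply)
qed (use assms ind_carrier \<tau>_carrier in auto)

lemma \<tau>_\<tau>: "\<tau> k \<otimes>\<^bsub>\<A>\<^esub> \<tau> k = \<one>\<^bsub>\<A>\<^esub>"
proof (rule aut_group_eqI)
  fix A assume A: "A \<in> V"
  have "X - (X - A) = A" using A by (rule compl_compl)
  then show "(\<tau> k \<otimes>\<^bsub>\<A>\<^esub> \<tau> k) A = \<one>\<^bsub>\<A>\<^esub> A"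
    using A compl_V by (simp add: aut_group_mult_apply \<tau>_carrier \<tau>_apply aut_group_one_apply)
qed (use \<tau>_carrier in auto)

lemma ind_id: "ind id = \<one>\<^bsub>\<A>\<^esub>"
  using ind_carrier[OF permutes_id] by (intro aut_group_eqI) (auto simp: ind_apply aut_group_one_apply)

lemma generate_\<tau>: "generate \<A> {\<tau> k} = {\<one>\<^bsub>\<A>\<^esub>, \<tau> k}"
proof
  show "generate \<A> {\<tau> k} \<subseteq> {\<one>\<^bsub>\<A>\<^esub>, \<tau> k}"
  proof
    fix f assume "f \<in> generate \<A> {\<tau> k}"
    then show "f \<in> {\<one>\<^bsub>\<A>\<^esub>, \<tau> k}"
    proof (induction rule: generate.induct)
      case (inv h)
      then show ?case using aut.inv_equality[OF \<tau>_\<tau> \<tau>_carrier \<tau>_carrier] by simp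
    qed (use \<tau>_carrier \<tau>_\<tau> in auto)
  qed
qed (auto intro: generate.intros)

lemma obtain_V_containing_avoiding:
  assumes "x \<in> X" "y \<in> X" "x \<noteq> y"
  obtains A where "A \<in> V" "x \<in> A" "y \<notin> A"
proof -
  have "k \<le> card (X - {y})" "{x} \<subseteq> X - {y}" using assms k2 by auto
  then obtain A where "{x} \<subseteq> A" "A \<subseteq> X - {y}" "card A = k"
    using exists_subset_between[of "{x}" k "X - {y}"] k2 by auto
  then have "A \<in> V" "x \<in> A" "y \<notin> A" unfolding V_iff by blast+
  then show thesis by (rule that)
qed

lemma obtain_V_containing:
  assumes "x \<in> X" "y \<in> X"
  obtains A where "A \<in> V" "x \<in> A" "y \<in> A"
proof -
  have "card {x, y} \<le> k" using k2 card_insert_le_m1[of k "{y}" x] by simp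
  then obtain A where "{x, y} \<subseteq> A" "A \<subseteq> X" "card A = k"
    using exists_subset_between[of "{x, y}" k X] assms by auto
  then have "A \<in> V" "x \<in> A" "y \<in> A" unfolding V_iff by blast+
  then show thesis by (rule that)
qed

lemma ind_inj:
  assumes p: "p permutes X" and q: "q permutes X" and eq: "ind p = ind q"
  shows "p = q"
proof
  fix x
  show "p x = q x"
  proof (cases "x \<in> X")
    case True
    show ?thesis
    proof (rule ccontr)
      define y where "y = inv' q (p x)"
      have y: "q y = p x" using permutes_surj[OF q] by (simp add: y_def surj_f_inv_f)
      assume "p x \<noteq> q x"
      then have "x \<noteq> y" using y by auto
      moreover have "y \<in> X" using permutes_in_image[OF q, of y] permutes_in_image[OF p, of x] y True by metis
      ultimately obtain A where A: "A \<in> V" "x \<in> A" "y \<notin> A"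
        using obtain_V_containing_avoiding True by metis
      have "p x \<in> q ` A" using eq A by (metis imageI ind_apply)
      then show False using A(3) y permutes_inj[OF q] by (metis imageE injD)
    qed
  next
    case False
    then show ?thesis using p q by (simp add: permutes_not_in)
  qed
qed

text \<open>A vertex through 1 and the preimage of \<open>p 1\<close> under \<open>q\<close> has
  \<open>p 1\<close> in its image under \<open>p\<close>, but not in the image of its complement
  under \<open>q\<close>. Two prescribed points in one vertex need \<open>k \<ge> 2\<close>; for
  \<open>k = 1\<close> complementation is itself a transposition.\<close>

lemma ind_neq_ind_\<tau>:
  assumes p: "p permutes X" and q: "q permutes X"
  shows "ind p \<noteq> ind q \<otimes>\<^bsub>\<A>\<^esub> \<tau> k"
proof
  assume eq: "ind p = ind q \<otimes>\<^bsub>\<A>\<^esub> \<tau> k"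
  have im: "p ` A = q ` (X - A)" if "A \<in> V" for A
  proof -
    have "p ` A = (ind q \<otimes>\<^bsub>\<A>\<^esub> \<tau> k) A" using ind_apply[OF that, of p] eq by simp
    then show ?thesis
      using that q compl_V by (simp add: aut_group_mult_apply ind_carrier \<tau>_carrier ind_apply \<tau>_apply)
  qed
  have x: "1 \<in> X" using k2 by simp
  define y where "y = inv' q (p 1)"
  have y: "q y = p 1" using permutes_surj[OF q] by (simp add: y_def surj_f_inv_f)
  have "y \<in> X" using permutes_in_image[OF q, of y] permutes_in_image[OF p, of 1] y x by metis
  then obtain A where A: "A \<in> V" "1 \<in> A" "y \<in> A" using obtain_V_containing x by metis
  have "p 1 \<in> q ` (X - A)" using im[OF A(1)] A(2) by blast
  then show False using A(3) y permutes_inj[OF q] by (metis DiffD2 imageE injD)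
qed

text \<open>Induction on the distance \<open>card (A - C)\<close>. At distance at least 2,
  \<open>C\<close> is a common neighbour of two vertices \<open>U\<close> and \<open>W\<close>
  nearer to \<open>A\<close>, which are fixed already. These have four common neighbours, and the
  other three are nearer to \<open>A\<close>, hence fixed; injectivity leaves only \<open>C\<close>
  as the image of \<open>C\<close>.\<close>

lemma aut_determined_by_neighbourhood:
  assumes h: "h \<in> carrier \<A>" and A: "A \<in> V" and fixA: "h A = A"
    and fixN: "\<And>a b. a \<in> A \<Longrightarrow> b \<in> X - A \<Longrightarrow> h (exchange A a b) = exchange A a b"
    and C: "C \<in> V"
  shows "h C = C"
  using C
proof (induction "card (A - C)" arbitrary: C rule: less_induct)
  case less
  note C = less.prems
  have fin: "finite A" "finite C" using finite_V[OF A] finite_V[OF C] .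
  have cards: "card (C - A) = card (A - C)"
  proof -
    have "card (C - A) = card C - card (C \<inter> A)" using fin by (intro card_Diff_subset_Int) simp
    moreover have "card (A - C) = card A - card (A \<inter> C)" using fin by (intro card_Diff_subset_Int) simp
    ultimately show ?thesis by (simp only: Int_commute[of C] V_card[OF A] V_card[OF C])
  qed
  consider "card (A - C) = 0" | "card (A - C) = 1" | "card (A - C) \<ge> 2" by linarith
  then show ?case
  proof cases
    case 1
    then have "A \<subseteq> C" using fin by simp
    then have "A = C" using card_subset_eq[OF fin(2)] V_card A C by simp
    then show ?thesis using fixA by simp
  next
    case 2
    then obtain a b where ab: "A - C = {a}" "C - A = {b}" using cards by (auto simp: card_1_singleton_iff)
    then have "a \<in> A" "b \<in> C" "b \<notin> A" "C = exchange A a b" by (auto simp: exchange_def)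
    moreover have "b \<in> X" using \<open>b \<in> C\<close> V_subset[OF C] by blast
    ultimately show ?thesis using fixN[of a b] by simp
  next
    case 3
    obtain s s' where s: "s \<in> A - C" "s' \<in> A - C" "s \<noteq> s'"
      using two_distinct_elements[OF 3] by blast
    obtain t t' where t: "t \<in> C - A" "t' \<in> C - A" "t \<noteq> t'"
      using two_distinct_elements[of "C - A"] 3 cards by auto
    have sX: "s \<in> X" "s' \<in> X" using s V_subset[OF A] by blast+
    have closer: "h D = D" if "D \<in> V" "A - D \<subset> A - C" for D
      using less.hyps[OF psubset_card_mono[OF _ that(2)] that(1)] fin by simp
    have arith: "exchange C u r \<in> V \<and> h (exchange C u r) = exchange C u r"
      if "r \<in> {s, s'}" "u \<in> {t, t'}" for r u
    proof -
      have "exchange C u r \<in> V" using that s t sX exchange_V[OF C] by auto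
      moreover have "A - exchange C u r \<subset> A - C" using that s t by (auto simp: exchange_def)
      ultimately show ?thesis using closer by blast
    qed
    define U where "U = exchange C t s"
    define W where "W = exchange C t' s'"
    have UW: "U \<in> V" "W \<in> V" "h U = U" "h W = W" using arith by (auto simp: U_def W_def)
    have finU: "finite U" using UW(1) finite_V by blast
    have hC: "h C \<in> V" using aut_group_closed[OF h C] .
    have "(U, h C) \<in> parcs J" "(W, h C) \<in> parcs J"
      using aut_group_arc[OF h UW(1) C] aut_group_arc[OF h UW(2) C] UW
        arc_exchange[OF C, of t s] arc_exchange[OF C, of t' s'] s t sX
      by (auto simp: arc_iff Int_commute U_def W_def)
    then obtain x y where xy: "x \<in> U" "y \<in> X - U" "h C = exchange U x y"
      using arc_obtain_exchange by metis
    have "card (U \<inter> W) + 2 = k"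
    proof -
      have "card (C \<inter> W) + 1 = k"
        using arc_exchange[OF C, of t' s'] s t sX by (simp add: arc_iff W_def)
      then show ?thesis
        using card_Int_exchange[of C t s W] fin s t by (simp add: U_def W_def exchange_def)
    qed
    moreover have "card (exchange U x y \<inter> W) + 1 = k"
      using \<open>(W, h C) \<in> parcs J\<close> xy(3) by (simp add: arc_iff Int_commute)
    \<comment> \<open>The image of \<open>C\<close> meets \<open>W\<close> in one point more than
      \<open>U\<close> does, so the exchange leading to it removes a point outside \<open>W\<close>
      and adds one of \<open>W\<close>.\<close>
    ultimately have "x \<notin> W" "y \<in> W"
      using card_Int_exchange[of U x y W] finU xy(1,2) by (auto split: if_splits)
    then have "x = s \<or> x = t'" "y = s' \<or> y = t"
      using xy(1,2) s t by (auto simp: U_def W_def exchange_def)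
    moreover have "exchange U s t = C" using s t by (auto simp: U_def exchange_def)
    moreover have "exchange U t' t = exchange C t' s" using s t by (auto simp: U_def exchange_def)
    moreover have "exchange U s s' = exchange C t s'" using s t by (auto simp: U_def exchange_def)
    ultimately consider "h C = C" | "h C = exchange C t' s" | "h C = exchange C t s'"
      | "h C = exchange (exchange C t s) t' s'"
      using xy(3) U_def by metis
    then show ?thesis
    proof cases
      case 4
      have "exchange (exchange C t s) t' s' \<in> V"
        using exchange_V[of "exchange C t s" t' s'] UW(1) s t sX by (auto simp: U_def exchange_def)
      moreover have "A - exchange (exchange C t s) t' s' \<subset> A - C" using s t by (auto simp: exchange_def)
      ultimately have "h (h C) = h C" using closer 4 by simp
      then show ?thesis using aut_group_inj[OF h] C hC by (metis inj_onD)
    next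
      case 2
      then have "h (h C) = h C" using arith[of s t'] by simp
      then show ?thesis using aut_group_inj[OF h] C hC by (metis inj_onD)
    next
      case 3
      then have "h (h C) = h C" using arith[of s' t] by simp
      then show ?thesis using aut_group_inj[OF h] C hC by (metis inj_onD)
    qed
  qed
qed

lemma aut_eqI_neighbourhood:
  assumes f: "f \<in> carrier \<A>" and g: "g \<in> carrier \<A>" and A: "A \<in> V" "f A = g A"
    and N: "\<And>a b. a \<in> A \<Longrightarrow> b \<in> X - A \<Longrightarrow> f (exchange A a b) = g (exchange A a b)"
  shows "f = g"
proof -
  let ?h = "inv\<^bsub>\<A>\<^esub> g \<otimes>\<^bsub>\<A>\<^esub> f"
  have h: "?h \<in> carrier \<A>" using f g by simp
  have eq: "?h C = C" if "C \<in> V" "f C = g C" for C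
    using that f g by (simp add: aut_group_mult_apply aut_group_inv_apply)
  have "?h C = C" if "C \<in> V" for C
    using aut_determined_by_neighbourhood[OF h A(1) eq[OF A] _ that] eq exchange_V[OF A(1)] N by blast
  then have "?h = \<one>\<^bsub>\<A>\<^esub>" using h by (intro aut_group_eqI) (auto simp: aut_group_one_apply)
  then show ?thesis using f g by (metis aut.inv_closed aut.inv_equality aut.inv_inv)
qed

lemma permutes_if_bij_parts:
  assumes "A \<subseteq> X" "bij_betw \<sigma> A B" "bij_betw \<rho> (X - A) (X - B)" "B \<subseteq> X"
  shows "(\<lambda>x. if x \<in> A then \<sigma> x else if x \<in> X then \<rho> x else x) permutes X"
proof (rule bij_imp_permutes)
  let ?p = "\<lambda>x. if x \<in> A then \<sigma> x else if x \<in> X then \<rho> x else x"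
  have "bij_betw ?p A B" using assms(2) by (rule bij_betw_cong[THEN iffD1, rotated]) simp
  moreover have "bij_betw ?p (X - A) (X - B)" using assms(3) by (rule bij_betw_cong[THEN iffD1, rotated]) simp
  ultimately have "bij_betw ?p (A \<union> (X - A)) (B \<union> (X - B))" by (rule bij_betw_combine) blast
  moreover have "A \<union> (X - A) = X" "B \<union> (X - B) = X" using assms(1,4) by auto
  ultimately show "bij_betw ?p X X" by simp
qed (use assms(1) in auto)

text \<open>If \<open>f\<close> keeps the two coordinate directions of the grids at \<open>A\<close>
  and \<open>B = f A\<close>, the coordinate maps glue to a permutation taking \<open>A\<close> to
  \<open>B\<close>. If it swaps them, the glued permutation takes \<open>A\<close> to
  \<open>X - B\<close>, and complementing first repairs this.\<close>

lemma aut_cases: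
  assumes f: "f \<in> carrier \<A>"
  shows "\<exists>p. p permutes X \<and> (f = ind p \<or> f = ind p \<otimes>\<^bsub>\<A>\<^esub> \<tau> k)"
proof -
  obtain A where A: "A \<in> V" using obtain_V_containing[of 1 1] k2 by auto
  let ?N = "X - A"
  define B where "B = f A"
  have B: "B \<in> V" using aut_group_closed[OF f A] by (simp add: B_def)
  have N: "?N \<in> V" using compl_V[OF A] .
  have M: "X - B \<in> V" using compl_V[OF B] .
  have card2: "\<exists>c\<in>C. \<exists>c'\<in>C. c \<noteq> c'" if C: "C \<in> V" for C
    using two_distinct_elements[of C] V_card[OF C] k2 by simp
  define \<phi> where "\<phi> r = (SOME q. q \<in> B \<times> (X - B) \<and>
    f (exchange A (fst r) (snd r)) = exchange B (fst q) (snd q))" for r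
  have \<phi>: "\<phi> (a, b) \<in> B \<times> (X - B)"
      "f (exchange A a b) = exchange B (fst (\<phi> (a, b))) (snd (\<phi> (a, b)))"
    if "a \<in> A" "b \<in> ?N" for a b
  proof -
    have "(B, f (exchange A a b)) \<in> parcs J"
      unfolding B_def using aut_group_arc[OF f A exchange_V[OF A that]] arc_exchange[OF A that] by simp
    then obtain a' b' where "a' \<in> B" "b' \<in> X - B" "f (exchange A a b) = exchange B a' b'"
      by (rule arc_obtain_exchange)
    then have "(a', b') \<in> B \<times> (X - B) \<and>
        f (exchange A (fst (a, b)) (snd (a, b))) = exchange B (fst (a', b')) (snd (a', b'))" by simp
    then have "\<phi> (a, b) \<in> B \<times> (X - B) \<and>
        f (exchange A (fst (a, b)) (snd (a, b))) = exchange B (fst (\<phi> (a, b))) (snd (\<phi> (a, b)))"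
      unfolding \<phi>_def by (rule someI)
    then show "\<phi> (a, b) \<in> B \<times> (X - B)"
      "f (exchange A a b) = exchange B (fst (\<phi> (a, b))) (snd (\<phi> (a, b)))" by auto
  qed
  have inj: "inj_on \<phi> (A \<times> ?N)"
  proof (rule inj_onI)
    fix r r' assume r: "r \<in> A \<times> ?N" "r' \<in> A \<times> ?N" "\<phi> r = \<phi> r'"
    obtain a b a' b' where ab: "r = (a, b)" "r' = (a', b')" by fastforce
    then have m: "a \<in> A" "b \<in> ?N" "a' \<in> A" "b' \<in> ?N" using r by auto
    have "f (exchange A a b) = f (exchange A a' b')" using \<phi>(2)[OF m(1,2)] \<phi>(2)[OF m(3,4)] r(3) ab by simp
    then have "exchange A a b = exchange A a' b'"
      using aut_group_inj[OF f] exchange_V[OF A m(1,2)] exchange_V[OF A m(3,4)] by (auto dest: inj_onD)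
    then show "r = r'" using exchange_eq_iff[of a A a' b b'] m ab by auto
  qed
  have coll: "(fst (\<phi> (a, b)) = fst (\<phi> (a', b'))) \<noteq> (snd (\<phi> (a, b)) = snd (\<phi> (a', b'))) \<longleftrightarrow> (a = a') \<noteq> (b = b')"
    if m: "a \<in> A" "b \<in> ?N" "a' \<in> A" "b' \<in> ?N" for a b a' b'
  proof -
    have "(a = a') \<noteq> (b = b') \<longleftrightarrow> (f (exchange A a b), f (exchange A a' b')) \<in> parcs J"
      using arc_exchange_exchange_iff[OF A m(1,3,2,4)] aut_group_arc[OF f exchange_V[OF A m(1,2)] exchange_V[OF A m(3,4)]]
      by simp
    also have "\<dots> \<longleftrightarrow> (fst (\<phi> (a, b)) = fst (\<phi> (a', b'))) \<noteq> (snd (\<phi> (a, b)) = snd (\<phi> (a', b')))"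
      unfolding \<phi>(2)[OF m(1,2)] \<phi>(2)[OF m(3,4)]
      using \<phi>(1)[OF m(1,2)] \<phi>(1)[OF m(3,4)] by (intro arc_exchange_exchange_iff[OF B]) auto
    finally show ?thesis by simp
  qed
  have bijI: "bij_betw \<sigma> C D" if "\<sigma> ` C \<subseteq> D" "inj_on \<sigma> C" "C \<in> V" "D \<in> V" for \<sigma> :: "nat \<Rightarrow> nat" and C D
    using that(1,2) card_image[OF that(2)] V_card[OF that(3)] V_card[OF that(4)]
      card_subset_eq[OF finite_V[OF that(4)] that(1)] by (simp add: bij_betw_def)
  obtain a0 b0 where 0: "a0 \<in> A" "b0 \<in> ?N" using card2[OF A] card2[OF N] by blast
  have "(\<exists>\<sigma> \<rho>. \<forall>a\<in>A. \<forall>b\<in>?N. \<phi> (a, b) = (\<sigma> a, \<rho> b)) \<or> (\<exists>\<sigma> \<rho>. \<forall>a\<in>A. \<forall>b\<in>?N. \<phi> (a, b) = (\<rho> b, \<sigma> a))"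
    by (rule grid_isomorphism[OF card2[OF A] card2[OF N] inj coll])
  then consider (straight) \<sigma> \<rho> where "\<forall>a\<in>A. \<forall>b\<in>?N. \<phi> (a, b) = (\<sigma> a, \<rho> b)"
    | (crossed) \<sigma> \<rho> where "\<forall>a\<in>A. \<forall>b\<in>?N. \<phi> (a, b) = (\<rho> b, \<sigma> a)" by blast
  then show ?thesis
  proof cases
    case straight
    have "inj_on \<sigma> A"
      using straight 0 by (intro inj_onI) (metis Pair_inject inj inj_onD mem_Sigma_iff)
    then have \<sigma>: "bij_betw \<sigma> A B"
      using \<phi>(1) straight 0 A B by (intro bijI) auto
    have "inj_on \<rho> ?N"
      using straight 0 by (intro inj_onI) (metis Pair_inject inj inj_onD mem_Sigma_iff)
    then have \<rho>: "bij_betw \<rho> ?N (X - B)"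
      using \<phi>(1) straight 0 N M by (intro bijI) auto
    define p where "p x = (if x \<in> A then \<sigma> x else if x \<in> X then \<rho> x else x)" for x
    have p: "p permutes X"
      unfolding p_def using V_subset[OF A] \<sigma> \<rho> V_subset[OF B] by (rule permutes_if_bij_parts)
    have pA: "p ` A = B" using \<sigma> by (auto simp: p_def bij_betw_def)
    have "f = ind p"
    proof (rule aut_eqI_neighbourhood[OF f ind_carrier[OF p] A])
      show "f A = ind p A" using A pA by (simp add: ind_apply B_def)
      fix a b assume ab: "a \<in> A" "b \<in> ?N"
      have "f (exchange A a b) = exchange B (p a) (p b)" using \<phi>(2)[OF ab] straight ab by (auto simp: p_def)
      then show "f (exchange A a b) = ind p (exchange A a b)"
        using image_exchange[OF permutes_inj[OF p], of A a b] pA exchange_V[OF A ab] by (simp add: ind_apply)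
    qed
    then show ?thesis using p by blast
  next
    case crossed
    have "inj_on \<sigma> A"
      using crossed 0 by (intro inj_onI) (metis Pair_inject inj inj_onD mem_Sigma_iff)
    then have \<sigma>: "bij_betw \<sigma> A (X - B)"
      using \<phi>(1) crossed 0 A M by (intro bijI) auto
    have "inj_on \<rho> ?N"
      using crossed 0 by (intro inj_onI) (metis Pair_inject inj inj_onD mem_Sigma_iff)
    then have \<rho>: "bij_betw \<rho> ?N B"
      using \<phi>(1) crossed 0 N B by (intro bijI) auto
    define p where "p x = (if x \<in> A then \<sigma> x else if x \<in> X then \<rho> x else x)" for x
    have p: "p permutes X"
      unfolding p_def using V_subset[OF A] \<sigma> \<rho> compl_compl[OF B]
      by (intro permutes_if_bij_parts[of A \<sigma> "X - B" \<rho>]) auto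
    have pN: "p ` ?N = B" using \<rho> by (auto simp: p_def bij_betw_def)
    have pt: "(ind p \<otimes>\<^bsub>\<A>\<^esub> \<tau> k) C = p ` (X - C)" if "C \<in> V" for C
      using that compl_V[OF that] p by (simp add: aut_group_mult_apply ind_carrier \<tau>_carrier ind_apply \<tau>_apply)
    have "f = ind p \<otimes>\<^bsub>\<A>\<^esub> \<tau> k"
    proof (rule aut_eqI_neighbourhood[OF f _ A])
      show "ind p \<otimes>\<^bsub>\<A>\<^esub> \<tau> k \<in> carrier \<A>" using ind_carrier[OF p] \<tau>_carrier by simp
      show "f A = (ind p \<otimes>\<^bsub>\<A>\<^esub> \<tau> k) A" using pt[OF A] pN by (simp add: B_def)
      fix a b assume ab: "a \<in> A" "b \<in> ?N"
      \<comment> \<open>Complementation interchanges the two coordinates of a neighbour.\<close>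
      have "X - exchange A a b = exchange ?N b a" using ab V_subset[OF A] by (auto simp: exchange_def)
      moreover have "f (exchange A a b) = exchange B (p b) (p a)" using \<phi>(2)[OF ab] crossed ab by (auto simp: p_def)
      ultimately show "f (exchange A a b) = (ind p \<otimes>\<^bsub>\<A>\<^esub> \<tau> k) (exchange A a b)"
        using image_exchange[OF permutes_inj[OF p], of ?N b a] pN pt[OF exchange_V[OF A ab]] by simp
    qed
    then show ?thesis using p by blast
  qed
qed

lemma aut_iso:
  "(\<lambda>(p, t). ind p \<otimes>\<^bsub>\<A>\<^esub> t) \<in> iso (sym_group (2 * k) \<times>\<times> \<A>\<lparr>carrier := generate \<A> {\<tau> k}\<rparr>) \<A>"
proof (rule isoI)
  let ?D = "sym_group (2 * k) \<times>\<times> \<A>\<lparr>carrier := generate \<A> {\<tau> k}\<rparr>"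
  have D: "carrier ?D = {p. p permutes X} \<times> {\<one>\<^bsub>\<A>\<^esub>, \<tau> k}"
    by (simp add: generate_\<tau> sym_group_def)
  have tc: "t \<in> carrier \<A>" if "t \<in> {\<one>\<^bsub>\<A>\<^esub>, \<tau> k}" for t using that \<tau>_carrier by auto
  have comm: "t \<otimes>\<^bsub>\<A>\<^esub> ind p = ind p \<otimes>\<^bsub>\<A>\<^esub> t" if "t \<in> {\<one>\<^bsub>\<A>\<^esub>, \<tau> k}" "p permutes X" for t p
    using that \<tau>_ind_commute ind_carrier by auto
  show "(\<lambda>(p, t). ind p \<otimes>\<^bsub>\<A>\<^esub> t) \<in> hom ?D \<A>"
  proof (rule homI)
    fix r s assume rs: "r \<in> carrier ?D" "s \<in> carrier ?D"
    then obtain p t q u where r: "r = (p, t)" "s = (q, u)" "p permutes X" "q permutes X"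
        "t \<in> {\<one>\<^bsub>\<A>\<^esub>, \<tau> k}" "u \<in> {\<one>\<^bsub>\<A>\<^esub>, \<tau> k}" unfolding D by blast
    note c = ind_carrier[OF r(3)] ind_carrier[OF r(4)] tc[OF r(5)] tc[OF r(6)]
    have "ind (p \<circ> q) \<otimes>\<^bsub>\<A>\<^esub> (t \<otimes>\<^bsub>\<A>\<^esub> u) = ind p \<otimes>\<^bsub>\<A>\<^esub> (ind q \<otimes>\<^bsub>\<A>\<^esub> t) \<otimes>\<^bsub>\<A>\<^esub> u"
      using c by (simp add: ind_comp[OF r(3,4)] aut.m_assoc)
    also have "\<dots> = (ind p \<otimes>\<^bsub>\<A>\<^esub> t) \<otimes>\<^bsub>\<A>\<^esub> (ind q \<otimes>\<^bsub>\<A>\<^esub> u)"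
      using c by (simp add: comm[OF r(5,4), symmetric] aut.m_assoc)
    finally show "(\<lambda>(p, t). ind p \<otimes>\<^bsub>\<A>\<^esub> t) (r \<otimes>\<^bsub>?D\<^esub> s)
        = (\<lambda>(p, t). ind p \<otimes>\<^bsub>\<A>\<^esub> t) r \<otimes>\<^bsub>\<A>\<^esub> (\<lambda>(p, t). ind p \<otimes>\<^bsub>\<A>\<^esub> t) s"
      by (simp add: r(1,2) sym_group_mult)
  next
    fix r assume "r \<in> carrier ?D"
    then show "(\<lambda>(p, t). ind p \<otimes>\<^bsub>\<A>\<^esub> t) r \<in> carrier \<A>"
      unfolding D using ind_carrier \<tau>_carrier by auto
  qed
  show "bij_betw (\<lambda>(p, t). ind p \<otimes>\<^bsub>\<A>\<^esub> t) (carrier ?D) (carrier \<A>)"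
    unfolding bij_betw_def
  proof
    show "inj_on (\<lambda>(p, t). ind p \<otimes>\<^bsub>\<A>\<^esub> t) (carrier ?D)"
    proof (rule inj_onI)
      fix r s assume rs: "r \<in> carrier ?D" "s \<in> carrier ?D"
        "(\<lambda>(p, t). ind p \<otimes>\<^bsub>\<A>\<^esub> t) r = (\<lambda>(p, t). ind p \<otimes>\<^bsub>\<A>\<^esub> t) s"
      then obtain p t q u where r: "r = (p, t)" "s = (q, u)" "p permutes X" "q permutes X"
        "t \<in> {\<one>\<^bsub>\<A>\<^esub>, \<tau> k}" "u \<in> {\<one>\<^bsub>\<A>\<^esub>, \<tau> k}" unfolding D by blast
      have eq: "ind p \<otimes>\<^bsub>\<A>\<^esub> t = ind q \<otimes>\<^bsub>\<A>\<^esub> u" using rs(3) r(1,2) by simp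
      note c = ind_carrier[OF r(3)] ind_carrier[OF r(4)] tc[OF r(5)] tc[OF r(6)]
      have "t = u"
        using eq r(5,6) c(1,2) ind_neq_ind_\<tau>[OF r(3,4)] ind_neq_ind_\<tau>[OF r(4,3)] by auto
      then show "r = s" using eq c ind_inj[OF r(3,4)] r(1,2) by simp
    qed
    show "(\<lambda>(p, t). ind p \<otimes>\<^bsub>\<A>\<^esub> t) ` carrier ?D = carrier \<A>"
    proof
      show "(\<lambda>(p, t). ind p \<otimes>\<^bsub>\<A>\<^esub> t) ` carrier ?D \<subseteq> carrier \<A>"
        unfolding D using ind_carrier \<tau>_carrier by auto
      show "carrier \<A> \<subseteq> (\<lambda>(p, t). ind p \<otimes>\<^bsub>\<A>\<^esub> t) ` carrier ?D"
      proof
        fix f assume f: "f \<in> carrier \<A>"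
        then obtain p where p: "p permutes X" "f = ind p \<or> f = ind p \<otimes>\<^bsub>\<A>\<^esub> \<tau> k" using aut_cases by blast
        then have "f = ind p \<otimes>\<^bsub>\<A>\<^esub> \<one>\<^bsub>\<A>\<^esub> \<or> f = ind p \<otimes>\<^bsub>\<A>\<^esub> \<tau> k" using ind_carrier[OF p(1)] by simp
        then obtain t where "t \<in> {\<one>\<^bsub>\<A>\<^esub>, \<tau> k}" "f = ind p \<otimes>\<^bsub>\<A>\<^esub> t" by blast
        then show "f \<in> (\<lambda>(p, t). ind p \<otimes>\<^bsub>\<A>\<^esub> t) ` carrier ?D"
          unfolding D using p(1) by (intro image_eqI[of _ _ "(p, t)"]) auto
      qed
    qed
  qed
qed

end

section \<open>Arc-transitive groups of automorphisms\<close>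

lemma image_inv_eq_iff: "bij h \<Longrightarrow> inv' h ` B = A \<longleftrightarrow> h ` A = B"
  by (metis bij_is_inj bij_is_surj image_f_inv_f image_inv_f_f)

lemma image_comp_eq: "(f \<circ> g) ` A = f ` g ` A"
  by (simp add: image_comp)

section \<open>Arc-transitivity of the symmetric and the alternating group\<close>

context middle_johnson
begin

lemma permutes_image_compl: "p permutes X \<Longrightarrow> A \<subseteq> X \<Longrightarrow> p ` (X - A) = X - p ` A"
  using permutes_image permutes_inj by (metis image_set_diff)

text \<open>An arc from \<open>A\<close> amounts to a point of \<open>A\<close> and a point outside,
  so bijections of the two halves with one prescribed value each are enough.\<close>

lemma sym_arc_transitive:
  assumes "(A, B) \<in> parcs J" "(A', B') \<in> parcs J"
  obtains q where "q permutes X" "q ` A = A'" "q ` B = B'"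
proof -
  have A: "A \<in> V" and A': "A' \<in> V" using assms arc_iff by auto
  obtain a b where ab: "a \<in> A" "b \<in> X - A" "B = exchange A a b" using arc_obtain_exchange[OF assms(1)] .
  obtain a' b' where ab': "a' \<in> A'" "b' \<in> X - A'" "B' = exchange A' a' b'" using arc_obtain_exchange[OF assms(2)] .
  have pointed: "\<exists>\<sigma>. bij_betw \<sigma> C D \<and> \<sigma> c = d" if CD: "C \<in> V" "D \<in> V" "c \<in> C" "d \<in> D" for C D c d
  proof -
    obtain \<sigma> where \<sigma>: "bij_betw \<sigma> C D"
      using finite_same_card_bij[OF finite_V[OF CD(1)] finite_V[OF CD(2)]
          trans[OF V_card[OF CD(1)] V_card[OF CD(2), symmetric]]] by blast
    then have "\<sigma> c \<in> D" using CD(3) by (rule bij_betwE[rule_format])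
    from permutes_imp_bij[OF permutes_swap_id[OF this CD(4)]]
    have "bij_betw (transpose (\<sigma> c) d \<circ> \<sigma>) C D" by (rule bij_betw_trans[OF \<sigma>])
    then show ?thesis by (intro exI[of _ "transpose (\<sigma> c) d \<circ> \<sigma>"]) simp
  qed
  obtain \<sigma> where \<sigma>: "bij_betw \<sigma> A A'" "\<sigma> a = a'" using pointed[OF A A' ab(1) ab'(1)] by blast
  obtain \<rho> where \<rho>: "bij_betw \<rho> (X - A) (X - A')" "\<rho> b = b'"
    using pointed[OF compl_V[OF A] compl_V[OF A'] ab(2) ab'(2)] by blast
  define q where "q x = (if x \<in> A then \<sigma> x else if x \<in> X then \<rho> x else x)" for x
  have q: "q permutes X" unfolding q_def
    by (rule permutes_if_bij_parts[OF V_subset[OF A] \<sigma>(1) \<rho>(1) V_subset[OF A']])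
  have qA: "q ` A = A'" using \<sigma>(1) by (auto simp: q_def bij_betw_def)
  have "q a = a'" "q b = b'" using ab(1,2) \<sigma>(2) \<rho>(2) by (auto simp: q_def)
  then have "q ` B = B'" using image_exchange[OF permutes_inj[OF q]] qA ab(3) ab'(3) by simp
  then show thesis using that q qA by blast
qed

text \<open>An odd solution is composed with a transposition of two points of
  \<open>A \<inter> B\<close>, which fixes both ends of the arc. That set has \<open>k - 1\<close>
  points, whence \<open>3 \<le> k\<close>.\<close>

lemma alt_arc_transitive:
  assumes k: "3 \<le> k" and arcs: "(A, B) \<in> parcs J" "(A', B') \<in> parcs J"
  obtains q where "q \<in> carrier (alt_group (2 * k))" "q ` A = A'" "q ` B = B'"
proof -
  obtain q where q: "q permutes X" "q ` A = A'" "q ` B = B'" using sym_arc_transitive[OF arcs] .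
  show thesis
  proof (cases "evenperm q")
    case True
    then show thesis using that[of q] q by (simp add: alt_group_carrier)
  next
    case False
    have "2 \<le> card (A \<inter> B)" using arcs(1) k by (simp add: arc_iff)
    then obtain x y where xy: "x \<in> A" "x \<in> B" "y \<in> A" "y \<in> B" "x \<noteq> y"
      using two_distinct_elements by blast
    let ?t = "transpose x y"
    have A: "A \<in> V" using arcs(1) arc_iff by blast
    have t: "?t permutes X" using xy V_subset[OF A] by (intro permutes_swap_id) auto
    have "permutation q" "permutation ?t" using q(1) t permutes_imp_permutation by blast+
    then have "evenperm (q \<circ> ?t)" using False xy(5) by (simp add: evenperm_comp evenperm_swap)
    moreover have "?t ` A = A" "?t ` B = B" using xy by (simp_all add: transpose_image_eq)
    ultimately show thesis
      using that[of "q \<circ> ?t"] permutes_compose[OF t q(1)] q(2,3) by (simp add: alt_group_carrier image_comp_eq del: o_apply)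
  qed
qed

end

section \<open>The point permutations in an arc-transitive group\<close>

locale middle_johnson_arc_transitive = middle_johnson +
  fixes G :: "(nat set \<Rightarrow> nat set) set"
  assumes G: "subgroup G \<A>" and transG: "arc_transitive J G"
begin

definition H :: "(nat \<Rightarrow> nat) set" where
  "H = {p. p permutes X \<and> ind p \<in> G}"

text \<open>The permutation parts of the elements of \<open>G\<close> written with a factor \<tau>.
  As \<tau> is a central involution, \<open>K\<close> is empty or a coset of \<open>H\<close>; it
  coincides with \<open>H\<close> when \<open>\<tau> k\<close> itself is in
  \<open>G\<close>.\<close>

definition K :: "(nat \<Rightarrow> nat) set" where
  "K = {p. p permutes X \<and> ind p \<otimes>\<^bsub>\<A>\<^esub> \<tau> k \<in> G}"

lemma permutes_H: "h \<in> H \<Longrightarrow> h permutes X" and permutes_K: "m \<in> K \<Longrightarrow> m permutes X"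
  by (simp_all add: H_def K_def)

lemma subgroup_H: "subgroup H (sym_group (2 * k))"
proof -
  interpret S: group "sym_group (2 * k)" by (rule sym_group_is_group)
  interpret G: subgroup G \<A> by (rule G)
  show ?thesis
  proof (rule S.subgroupI)
    show "H \<subseteq> carrier (sym_group (2 * k))" by (auto simp: H_def sym_group_carrier)
    have "id \<in> H" using permutes_id ind_id G.one_closed by (simp add: H_def del: id_apply)
    then show "H \<noteq> {}" by blast
    show "inv\<^bsub>sym_group (2 * k)\<^esub> p \<in> H" if "p \<in> H" for p
    proof -
      have p: "p permutes X" "ind p \<in> G" using that by (auto simp: H_def)
      have p': "inv' p permutes X" using permutes_inv[OF p(1)] .
      have "ind (inv' p) \<otimes>\<^bsub>\<A>\<^esub> ind p = \<one>\<^bsub>\<A>\<^esub>"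
        using ind_comp[OF p' p(1)] permutes_inv_o(2)[OF p(1)] ind_id by metis
      then have "inv\<^bsub>\<A>\<^esub> ind p = ind (inv' p)"
        using aut.inv_equality ind_carrier p(1) p' by blast
      then have "ind (inv' p) \<in> G" using G.m_inv_closed[OF p(2)] by simp
      then show ?thesis using p p' by (simp add: H_def sym_group_carrier)
    qed
    show "p \<otimes>\<^bsub>sym_group (2 * k)\<^esub> q \<in> H" if "p \<in> H" "q \<in> H" for p q
      using that ind_comp[of p q] permutes_compose[of q X p] by (simp add: H_def sym_group_mult)
  qed
qed

lemma K_comp_H: "m \<in> K \<Longrightarrow> h \<in> H \<Longrightarrow> m \<circ> h \<in> K"
  and H_comp_K: "m \<in> K \<Longrightarrow> h \<in> H \<Longrightarrow> h \<circ> m \<in> K"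
  and K_comp_K: "m \<in> K \<Longrightarrow> m' \<in> K \<Longrightarrow> m \<circ> m' \<in> H"
proof -
  interpret G: subgroup G \<A> by (rule G)
  show "m \<circ> h \<in> K" if "m \<in> K" "h \<in> H"
  proof -
    have p: "m permutes X" "h permutes X" using that by (auto simp: H_def K_def)
    note c = ind_carrier[OF p(1)] ind_carrier[OF p(2)] \<tau>_carrier
    have "ind (m \<circ> h) \<otimes>\<^bsub>\<A>\<^esub> \<tau> k = (ind m \<otimes>\<^bsub>\<A>\<^esub> \<tau> k) \<otimes>\<^bsub>\<A>\<^esub> ind h"
      using c by (simp add: ind_comp[OF p] aut.m_assoc \<tau>_ind_commute[OF p(2)])
    then show ?thesis using that permutes_compose[OF p(2,1)] by (simp add: H_def K_def)
  qed
  show "h \<circ> m \<in> K" if "m \<in> K" "h \<in> H"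
  proof -
    have p: "m permutes X" "h permutes X" using that by (auto simp: H_def K_def)
    note c = ind_carrier[OF p(1)] ind_carrier[OF p(2)] \<tau>_carrier
    have "ind (h \<circ> m) \<otimes>\<^bsub>\<A>\<^esub> \<tau> k = ind h \<otimes>\<^bsub>\<A>\<^esub> (ind m \<otimes>\<^bsub>\<A>\<^esub> \<tau> k)"
      using c by (simp add: ind_comp[OF p(2,1)] aut.m_assoc)
    then show ?thesis using that permutes_compose[OF p(1,2)] by (simp add: H_def K_def)
  qed
  show "m \<circ> m' \<in> H" if "m \<in> K" "m' \<in> K"
  proof -
    have p: "m permutes X" "m' permutes X" using that by (auto simp: K_def)
    note c = ind_carrier[OF p(1)] ind_carrier[OF p(2)] \<tau>_carrier
    have "(ind m \<otimes>\<^bsub>\<A>\<^esub> \<tau> k) \<otimes>\<^bsub>\<A>\<^esub> (ind m' \<otimes>\<^bsub>\<A>\<^esub> \<tau> k)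
        = ind m \<otimes>\<^bsub>\<A>\<^esub> (ind m' \<otimes>\<^bsub>\<A>\<^esub> \<tau> k) \<otimes>\<^bsub>\<A>\<^esub> \<tau> k"
      using c by (simp add: aut.m_assoc \<tau>_ind_commute[OF p(2), symmetric])
    also have "\<dots> = ind (m \<circ> m')" using c by (simp add: ind_comp[OF p] aut.m_assoc \<tau>_\<tau>)
    finally have "ind (m \<circ> m') = (ind m \<otimes>\<^bsub>\<A>\<^esub> \<tau> k) \<otimes>\<^bsub>\<A>\<^esub> (ind m' \<otimes>\<^bsub>\<A>\<^esub> \<tau> k)" by simp
    moreover have "ind m \<otimes>\<^bsub>\<A>\<^esub> \<tau> k \<in> G" "ind m' \<otimes>\<^bsub>\<A>\<^esub> \<tau> k \<in> G"
      using that by (simp_all add: K_def)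
    ultimately have "ind (m \<circ> m') \<in> G" by (simp add: G.m_closed)
    then show ?thesis using permutes_compose[OF p(2,1)] by (simp add: H_def)
  qed
qed

lemma inv_K: "m \<in> K \<Longrightarrow> inv' m \<in> K"
proof -
  assume m: "m \<in> K"
  have "m \<circ> m \<in> H" using K_comp_K[OF m m] .
  then have "inv' (m \<circ> m) \<in> H" using perm_subgroup_inv[OF subgroup_H] by blast
  then have "m \<circ> inv' (m \<circ> m) \<in> K" using K_comp_H[OF m] by blast
  moreover have "m \<circ> inv' (m \<circ> m) = inv' m"
    using permutes_bij[OF permutes_K[OF m]] by (simp add: o_inv_distrib fun_eq_iff bij_is_surj surj_f_inv_f)
  ultimately show ?thesis by simp
qed

lemma bij_H: "h \<in> H \<Longrightarrow> bij h" and bij_K: "m \<in> K \<Longrightarrow> bij m"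
  using permutes_bij permutes_H permutes_K by blast+

text \<open>The form in which arc-transitivity of \<open>G\<close> is used: an element with a factor
  \<tau> acts on a vertex by applying its permutation part \<open>m\<close> to the
  complement.\<close>

lemma arc_cases:
  assumes "(A, B) \<in> parcs J" "(A', B') \<in> parcs J"
  shows "(\<exists>h\<in>H. h ` A = A' \<and> h ` B = B') \<or> (\<exists>m\<in>K. m ` (X - A) = A' \<and> m ` (X - B) = B')"
proof -
  have V: "A \<in> V" "B \<in> V" using assms arc_iff by auto
  obtain g where g: "g \<in> G" "g A = A'" "g B = B'"
    using transG assms unfolding arc_transitive_iff[OF wf G] by blast
  have "g \<in> carrier \<A>" using subgroup.mem_carrier[OF G g(1)] .
  then obtain p where p: "p permutes X" "g = ind p \<or> g = ind p \<otimes>\<^bsub>\<A>\<^esub> \<tau> k" using aut_cases by blast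
  have "(ind p \<otimes>\<^bsub>\<A>\<^esub> \<tau> k) C = p ` (X - C)" if "C \<in> V" for C
    using that compl_V[OF that] p(1) by (simp add: aut_group_mult_apply ind_carrier \<tau>_carrier ind_apply \<tau>_apply)
  then show ?thesis using p g V ind_apply unfolding H_def K_def by auto
qed

lemma ind_H: "G \<inter> induced_sym (2 * k) k = ind ` H"
  by (auto simp: induced_sym_def H_def sym_group_carrier)

lemma subgroup_ind_H: "subgroup (ind ` H) \<A>"
proof (rule aut.subgroupI)
  note HS = subgroup_H
  show "ind ` H \<subseteq> carrier \<A>" using ind_carrier permutes_H by blast
  show "ind ` H \<noteq> {}" using perm_subgroup_id[OF HS] by blast
  show "inv\<^bsub>\<A>\<^esub> f \<in> ind ` H" if f: "f \<in> ind ` H" for f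
  proof -
    obtain h where h: "h \<in> H" "f = ind h" using f by blast
    have h': "inv' h \<in> H" using perm_subgroup_inv[OF HS h(1)] .
    have "ind (inv' h) \<otimes>\<^bsub>\<A>\<^esub> ind h = \<one>\<^bsub>\<A>\<^esub>"
      using ind_comp[OF permutes_H[OF h'] permutes_H[OF h(1)]] permutes_inv_o(2)[OF permutes_H[OF h(1)]] ind_id by metis
    then have "inv\<^bsub>\<A>\<^esub> f = ind (inv' h)"
      using aut.inv_equality ind_carrier permutes_H h h' by blast
    then show ?thesis using h' by blast
  qed
  show "f \<otimes>\<^bsub>\<A>\<^esub> g \<in> ind ` H" if "f \<in> ind ` H" "g \<in> ind ` H" for f g
    using that ind_comp[OF permutes_H permutes_H] perm_subgroup_comp[OF HS] by (auto simp del: o_apply) (metis imageI)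
qed

lemma arc_transitive_ind_H_iff:
  "arc_transitive J (ind ` H) \<longleftrightarrow>
    (\<forall>A B A' B'. (A, B) \<in> parcs J \<longrightarrow> (A', B') \<in> parcs J \<longrightarrow> (\<exists>h\<in>H. h ` A = A' \<and> h ` B = B'))"
  unfolding arc_transitive_iff[OF wf subgroup_ind_H]
  by (simp add: arc_iff ind_apply cong: conj_cong)

definition equiv_H :: "nat set \<Rightarrow> nat set \<Rightarrow> bool" where
  "equiv_H A B \<longleftrightarrow> (\<exists>h\<in>H. h ` A = B)"

lemma vertex_cases:
  assumes "(A, B) \<in> parcs J"
  shows "equiv_H A B \<or> (\<exists>m\<in>K. m ` (X - A) = B)"
proof -
  have "(B, A) \<in> parcs J" using assms by (simp add: arc_iff Int_commute)
  from arc_cases[OF assms this] show ?thesis unfolding equiv_H_def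
    by (elim disjE bexE conjE)
      (rule disjI1, rule bexI, assumption+, rule disjI2, rule bexI, assumption+)
qed

lemma equiv_H_trans: "equiv_H A B \<Longrightarrow> equiv_H B C \<Longrightarrow> equiv_H A C"
  unfolding equiv_H_def using perm_subgroup_comp[OF subgroup_H] image_comp_eq by metis

text \<open>
  The two \<^term>\<open>H\<close>-orbits on vertices, if there were two, would be blocks for \<^term>\<open>G\<close>, hence all arcs would join
  different orbits; but the graph has triangles.
\<close>
lemma exists_arc_in_orbit: "\<exists>A B. (A, B) \<in> parcs J \<and> equiv_H A B"
proof -
  obtain A where A: "A \<in> V" using obtain_V_containing[of 1 1] k2 by auto
  have "2 \<le> card A" "2 \<le> card (X - A)" using V_card[OF A] V_card[OF compl_V[OF A]] k2 by auto
  then obtain a b b' where ab: "a \<in> A" "b \<in> X - A" "b' \<in> X - A" "b \<noteq> b'"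
    using two_distinct_elements[of A] two_distinct_elements[of "X - A"] by blast
  let ?B = "exchange A a b" and ?C = "exchange A a b'"
  have arcs: "(A, ?B) \<in> parcs J" "(A, ?C) \<in> parcs J" "(?B, ?C) \<in> parcs J"
    using arc_exchange[OF A ab(1,2)] arc_exchange[OF A ab(1,3)] arc_exchange_exchange_iff[OF A ab(1,1,2,3)] ab(4)
    by auto
  have "equiv_H A ?B \<or> (\<exists>m\<in>K. m ` (X - A) = ?B)" "equiv_H A ?C \<or> (\<exists>m\<in>K. m ` (X - A) = ?C)"
    using vertex_cases[OF arcs(1)] vertex_cases[OF arcs(2)] .
  \<comment> \<open>If both neighbours in the triangle are reached from \<open>A\<close> only
    through \<open>K\<close>, the passage from one to the other is a product of two members of
    \<open>K\<close> and so lies in \<open>H\<close>.\<close>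
  then consider "equiv_H A ?B" | "equiv_H A ?C" | m m' where "m \<in> K" "m' \<in> K" "m ` (X - A) = ?B" "m' ` (X - A) = ?C"
    by fast
  then show ?thesis
  proof cases
    case 3
    have "inv' m ` ?B = X - A" using 3(3) image_inv_eq_iff[OF bij_K[OF 3(1)]] by simp
    then have "(m' \<circ> inv' m) ` ?B = ?C" using 3(4) by (simp only: image_comp_eq)
    moreover have "m' \<circ> inv' m \<in> H" using K_comp_K[OF 3(2) inv_K[OF 3(1)]] .
    ultimately show ?thesis using arcs(3) unfolding equiv_H_def by blast
  qed (use arcs in blast)+
qed

text \<open>Conjugation by elements of \<open>H\<close> and of \<open>K\<close> preserves
  \<open>H\<close>, so an element of \<open>H\<close> joining the ends of one arc yields one joining
  the ends of any other; for \<open>K\<close> it is used on the complements of the ends.\<close>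

lemma arc_in_orbit:
  assumes arc: "(A', B') \<in> parcs J"
  shows "equiv_H A' B'"
proof -
  obtain A B g where AB: "(A, B) \<in> parcs J" and g: "g \<in> H" "g ` A = B"
    using exists_arc_in_orbit unfolding equiv_H_def by blast
  have AX: "A \<subseteq> X" using AB arc_iff V_subset by blast
  from arc_cases[OF AB arc] show ?thesis
  proof
    assume "\<exists>h\<in>H. h ` A = A' \<and> h ` B = B'"
    then obtain h where h: "h \<in> H" "h ` A = A'" "h ` B = B'" by blast
    have "(h \<circ> g \<circ> inv' h) ` A' = B'"
      using image_inv_eq_iff[OF bij_H[OF h(1)], of A' A] h g by (simp add: image_comp_eq del: o_apply)
    moreover have "h \<circ> g \<circ> inv' h \<in> H"
      using perm_subgroup_comp[OF subgroup_H] perm_subgroup_inv[OF subgroup_H] h(1) g(1) by blast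
    ultimately show ?thesis unfolding equiv_H_def by blast
  next
    assume "\<exists>m\<in>K. m ` (X - A) = A' \<and> m ` (X - B) = B'"
    then obtain m where m: "m \<in> K" "m ` (X - A) = A'" "m ` (X - B) = B'" by blast
    have "g ` (X - A) = X - B" using permutes_image_compl[OF permutes_H[OF g(1)] AX] g(2) by simp
    then have "(m \<circ> g \<circ> inv' m) ` A' = B'"
      using image_inv_eq_iff[OF bij_K[OF m(1)], of A' "X - A"] m by (simp add: image_comp_eq del: o_apply)
    moreover have "m \<circ> g \<circ> inv' m \<in> H" using K_comp_K K_comp_H inv_K m(1) g(1) by blast
    ultimately show ?thesis unfolding equiv_H_def by blast
  qed
qed

text \<open>Connectedness of the graph: each exchange moves the vertex one step closer to
  \<open>B\<close> without leaving its orbit.\<close>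

lemma equiv_H_all:
  assumes "A \<in> V" "B \<in> V"
  shows "equiv_H A B"
  using assms(1)
proof (induction "card (A - B)" arbitrary: A rule: less_induct)
  case less
  show ?case
  proof (cases "A = B")
    case True
    then show ?thesis unfolding equiv_H_def using perm_subgroup_id[OF subgroup_H] by (intro bexI[of _ id]) auto
  next
    case False
    have fin: "finite A" "finite B" using finite_V[OF less.prems] finite_V[OF assms(2)] .
    have cards: "card A = card B" using V_card[OF less.prems] V_card[OF assms(2)] by simp
    have "\<not> A \<subseteq> B" using False card_subset_eq[OF fin(2)] cards by blast
    then obtain a where a: "a \<in> A" "a \<notin> B" by blast
    have "\<not> B \<subseteq> A" using False card_subset_eq[OF fin(1)] cards by metis
    then obtain b where b: "b \<in> B" "b \<notin> A" by blast
    have bX: "b \<in> X - A" using b V_subset[OF assms(2)] by blast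
    have "exchange A a b - B \<subset> A - B" using a b by (auto simp: exchange_def)
    then have "card (exchange A a b - B) < card (A - B)" using fin by (intro psubset_card_mono) auto
    then have "equiv_H (exchange A a b) B" using less.hyps exchange_V[OF less.prems a(1) bX] by blast
    then show ?thesis using arc_in_orbit[OF arc_exchange[OF less.prems a(1) bX]] equiv_H_trans by blast
  qed
qed

lemma homogeneous_H: "homogeneous (2 * k) k H"
  unfolding homogeneous_def using equiv_H_all unfolding equiv_H_def V_iff by blast

lemma card_neighbours:
  assumes A: "A \<in> V"
  shows "card {B. (A, B) \<in> parcs J} = k * k"
proof -
  have "{B. (A, B) \<in> parcs J} = (\<lambda>(a, b). exchange A a b) ` (A \<times> (X - A))"
  proof (intro equalityI subsetI)
    fix B assume "B \<in> {B. (A, B) \<in> parcs J}"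
    then have "(A, B) \<in> parcs J" by simp
    then obtain a b where "a \<in> A" "b \<in> X - A" "B = exchange A a b" by (rule arc_obtain_exchange)
    then show "B \<in> (\<lambda>(a, b). exchange A a b) ` (A \<times> (X - A))" by (intro image_eqI[of _ _ "(a, b)"]) simp_all
  next
    fix B assume "B \<in> (\<lambda>(a, b). exchange A a b) ` (A \<times> (X - A))"
    then obtain a b where "a \<in> A" "b \<in> X - A" "B = exchange A a b" by blast
    then show "B \<in> {B. (A, B) \<in> parcs J}" using arc_exchange[OF A] by simp
  qed
  moreover have "inj_on (\<lambda>(a, b). exchange A a b) (A \<times> (X - A))"
  proof (rule inj_onI)
    fix r r' assume r: "r \<in> A \<times> (X - A)" "r' \<in> A \<times> (X - A)"
      "(case r of (a, b) \<Rightarrow> exchange A a b) = (case r' of (a, b) \<Rightarrow> exchange A a b)"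
    obtain a b a' b' where ab: "r = (a, b)" "r' = (a', b')" by fastforce
    then show "r = r'" using r exchange_eq_iff[of a A a' b b'] by simp
  qed
  ultimately show ?thesis
    using V_card[OF A] V_card[OF compl_V[OF A]] by (simp add: card_image card_cartesian_product)
qed

text \<open>If the stabiliser of a vertex in \<^term>\<open>H\<close> had two orbits on the neighbours, their number would be even.\<close>
lemma neighbour_transitive_if_odd:
  assumes odd: "odd k" and arcs: "(A, B\<^sub>0) \<in> parcs J" "(A, B\<^sub>1) \<in> parcs J"
  shows "\<exists>h\<in>H. h ` A = A \<and> h ` B\<^sub>0 = B\<^sub>1"
proof (rule ccontr)
  assume no: "\<not> ?thesis"
  have A: "A \<in> V" and B0: "B\<^sub>0 \<in> V" using arcs arc_iff by auto
  note AX = V_subset[OF A]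
  obtain m where m: "m \<in> K" "m ` (X - A) = A" "m ` (X - B\<^sub>0) = B\<^sub>1" using arc_cases[OF arcs] no by blast
  have bm: "bij m" using bij_K[OF m(1)] .
  define O\<^sub>0 where "O\<^sub>0 = (\<lambda>h. h ` B\<^sub>0) ` {h \<in> H. h ` A = A}"
  \<comment> \<open>The action of an element of \<open>G\<close> outside the first alternative: it
    fixes \<open>A\<close>, maps \<open>B\<^sub>0\<close> to \<open>B\<^sub>1\<close> and turns the
    first orbit into the second.\<close>
  define \<psi> where "\<psi> B = m ` (X - B)" for B
  have OV: "O\<^sub>0 \<subseteq> V" using image_V[OF permutes_H B0] by (auto simp: O\<^sub>0_def)
  have finO: "finite O\<^sub>0" using perm_subgroup_finite[OF subgroup_H] by (simp add: O\<^sub>0_def)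
  have inj: "inj_on \<psi> V"
  proof (rule inj_onI)
    fix B C assume BC: "B \<in> V" "C \<in> V" "\<psi> B = \<psi> C"
    then have "X - B = X - C" using bm by (simp add: \<psi>_def bij_is_inj inj_image_eq_iff)
    then show "B = C" using compl_compl BC(1,2) by metis
  qed
  have hcompl: "h ` (X - A) = X - A" if "h \<in> H" "h ` A = A" for h
    using permutes_image_compl[OF permutes_H[OF that(1)] AX] that(2) by simp
  have inv_m: "inv' m ` A = X - A" using image_inv_eq_iff[OF bm] m(2) by simp
  have "{B. (A, B) \<in> parcs J} = O\<^sub>0 \<union> \<psi> ` O\<^sub>0"
  proof (intro equalityI subsetI)
    fix B assume "B \<in> {B. (A, B) \<in> parcs J}"
    then have "(A, B) \<in> parcs J" by simp
    from arc_cases[OF arcs(1) this] show "B \<in> O\<^sub>0 \<union> \<psi> ` O\<^sub>0"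
    proof
      assume "\<exists>h\<in>H. h ` A = A \<and> h ` B\<^sub>0 = B"
      then show ?thesis by (auto simp: O\<^sub>0_def)
    next
      assume "\<exists>m'\<in>K. m' ` (X - A) = A \<and> m' ` (X - B\<^sub>0) = B"
      then obtain m' where m': "m' \<in> K" "m' ` (X - A) = A" "m' ` (X - B\<^sub>0) = B" by blast
      define h where "h = inv' m \<circ> m'"
      have h: "h \<in> H" unfolding h_def using K_comp_K inv_K m(1) m'(1) by blast
      have "h ` (X - A) = X - A" using inv_m m'(2) by (simp add: h_def image_comp_eq del: o_apply)
      then have "X - h ` A = X - A" using permutes_image_compl[OF permutes_H[OF h] AX] by simp
      then have hA: "h ` A = A" using compl_compl image_V[OF permutes_H[OF h] A] A by metis
      have "m ` h ` (X - B\<^sub>0) = m' ` (X - B\<^sub>0)"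
        using bm by (simp add: h_def image_image bij_is_surj surj_f_inv_f)
      then have "B = \<psi> (h ` B\<^sub>0)"
        using m'(3) permutes_image_compl[OF permutes_H[OF h] V_subset[OF B0]] by (simp add: \<psi>_def)
      then show ?thesis using h hA by (auto simp: O\<^sub>0_def)
    qed
  next
    fix B assume "B \<in> O\<^sub>0 \<union> \<psi> ` O\<^sub>0"
    moreover have "(A, h ` B\<^sub>0) \<in> parcs J" if "h \<in> H" "h ` A = A" for h
      using aut_group_arc[OF ind_carrier[OF permutes_H[OF that(1)]] A B0] arcs(1) A B0 that(2) by (simp add: ind_apply)
    moreover have "(A, \<psi> C) \<in> parcs J" if C: "(A, C) \<in> parcs J" for C
    proof -
      have CV: "C \<in> V" using C arc_iff by blast
      have app: "(ind m \<otimes>\<^bsub>\<A>\<^esub> \<tau> k) D = m ` (X - D)" if "D \<in> V" for D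
        using that compl_V[OF that] permutes_K[OF m(1)]
        by (simp add: aut_group_mult_apply ind_carrier \<tau>_carrier ind_apply \<tau>_apply)
      have "ind m \<otimes>\<^bsub>\<A>\<^esub> \<tau> k \<in> carrier \<A>" using ind_carrier[OF permutes_K[OF m(1)]] \<tau>_carrier by simp
      from aut_group_arc[OF this A CV] show ?thesis using C app[OF A] app[OF CV] m(2) by (simp add: \<psi>_def)
    qed
    ultimately show "B \<in> {B. (A, B) \<in> parcs J}" by (auto simp: O\<^sub>0_def)
  qed
  moreover have "O\<^sub>0 \<inter> \<psi> ` O\<^sub>0 = {}"
  proof (rule ccontr)
    assume "O\<^sub>0 \<inter> \<psi> ` O\<^sub>0 \<noteq> {}"
    then obtain h h' where h: "h \<in> H" "h ` A = A" "h' \<in> H" "h' ` A = A" "h' ` B\<^sub>0 = \<psi> (h ` B\<^sub>0)"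
      unfolding O\<^sub>0_def by blast
    \<comment> \<open>If the two orbits met, undoing \<open>m\<close> and \<open>h\<close> after
      \<open>h'\<close> and then applying \<open>m\<close> would fix \<open>A\<close> and take
      \<open>B\<^sub>0\<close> to \<open>B\<^sub>1\<close>, all within \<open>H\<close>.\<close>
    let ?g = "m \<circ> inv' h \<circ> inv' m \<circ> h'"
    have hB: "h ` (X - B\<^sub>0) = X - h ` B\<^sub>0"
      using permutes_image_compl[OF permutes_H[OF h(1)] V_subset[OF B0]] .
    have bh: "bij h" using bij_H[OF h(1)] .
    have "m \<circ> inv' h \<circ> inv' m \<in> H"
      using K_comp_K K_comp_H inv_K m(1) perm_subgroup_inv[OF subgroup_H h(1)] by blast
    then have "?g \<in> H" using perm_subgroup_comp[OF subgroup_H] h(3) by blast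
    moreover have "?g ` A = A"
    proof -
      have "inv' h ` (X - A) = X - A" using image_inv_eq_iff[OF bh] hcompl[OF h(1,2)] by simp
      then show ?thesis using h(4) inv_m m(2) by (simp add: image_comp_eq del: o_apply)
    qed
    moreover have "?g ` B\<^sub>0 = B\<^sub>1"
    proof -
      have "inv' m ` \<psi> (h ` B\<^sub>0) = X - h ` B\<^sub>0" using image_inv_eq_iff[OF bm] by (simp add: \<psi>_def)
      moreover have "inv' h ` (X - h ` B\<^sub>0) = X - B\<^sub>0" using image_inv_eq_iff[OF bh] hB by simp
      ultimately show ?thesis using h(5) m(3) by (simp add: image_comp_eq del: o_apply)
    qed
    ultimately show False using no by blast
  qed
  moreover have "card (\<psi> ` O\<^sub>0) = card O\<^sub>0" using inj OV by (meson card_image inj_on_subset)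
  ultimately have "k * k = card O\<^sub>0 + card O\<^sub>0"
    using card_neighbours[OF A] finO card_Un_disjoint[of "O\<^sub>0" "\<psi> ` O\<^sub>0"] by simp
  then show False using odd by (metis even_add even_mult_iff)
qed

lemma arc_transitive_H_if_ge_3:
  assumes k: "3 \<le> k"
  shows "arc_transitive J (ind ` H)"
  unfolding arc_transitive_ind_H_iff
proof (intro allI impI)
  fix A B A' B' assume arcs: "(A, B) \<in> parcs J" "(A', B') \<in> parcs J"
  show "\<exists>h\<in>H. h ` A = A' \<and> h ` B = B'"
  proof (cases "even k")
    case True
    then have "4 \<le> k" using k by (cases "k = 3") auto
    then have "carrier (alt_group (2 * k)) \<subseteq> H"
      using homogeneous_even_contains_alt[OF _ True subgroup_H homogeneous_H] by blast
    moreover obtain q where "q \<in> carrier (alt_group (2 * k))" "q ` A = A'" "q ` B = B'"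
      using alt_arc_transitive[OF k arcs] .
    ultimately show ?thesis by blast
  next
    case False
    have V: "A \<in> V" "B \<in> V" "A' \<in> V" using arcs arc_iff by auto
    obtain g where g: "g \<in> H" "g ` A = A'" using equiv_H_all[OF V(1,3)] unfolding equiv_H_def by blast
    have "(A', g ` B) \<in> parcs J"
      using aut_group_arc[OF ind_carrier[OF permutes_H[OF g(1)]] V(1,2)] arcs(1) g(2) V by (simp add: ind_apply)
    from neighbour_transitive_if_odd[OF False this arcs(2)]
    obtain h where h: "h \<in> H" "h ` A' = A'" "h ` g ` B = B'" by blast
    then have "(h \<circ> g) ` A = A'" "(h \<circ> g) ` B = B'" using g(2) by (simp_all add: image_comp_eq del: o_apply)
    then show ?thesis using perm_subgroup_comp[OF subgroup_H h(1) g(1)] by blast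
  qed
qed

end

section \<open>The exceptional graph J(4,2)\<close>

context middle_johnson_arc_transitive
begin

lemma ind_K_subset: "m \<in> K \<Longrightarrow> ind m \<otimes>\<^bsub>\<A>\<^esub> \<tau> k \<in> G"
  by (simp add: K_def)

lemma G_cases:
  assumes "g \<in> G"
  obtains h where "h \<in> H" "g = ind h" | m where "m \<in> K" "g = ind m \<otimes>\<^bsub>\<A>\<^esub> \<tau> k"
  using aut_cases[OF subgroup.mem_carrier[OF G assms]] assms unfolding H_def K_def by blast

end

text \<open>This arc pins down all four points: the common point 1, then 2 and 3 as the other points
  of its ends, and 4 as the last one.\<close>

lemma permutes_4_eq_id:
  fixes q :: "nat \<Rightarrow> nat"
  assumes q: "q permutes {1..4}" and im: "q ` {1, 2} = {1, 2}" "q ` {1, 3} = {1, 3}"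
  shows "q = id"
proof
  have inj: "inj q" using permutes_inj[OF q] .
  have "{1, 2} \<inter> {1, 3} = {1 :: nat}" by auto
  then have "q ` {1} = {1}" using image_Int[OF inj, of "{1, 2}" "{1, 3}"] unfolding im by (simp only:)
  then have 1: "q 1 = 1" by simp
  have 2: "q 2 = 2" using im(1) 1 inj by (auto simp: doubleton_eq_iff dest: injD)
  have 3: "q 3 = 3" using im(2) 1 inj by (auto simp: doubleton_eq_iff dest: injD)
  have "q 4 \<in> {1..4}" using permutes_in_image[OF q, of 4] by simp
  moreover have "q 4 \<noteq> q 1" "q 4 \<noteq> q 2" "q 4 \<noteq> q 3" using inj by (simp_all add: inj_eq)
  ultimately have 4: "q 4 = 4" unfolding 1 2 3 by auto
  fix x
  show "q x = id x"
  proof (cases "x \<in> {1..4}")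
    case True
    then have "x = 1 \<or> x = 2 \<or> x = 3 \<or> x = 4" by auto
    then show ?thesis using 1 2 3 4 by auto
  next
    case False
    then show ?thesis using permutes_not_in[OF q] by simp
  qed
qed

lemma three_cycle_cube:
  assumes "length cs = 3" "cycle cs"
  shows "cycle_of_list cs \<circ> cycle_of_list cs \<circ> cycle_of_list cs = id"
proof -
  obtain a b c where cs: "cs = [a, b, c]" using stupid_lemma[OF assms(1)] by blast
  then show ?thesis using assms(2) by (auto simp: fun_eq_iff transpose_def)
qed

locale middle_johnson_2 = middle_johnson_arc_transitive +
  assumes two: "k = 2" and not_trans: "\<not> arc_transitive J (ind ` H)"
begin

abbreviation A\<^sub>0 :: "nat set" where "A\<^sub>0 \<equiv> {1, 2}"
abbreviation B\<^sub>0 :: "nat set" where "B\<^sub>0 \<equiv> {1, 3}"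

text \<open>The double transposition (1 4)(2 3) maps both ends of the base arc to their complements,
  so on this arc it does what \<tau> does. Its evenness later decides that \<open>K\<close> consists
  of odd permutations.\<close>

definition r :: "nat \<Rightarrow> nat" where
  "r = transpose 1 4 \<circ> transpose 2 3"

lemma X4: "X = {1..4}"
  by (simp add: two)

lemma arc0: "(A\<^sub>0, B\<^sub>0) \<in> parcs J"
  unfolding arc_iff V_iff by (auto simp: two card_insert_if)

lemma r_permutes: "r permutes X" and r_permutation: "permutation r" and r_even: "evenperm r"
proof -
  have t: "transpose 1 4 permutes X" "transpose 2 3 permutes X" by (auto simp: two intro!: permutes_swap_id)
  show p: "r permutes X" unfolding r_def by (rule permutes_compose[OF t(2,1)])
  show "permutation r" using p permutes_imp_permutation by blast
  have "permutation (transpose 1 4 :: nat \<Rightarrow> nat)" "permutation (transpose 2 3 :: nat \<Rightarrow> nat)"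
    using t permutes_imp_permutation by blast+
  then show "evenperm r" unfolding r_def by (simp add: evenperm_comp evenperm_swap)
qed

lemma r_image: "X - A\<^sub>0 = r ` A\<^sub>0" "X - B\<^sub>0 = r ` B\<^sub>0"
proof -
  have "X = {1, 2, 3, 4}" unfolding X4 by auto
  then show "X - A\<^sub>0 = r ` A\<^sub>0" "X - B\<^sub>0 = r ` B\<^sub>0" by (simp_all only:) (auto simp: r_def transpose_def)
qed

lemma perm_permutation: "p permutes X \<Longrightarrow> permutation p"
  using permutes_imp_permutation by blast

lemma eq_if_agree_on_arc0:
  assumes p: "p permutes X" and q: "q permutes X" and eq: "p ` A\<^sub>0 = q ` A\<^sub>0" "p ` B\<^sub>0 = q ` B\<^sub>0"
  shows "p = q"
proof -
  have bq: "bij q" using permutes_bij[OF q] .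
  have "(inv' q \<circ> p) ` A\<^sub>0 = A\<^sub>0" "(inv' q \<circ> p) ` B\<^sub>0 = B\<^sub>0"
    using image_inv_eq_iff[OF bq] eq by (simp_all only: image_comp_eq)
  moreover have "inv' q \<circ> p permutes {1..4}"
    using permutes_compose[OF p permutes_inv[OF q]] X4 by simp
  ultimately have "inv' q \<circ> p = id" using permutes_4_eq_id by blast
  then have "q \<circ> (inv' q \<circ> p) = q" by simp
  then show ?thesis using bq by (simp add: o_assoc[symmetric] fun_eq_iff bij_is_surj surj_f_inv_f)
qed

lemma perm_arc0: "q permutes X \<Longrightarrow> (q ` A\<^sub>0, q ` B\<^sub>0) \<in> parcs J"
  using aut_group_arc[OF ind_carrier, of q A\<^sub>0 B\<^sub>0] arc0 arc_iff by (simp add: ind_apply)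

text \<open>Arc-transitivity of \<open>G\<close> read through the regular action of the symmetric
  group: the image of the base arc determines the permutation, and on that arc complementation can
  be replaced by \<open>r\<close>.\<close>

lemma cover:
  assumes q: "q permutes X" and "q \<notin> H"
  obtains m where "m \<in> K" "q = m \<circ> r"
proof -
  from arc_cases[OF arc0 perm_arc0[OF q]] show thesis
  proof
    assume "\<exists>h\<in>H. h ` A\<^sub>0 = q ` A\<^sub>0 \<and> h ` B\<^sub>0 = q ` B\<^sub>0"
    then show thesis using eq_if_agree_on_arc0[OF permutes_H q] assms(2) by blast
  next
    assume "\<exists>m\<in>K. m ` (X - A\<^sub>0) = q ` A\<^sub>0 \<and> m ` (X - B\<^sub>0) = q ` B\<^sub>0"
    then obtain m where m: "m \<in> K" "m ` r ` A\<^sub>0 = q ` A\<^sub>0" "m ` r ` B\<^sub>0 = q ` B\<^sub>0"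
      unfolding r_image by blast
    have "m \<circ> r = q"
      using m(2,3) by (intro eq_if_agree_on_arc0 permutes_compose[OF r_permutes permutes_K[OF m(1)]] q)
        (simp_all only: image_comp_eq)
    then show thesis using that m(1) by blast
  qed
qed

text \<open>The complement of \<open>H\<close> is covered by products \<open>m \<circ> r\<close>,
  and two of these differ by an element of \<open>H\<close>. So if \<open>q\<close> and
  \<open>q \<circ> q\<close> were both outside, their quotient \<open>q\<close> would be
  inside.\<close>

lemma square_in_H:
  assumes q: "q permutes X"
  shows "q \<circ> q \<in> H"
proof (cases "q \<in> H")
  case True
  then show ?thesis using perm_subgroup_comp[OF subgroup_H] by blast
next
  case False
  then obtain m where m: "m \<in> K" "q = m \<circ> r" using cover[OF q] by blast
  show ?thesis
  proof (rule ccontr)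
    assume "q \<circ> q \<notin> H"
    then obtain m' where m': "m' \<in> K" "q \<circ> q = m' \<circ> r" using cover[OF permutes_compose[OF q q]] by blast
    have bq: "bij q" "bij m" "bij r" using permutes_bij q r_permutes permutes_K[OF m(1)] by blast+
    have "q = q \<circ> q \<circ> inv' q" using bq(1) by (simp add: fun_eq_iff bij_is_surj surj_f_inv_f)
    also have "\<dots> = m' \<circ> r \<circ> inv' q" by (simp only: m'(2))
    also have "inv' q = inv' r \<circ> inv' m" using o_inv_distrib[OF bq(2,3)] m(2) by simp
    also have "m' \<circ> r \<circ> (inv' r \<circ> inv' m) = m' \<circ> inv' m" using bq(3) by (simp add: fun_eq_iff bij_is_surj surj_f_inv_f)
    finally have "q \<in> H" using K_comp_K[OF m'(1) inv_K[OF m(1)]] by simp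
    then show False using False by simp
  qed
qed

text \<open>A 3-cycle is a square, namely that of its own square.\<close>

lemma alt_subset_H: "carrier (alt_group (2 * k)) \<subseteq> H"
proof (rule three_cycles_generate[OF subgroup_H])
  show "three_cycles (2 * k) \<subseteq> H"
  proof
    fix c assume "c \<in> three_cycles (2 * k)"
    then obtain cs where cs: "c = cycle_of_list cs" "cycle cs" "length cs = 3" "set cs \<subseteq> X" by auto
    have c: "c permutes X" using permutes_subset[OF cycle_permutes cs(4)] cs(1) by simp
    have "(c \<circ> c) \<circ> (c \<circ> c) = c"
      using three_cycle_cube[OF cs(3,2)] cs(1) by (metis comp_assoc comp_id)
    then show "c \<in> H" using perm_subgroup_comp[OF subgroup_H square_in_H[OF c] square_in_H[OF c]] by simp
  qed
qed

lemma exists_not_in_H: "\<exists>q. q permutes X \<and> q \<notin> H"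
proof (rule ccontr)
  assume "\<not> ?thesis"
  then have all: "q \<in> H" if "q permutes X" for q using that by blast
  have "arc_transitive J (ind ` H)"
    unfolding arc_transitive_ind_H_iff using sym_arc_transitive all by metis
  then show False using not_trans by simp
qed

text \<open>A group that contains all even permutations and an odd one contains every odd
  permutation, but \<open>not_trans\<close> leaves some permutation outside
  \<open>H\<close>.\<close>

lemma H_eq: "H = carrier (alt_group (2 * k))"
proof
  obtain q where q: "q permutes X" "q \<notin> H" using exists_not_in_H by blast
  then have oq: "\<not> evenperm q" using alt_subset_H by (auto simp: alt_group_carrier)
  show "H \<subseteq> carrier (alt_group (2 * k))"
  proof
    fix h assume h: "h \<in> H"
    have "evenperm h"
    proof (rule ccontr)
      assume odd: "\<not> evenperm h"
      have h': "inv' h permutes X" using permutes_inv[OF permutes_H[OF h]] .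
      have "evenperm (q \<circ> inv' h)"
        using odd oq perm_permutation[OF q(1)] perm_permutation[OF h'] perm_permutation[OF permutes_H[OF h]]
        by (simp add: evenperm_comp evenperm_inv)
      then have "q \<circ> inv' h \<in> H"
        using alt_subset_H permutes_compose[OF h' q(1)] by (auto simp: alt_group_carrier)
      then have "q \<circ> inv' h \<circ> h \<in> H" using perm_subgroup_comp[OF subgroup_H _ h] by blast
      moreover have "q \<circ> inv' h \<circ> h = q" using bij_H[OF h] by (simp add: fun_eq_iff bij_is_inj)
      ultimately show False using q(2) by simp
    qed
    then show "h \<in> carrier (alt_group (2 * k))" using permutes_H[OF h] by (simp add: alt_group_carrier)
  qed
qed (rule alt_subset_H)

text \<open>An odd \<open>q\<close> outside \<open>H\<close> is \<open>m \<circ> r\<close> with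
  \<open>r\<close> even, so \<open>K\<close> has an odd member \<open>m\<close>; the members of
  \<open>K\<close> are those that differ from it by an even permutation.\<close>

lemma K_eq: "K = {p. p permutes X \<and> \<not> evenperm p}"
proof -
  obtain q where q: "q permutes X" "q \<notin> H" using exists_not_in_H by blast
  then have oq: "\<not> evenperm q" unfolding H_eq by (simp add: alt_group_carrier)
  obtain m where m: "m \<in> K" "q = m \<circ> r" using cover[OF q] .
  note pm = perm_permutation[OF permutes_K]
  have om: "\<not> evenperm m"
    using oq m(2) r_even pm[OF m(1)] r_permutation by (simp add: evenperm_comp)
  have m': "inv' m permutes X" "permutation (inv' m)" "\<not> evenperm (inv' m)"
    using permutes_inv[OF permutes_K[OF m(1)]] perm_permutation om evenperm_inv[OF pm[OF m(1)]] by auto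
  show ?thesis
  proof (intro equalityI subsetI)
    fix p assume p: "p \<in> K"
    have "p \<circ> inv' m \<in> H" using K_comp_K[OF p inv_K[OF m(1)]] .
    then have "evenperm (p \<circ> inv' m)" unfolding H_eq by (simp add: alt_group_carrier)
    then show "p \<in> {p. p permutes X \<and> \<not> evenperm p}"
      using permutes_K[OF p] pm[OF p] m' by (simp add: evenperm_comp)
  next
    fix p assume "p \<in> {p. p permutes X \<and> \<not> evenperm p}"
    then have p: "p permutes X" "\<not> evenperm p" by auto
    have "evenperm (p \<circ> inv' m)" using p perm_permutation[OF p(1)] m' by (simp add: evenperm_comp)
    then have "p \<circ> inv' m \<in> H" unfolding H_eq using permutes_compose[OF m'(1) p(1)] by (simp add: alt_group_carrier)
    then have "p \<circ> inv' m \<circ> m \<in> K" using H_comp_K[OF m(1)] by blast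
    moreover have "p \<circ> inv' m \<circ> m = p" using bij_K[OF m(1)] by (simp add: fun_eq_iff bij_is_inj)
    ultimately show "p \<in> K" by simp
  qed
qed

abbreviation s :: "nat \<Rightarrow> nat" where "s \<equiv> transpose 1 2"

lemma s_props: "s permutes X" "permutation s" "\<not> evenperm s" "s \<circ> s = id"
proof -
  show "s permutes X" by (auto simp: two intro!: permutes_swap_id)
  then show "permutation s" by (rule perm_permutation)
qed (simp_all add: evenperm_swap)

text \<open>Every \<open>m\<close> in \<open>K\<close> is the even permutation
  \<open>m \<circ> s\<close> followed on the right by \<open>s\<close>, so a single generator with a
  factor \<tau> suffices.\<close>

lemma G_eq: "G = generate \<A> (induced_alt (2 * k) k \<union> {ind s \<otimes>\<^bsub>\<A>\<^esub> \<tau> k})"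
proof
  let ?S = "induced_alt (2 * k) k \<union> {ind s \<otimes>\<^bsub>\<A>\<^esub> \<tau> k}"
  have alt: "induced_alt (2 * k) k = ind ` H" by (simp add: induced_alt_def H_eq)
  have "?S \<subseteq> G" using alt s_props ind_K_subset[of s] by (auto simp: H_def K_eq)
  then show "generate \<A> ?S \<subseteq> G" using aut.generate_subgroup_incl[OF _ G] by blast
  show "G \<subseteq> generate \<A> ?S"
  proof
    fix g assume "g \<in> G"
    then show "g \<in> generate \<A> ?S"
    proof (cases rule: G_cases)
      case (1 h)
      then show ?thesis using alt by (intro generate.incl) blast
    next
      case (2 m)
      have m: "m permutes X" "\<not> evenperm m" using 2(1) unfolding K_eq by auto
      have ms: "m \<circ> s permutes X" using permutes_compose[OF s_props(1) m(1)] .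
      have "evenperm (m \<circ> s)" using m perm_permutation[OF m(1)] s_props by (simp add: evenperm_comp)
      then have "m \<circ> s \<in> H" unfolding H_eq using ms by (simp add: alt_group_carrier)
      then have "ind (m \<circ> s) \<in> generate \<A> ?S" using alt by (intro generate.incl) blast
      moreover have "ind s \<otimes>\<^bsub>\<A>\<^esub> \<tau> k \<in> generate \<A> ?S" by (intro generate.incl) blast
      ultimately have "ind (m \<circ> s) \<otimes>\<^bsub>\<A>\<^esub> (ind s \<otimes>\<^bsub>\<A>\<^esub> \<tau> k) \<in> generate \<A> ?S" by (rule generate.eng)
      also have "ind (m \<circ> s) \<otimes>\<^bsub>\<A>\<^esub> (ind s \<otimes>\<^bsub>\<A>\<^esub> \<tau> k) = ind (m \<circ> s \<circ> s) \<otimes>\<^bsub>\<A>\<^esub> \<tau> k"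
        using ind_comp[OF ms s_props(1)] ind_carrier ms s_props(1) \<tau>_carrier by (simp add: aut.m_assoc)
      also have "m \<circ> s \<circ> s = m" using s_props(4) by (simp only: comp_assoc comp_id)
      finally show ?thesis using 2(2) by simp
    qed
  qed
qed

text \<open>By regularity \<open>P\<close> identifies permutations with arcs, and the orbits of
  \<open>H\<close> become the cosets of the alternating group, that is, the two parities.\<close>

lemma card_arc_orbits: "card (arc_orbits J (ind ` H)) = 2"
proof -
  let ?M = "\<A>\<lparr>carrier := ind ` H\<rparr>" and ?\<phi> = "arc_action J"
  interpret act: group_action ?M "parcs J" ?\<phi> by (rule arc_group_action[OF wf subgroup_ind_H])
  define P where "P q = (q ` A\<^sub>0, q ` B\<^sub>0)" for q :: "nat \<Rightarrow> nat"
  have P_arc: "P q \<in> parcs J" if "q permutes X" for q using perm_arc0[OF that] by (simp add: P_def)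
  have orb: "orbit ?M ?\<phi> (P q) = (\<lambda>h. P (h \<circ> q)) ` H" if q: "q permutes X" for q
  proof -
    have "q ` A\<^sub>0 \<in> V" "q ` B\<^sub>0 \<in> V" using perm_arc0[OF q] arc_iff by blast+
    then have "(ind h (q ` A\<^sub>0), ind h (q ` B\<^sub>0)) = P (h \<circ> q)" for h
      unfolding P_def image_comp_eq by (simp only: ind_apply)
    then have "?\<phi> (ind h) (P q) = P (h \<circ> q)" for h
      using P_arc[OF q] unfolding arc_action_def P_def by simp
    moreover have "orbit ?M ?\<phi> (P q) = (\<lambda>h. ?\<phi> (ind h) (P q)) ` H" by (auto simp: orbit_def)
    ultimately show ?thesis by simp
  qed
  have even: "P q \<in> orbit ?M ?\<phi> (P id)" if "q permutes X" "evenperm q" for q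
    using that orb[OF permutes_id] unfolding H_eq by (auto simp: alt_group_carrier)
  have odd: "P q \<in> orbit ?M ?\<phi> (P s)" if q: "q permutes X" "\<not> evenperm q" for q
  proof -
    have "evenperm (q \<circ> s)" using q s_props perm_permutation[OF q(1)] by (simp add: evenperm_comp)
    then have "q \<circ> s \<in> H" unfolding H_eq using permutes_compose[OF s_props(1) q(1)] by (simp add: alt_group_carrier)
    moreover have "q \<circ> s \<circ> s = q" using s_props(4) by (simp only: comp_assoc comp_id)
    ultimately show ?thesis using orb[OF s_props(1)] by (metis imageI)
  qed
  have same: "orbit ?M ?\<phi> e = orbit ?M ?\<phi> e'" if "e \<in> parcs J" "e' \<in> parcs J" "e \<in> orbit ?M ?\<phi> e'" for e e'
    using act.disjoint_union[of "orbit ?M ?\<phi> e" "orbit ?M ?\<phi> e'"] act.orbit_refl[OF that(1)] that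
    unfolding orbits_def by blast
  have "orbits ?M (parcs J) ?\<phi> = {orbit ?M ?\<phi> (P id), orbit ?M ?\<phi> (P s)}"
  proof (intro equalityI subsetI)
    fix \<O> assume "\<O> \<in> orbits ?M (parcs J) ?\<phi>"
    then obtain e where e: "e \<in> parcs J" "\<O> = orbit ?M ?\<phi> e" by (auto simp: orbits_def)
    obtain A B where AB: "e = (A, B)" by fastforce
    obtain q where q: "q permutes X" "q ` A\<^sub>0 = A" "q ` B\<^sub>0 = B" using sym_arc_transitive[OF arc0] e(1) AB by metis
    then have "e = P q" by (simp add: P_def AB)
    then show "\<O> \<in> {orbit ?M ?\<phi> (P id), orbit ?M ?\<phi> (P s)}"
      using same[OF e(1) P_arc[OF permutes_id]] same[OF e(1) P_arc[OF s_props(1)]] even[OF q(1)] odd[OF q(1)] e(2)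
      by blast
  next
    fix \<O> assume "\<O> \<in> {orbit ?M ?\<phi> (P id), orbit ?M ?\<phi> (P s)}"
    then show "\<O> \<in> orbits ?M (parcs J) ?\<phi>"
      using P_arc[OF permutes_id] P_arc[OF s_props(1)] unfolding orbits_def by blast
  qed
  moreover have "orbit ?M ?\<phi> (P id) \<noteq> orbit ?M ?\<phi> (P s)"
  proof
    assume "orbit ?M ?\<phi> (P id) = orbit ?M ?\<phi> (P s)"
    then have "P s \<in> orbit ?M ?\<phi> (P id)" using act.orbit_refl[OF P_arc[OF s_props(1)]] by simp
    then obtain h where h: "h \<in> H" "P s = P (h \<circ> id)" using orb[OF permutes_id] by blast
    then have "s = h" using eq_if_agree_on_arc0[OF s_props(1) permutes_H[OF h(1)]] by (simp add: P_def)
    then show False using h(1) s_props(3) unfolding H_eq by (simp add: alt_group_carrier)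
  qed
  ultimately show ?thesis by (simp add: arc_orbits_def)
qed

end

text \<open>The identification of the full automorphism group is claimed and not assumed, which is
  why it stands as the first conjunct, as a product map that is an isomorphism.\<close>

theorem theorem3p5:
  fixes k :: nat and \<Gamma> :: "nat set pair_pre_digraph" and G :: "(nat set \<Rightarrow> nat set) set"
  assumes "k \<ge> 2"
    and "\<Gamma> = johnson_graph (2 * k) k"
    and "subgroup G (aut_group \<Gamma>)"
    and "arc_transitive \<Gamma> G"
  shows "(\<lambda>(p, t). induced_perm (2 * k) k p \<otimes>\<^bsub>aut_group \<Gamma>\<^esub> t)
           \<in> iso (sym_group (2 * k) \<times>\<times> aut_group \<Gamma> \<lparr> carrier := generate (aut_group \<Gamma>) {\<tau> k} \<rparr>)
                 (aut_group \<Gamma>)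
       \<and> (arc_transitive \<Gamma> (G \<inter> induced_sym (2 * k) k)
          \<or> (k = 2
             \<and> G = generate (aut_group \<Gamma>)
                     (induced_alt 4 2 \<union> {induced_perm 4 2 (transpose 1 2) \<otimes>\<^bsub>aut_group \<Gamma>\<^esub> \<tau> 2})
             \<and> G \<inter> induced_sym 4 2 = induced_alt 4 2
             \<and> card (arc_orbits \<Gamma> (G \<inter> induced_sym 4 2)) = 2))"
proof -
  interpret middle_johnson_arc_transitive k G
    using assms by (intro middle_johnson_arc_transitive.intro middle_johnson.intro
        middle_johnson_arc_transitive_axioms.intro) simp_all
  show ?thesis
  proof (cases "arc_transitive J (ind ` H)")
    case True
    then show ?thesis using aut_iso ind_H assms(2) by simp
  next
    case False
    then have k: "k = 2" using arc_transitive_H_if_ge_3 assms(1) by (cases "k = 2") auto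
    interpret middle_johnson_2 k G by unfold_locales (rule k, rule False)
    have "ind ` H = induced_alt (2 * k) k" by (simp add: induced_alt_def H_eq)
    then show ?thesis using aut_iso G_eq card_arc_orbits ind_H assms(2) unfolding k by simp
  qed
qed

end
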